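(* Let $G$ be a locally compact Hausdorff topological group. For every character $\chi\colon G\to\mathbb R$, we have: 1. $\chi\in\Sigma^1_{\mathrm{top}}(G)$ if and only if $G$ is compactly generated along $\chi$. 2. $\chi\in\Sigma^2_{\mathrm{top}}(G)$ if and only if $G$ is compactly presented along $\chi$.
   Context: A character on $G$ is a continuous homomorphism $\chi\colon G\to\mathbb R$; $G_\chi:=\{g\in G\mid\chi(g)\ge0\}$. **$\Sigma^n_{\mathrm{top}}$.** For a set $S$, $\mathrm E S$ is the simplicial set with $n$-simplices $S^{n+1}$, the $i$-th face (degeneracy) map deleting (doubling) the $i$-th entry. $\mathcal C(G)$ is the poset of compact subsets of $G$ ordered by inclusion. For $C\in\mathcal C(G)$, $G_\chi\cdot\mathrm E C\subseteq \mathrm E G$ is the simplicial subset of all simplices $(gx_0,\dots,gx_k)$ with $g\in G_\chi$, $x_i\in C$. A filtration $(X_\alpha)_{\alpha\in A}$ of a connected simplicial set $X$ over a directed poset $A$ (simplicial subsets, increasing in $\alpha$, with union $X$) is essentially $n$-connected if for a vertex $x\in X$ (the choice is immaterial), every $k$ with $0\le k\le n$ and every $\alpha$ with $x\in X_\alpha$, there is $\beta\ge\alpha$ such that $\pi_k(X_\alpha,x)\to\pi_k(X_\beta,x)$ is trivial (homotopy groups are those of geometric realizations). $\Sigma^n_{\mathrm{top}}(G)$ is the set of characters $\chi$ for which the filtration $(G_\chi\cdot \mathrm E C)_{C\in\mathcal C(G)}$ of $\mathrm E G$ is essentially $(n-1)$-connected. **Generation along $\chi$.** For $X\subseteq G$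 put $\dot X:=X\cup X^{-1}\cup\{1\}$. The $\chi$-track of a word $x_1\cdots x_m$ is the sequence $\chi(x_1\cdots x_i)$, $0\le i\le m$; it is non-negative if all its values are $\ge 0$. $X$ generates $G$ along $\chi$ if every $g\in G_\chi$ is represented by a word in $\dot X$ of non-negative $\chi$-track. $G$ is compactly generated along $\chi$ if some compact subset of $G$ generates $G$ along $\chi$. **Presentations along $\chi$.** Given a generating set $X\subseteq G$, let $\bar X=\{\bar x\mid x\in X\}$ be a disjoint copy of $X$ (formal inverses; $\bar{\bar x}:=x$), and $X^\pm:=X\sqcup\bar X$. An $X^\pm$-word represents an element of $G$ by reading $\bar x$ as $x^{-1}$, and its $\chi$-track is defined accordingly. For $w=y_1\cdots y_k$ put $\bar w:=\bar y_k\cdots\bar y_1$. Two $X^\pm$-words are freely equivalent if they differ by a sequence of insertions and deletions of subwords $y\bar y$, $y\in X^\pm$. An $X$-relation is an $X^\pm$-word representing $1$. For a set $R$ of $X$-relations, $\dot R:=R\cup\{\bar w\mid w\in R\}$. An $X$-relation $\rho$ of non-negative $\chi$-track follows from $R$ along $\chi$ if $\rho$ is freely equivalent to a relation $w_1r_1\bar w_1\cdots w_lr_l\bar w_l$ of non-negative $\chi$-track with $r_i\in\dot R$ and $w_i$ $X^\pm$-words. $\langle X\mid R\rangle$ is a presentation of $G$ along $\chi$ if $X$ generates $G$ along $\chi$ and all $X$-relations of non-negative $\chi$-track follow from $R$ along $\chi$. It is compact if $X$ is compact and there is a uniform bound on the length of the words in $R$. $G$ is compactly presented along $\chi$ if it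 has a compact presentation along $\chi$. *)

theory Defs
  imports "HOL-Analysis.Analysis" "HOL-Homology.Simplices"
begin

section \<open>Simplicial sets\<close>

text \<open>The first argument of \<open>face\<close> and \<open>degen\<close> is the dimension of the simplex they are
  applied to.\<close>

record 's sset =
  simplices :: "nat \<Rightarrow> 's set"
  face :: "nat \<Rightarrow> nat \<Rightarrow> 's \<Rightarrow> 's"
  degen :: "nat \<Rightarrow> nat \<Rightarrow> 's \<Rightarrow> 's"

locale simplicial_set =
  fixes X :: "('s, 'm) sset_scheme"
  assumes face_in: "\<lbrakk>x \<in> simplices X (Suc n); i \<le> Suc n\<rbrakk> \<Longrightarrow> face X (Suc n) i x \<in> simplices X n"
    and degen_in: "\<lbrakk>x \<in> simplices X n; i \<le> n\<rbrakk> \<Longrightarrow> degen X n i x \<in> simplices X (Suc n)"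
    and face_face: "\<lbrakk>x \<in> simplices X (Suc (Suc n)); i < j; j \<le> Suc (Suc n)\<rbrakk> \<Longrightarrow>
      face X (Suc n) i (face X (Suc (Suc n)) j x) = face X (Suc n) (j - 1) (face X (Suc (Suc n)) i x)"
    and face_degen_less: "\<lbrakk>x \<in> simplices X (Suc n); i < j; j \<le> Suc n\<rbrakk> \<Longrightarrow>
      face X (Suc (Suc n)) i (degen X (Suc n) j x) = degen X n (j - 1) (face X (Suc n) i x)"
    and face_degen_same: "\<lbrakk>x \<in> simplices X n; j \<le> n; i = j \<or> i = Suc j\<rbrakk> \<Longrightarrow>
      face X (Suc n) i (degen X n j x) = x"
    and face_degen_greater: "\<lbrakk>x \<in> simplices X (Suc n); Suc j < i; i \<le> Suc (Suc n)\<rbrakk> \<Longrightarrow>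
      face X (Suc (Suc n)) i (degen X (Suc n) j x) = degen X n j (face X (Suc n) (i - 1) x)"
    and degen_degen: "\<lbrakk>x \<in> simplices X n; i \<le> j; j \<le> n\<rbrakk> \<Longrightarrow>
      degen X (Suc n) i (degen X n j x) = degen X (Suc n) (Suc j) (degen X n i x)"

definition simplicial_subset :: "'s sset \<Rightarrow> 's sset \<Rightarrow> bool" where
  "simplicial_subset Y X \<longleftrightarrow> simplicial_set X \<and> simplicial_set Y \<and>
     (\<forall>n. simplices Y n \<subseteq> simplices X n) \<and> face Y = face X \<and> degen Y = degen X"

text \<open>\<open>filtration X A F\<close>: the family \<open>(F a)\<^bsub>a \<in> A\<^esub>\<close> is a filtration of \<open>X\<close> over the directed
  poset \<open>A\<close>.\<close>

definition filtration :: "'s sset \<Rightarrow> 'i::order set \<Rightarrow> ('i \<Rightarrow> 's sset) \<Rightarrow> bool" where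
  "filtration X A F \<longleftrightarrow>
     A \<noteq> {} \<and> (\<forall>a\<in>A. \<forall>b\<in>A. \<exists>c\<in>A. a \<le> c \<and> b \<le> c) \<and>
     (\<forall>a\<in>A. simplicial_subset (F a) X) \<and>
     (\<forall>a\<in>A. \<forall>b\<in>A. a \<le> b \<longrightarrow> (\<forall>n. simplices (F a) n \<subseteq> simplices (F b) n)) \<and>
     (\<forall>n. simplices X n = (\<Union>a\<in>A. simplices (F a) n))"


section \<open>Geometric realization\<close>

definition quotient_topology :: "'a topology \<Rightarrow> ('a \<Rightarrow> 'b) \<Rightarrow> 'b topology" where
  "quotient_topology X f =
     topology (\<lambda>U. U \<subseteq> f ` topspace X \<and> openin X {x \<in> topspace X. f x \<in> U})"

lemma istopology_quotient:
  "istopology (\<lambda>U. U \<subseteq> f ` topspace X \<and> openin X {x \<in> topspace X. f x \<in> U})"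
proof -
  have 1: "{x \<in> topspace X. f x \<in> S \<inter> T} = {x \<in> topspace X. f x \<in> S} \<inter> {x \<in> topspace X. f x \<in> T}"
    for S T by auto
  have 2: "{x \<in> topspace X. f x \<in> \<Union>\<K>} = (\<Union>K\<in>\<K>. {x \<in> topspace X. f x \<in> K})" for \<K>
    by auto
  show ?thesis
    unfolding istopology_def 1 2 by (blast intro: openin_Int openin_Union)
qed

lemma openin_quotient_topology:
  "openin (quotient_topology X f) U \<longleftrightarrow>
     U \<subseteq> f ` topspace X \<and> openin X {x \<in> topspace X. f x \<in> U}"
  unfolding quotient_topology_def by (simp add: topology_inverse' [OF istopology_quotient])

lemma topspace_quotient_topology [simp]: "topspace (quotient_topology X f) = f ` topspace X"
proof -
  have "{x \<in> topspace X. f x \<in> f ` topspace X} = topspace X" by auto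
  then have "openin (quotient_topology X f) (f ` topspace X)"
    by (simp add: openin_quotient_topology)
  then show ?thesis
    by (metis openin_quotient_topology openin_subset openin_topspace subset_antisym)
qed

lemma quotient_map_quotient_topology: "quotient_map X (quotient_topology X f) f"
  by (simp add: quotient_map_def openin_quotient_topology)

text \<open>The map \<open>\<Delta>\<^sup>n\<^sup>+\<^sup>1 \<rightarrow> \<Delta>\<^sup>n\<close> that collapses the vertices \<open>k\<close> and \<open>k + 1\<close>. Its counterpart
  \<open>\<Delta>\<^sup>n \<rightarrow> \<Delta>\<^sup>n\<^sup>+\<^sup>1\<close> that omits the vertex \<open>k\<close> is \<^const>\<open>simplical_face\<close>.\<close>

definition simplex_collapse :: "nat \<Rightarrow> (nat \<Rightarrow> real) \<Rightarrow> nat \<Rightarrow> real" where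
  "simplex_collapse k t =
     (\<lambda>i. if i < k then t i else if i = k then t k + t (Suc k) else t (Suc i))"

definition prerealization :: "('s, 'm) sset_scheme \<Rightarrow> (nat \<times> 's \<times> (nat \<Rightarrow> real)) topology" where
  "prerealization X =
     sum_topology (\<lambda>n. prod_topology (discrete_topology (simplices X n))
                                     (subtopology (powertop_real UNIV) (standard_simplex n))) UNIV"

inductive_set realization_gluing ::
    "('s, 'm) sset_scheme \<Rightarrow> ((nat \<times> 's \<times> (nat \<Rightarrow> real)) \<times> (nat \<times> 's \<times> (nat \<Rightarrow> real))) set"
  for X :: "('s, 'm) sset_scheme" where
  face: "\<lbrakk>x \<in> simplices X (Suc n); t \<in> standard_simplex n; i \<le> Suc n\<rbrakk> \<Longrightarrow>
     ((Suc n, x, simplical_face i t), (n, face X (Suc n) i x, t)) \<in> realization_gluing X"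
| degen: "\<lbrakk>x \<in> simplices X n; t \<in> standard_simplex (Suc n); i \<le> n\<rbrakk> \<Longrightarrow>
     ((n, x, simplex_collapse i t), (Suc n, degen X n i x, t)) \<in> realization_gluing X"

definition realization_rel ::
    "('s, 'm) sset_scheme \<Rightarrow> ((nat \<times> 's \<times> (nat \<Rightarrow> real)) \<times> (nat \<times> 's \<times> (nat \<Rightarrow> real))) set" where
  "realization_rel X =
     Restr ((realization_gluing X \<union> (realization_gluing X)\<inverse>)\<^sup>*) (topspace (prerealization X))"

definition realization :: "('s, 'm) sset_scheme \<Rightarrow> (nat \<times> 's \<times> (nat \<Rightarrow> real)) set topology" where
  "realization X = quotient_topology (prerealization X) (\<lambda>p. realization_rel X `` {p})"

text \<open>The map \<open>|Y| \<rightarrow> |X|\<close> induced by the inclusion of a simplicial subset \<open>Y\<close> of \<open>X\<close>. A point of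
  \<open>|Y|\<close> is an equivalence class of \<open>Y\<close>, which in general is properly contained in the equivalence
  class of \<open>X\<close> that it is sent to.\<close>

definition realization_inclusion ::
    "'s sset \<Rightarrow> 's sset \<Rightarrow> (nat \<times> 's \<times> (nat \<Rightarrow> real)) set \<Rightarrow> (nat \<times> 's \<times> (nat \<Rightarrow> real)) set" where
  "realization_inclusion Y X c = realization_rel X `` c"

definition vertex_point :: "'s sset \<Rightarrow> 's \<Rightarrow> (nat \<times> 's \<times> (nat \<Rightarrow> real)) set" where
  "vertex_point X x = realization_rel X `` {(0, x, \<lambda>i. if i = 0 then 1 else 0)}"

lemma topspace_prerealization:
  "topspace (prerealization X) = {(n, x, t). x \<in> simplices X n \<and> t \<in> standard_simplex n}"
  by (auto simp: prerealization_def)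

lemma equiv_realization_rel: "equiv (topspace (prerealization X)) (realization_rel X)"
proof (rule equivI)
  have "sym ((realization_gluing X \<union> (realization_gluing X)\<inverse>)\<^sup>*)"
    by (intro sym_rtrancl) (auto simp: sym_def)
  then show "sym (realization_rel X)"
    unfolding realization_rel_def sym_def by blast
  show "trans (realization_rel X)"
    unfolding realization_rel_def trans_def by (blast intro: rtrancl_trans)
qed (auto simp: realization_rel_def refl_on_def)

lemma realization_inclusion_class:
  assumes "simplicial_subset Y X" "p \<in> topspace (prerealization Y)"
  shows "realization_inclusion Y X (realization_rel Y `` {p}) = realization_rel X `` {p}"
proof -
  have sub: "simplices Y n \<subseteq> simplices X n" "face Y = face X" "degen Y = degen X" for n
    using assms(1) by (auto simp: simplicial_subset_def)
  have "realization_gluing Y \<subseteq> realization_gluing X"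
  proof (rule subsetI)
    fix z assume z: "z \<in> realization_gluing Y"
    obtain m x s n y t where eq: "z = ((m, x, s), (n, y, t))"
      by (metis prod.exhaust)
    show "z \<in> realization_gluing X"
      using z unfolding eq
      by cases (use sub in \<open>auto intro: realization_gluing.intros\<close>)
  qed
  then have "(realization_gluing Y \<union> (realization_gluing Y)\<inverse>)\<^sup>*
      \<subseteq> (realization_gluing X \<union> (realization_gluing X)\<inverse>)\<^sup>*"
    by (intro rtrancl_mono) blast
  moreover have "topspace (prerealization Y) \<subseteq> topspace (prerealization X)"
    using sub(1) by (auto simp: topspace_prerealization)
  ultimately have le: "realization_rel Y \<subseteq> realization_rel X"
    unfolding realization_rel_def by blast
  have "(p, p) \<in> realization_rel Y"
    using assms(2) by (simp add: realization_rel_def)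
  moreover have "trans (realization_rel X)"
    using equiv_realization_rel by (rule equivE)
  ultimately show ?thesis
    unfolding realization_inclusion_def using le by (blast dest: transD)
qed


section \<open>Homotopy groups\<close>

text \<open>\<open>\<pi>\<^sub>k(X, x)\<close> consists of the homotopy classes, relative to the boundary, of maps from the
  \<open>k\<close>-cube to \<open>X\<close> that are constant \<open>x\<close> on the boundary. For \<open>k = 0\<close> the cube is a point with empty
  boundary, which gives the set of path components. Only triviality of induced maps is needed, so
  only the pointed set underlying the group is introduced.\<close>

definition cube :: "nat \<Rightarrow> (nat \<Rightarrow> real) topology" where
  "cube k = product_topology (\<lambda>_. top_of_set {0..1}) {..<k}"

definition cube_boundary :: "nat \<Rightarrow> (nat \<Rightarrow> real) set" where
  "cube_boundary k = {u \<in> topspace (cube k). \<exists>i<k. u i = 0 \<or> u i = 1}"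

definition spheroids :: "nat \<Rightarrow> 'a topology \<Rightarrow> 'a \<Rightarrow> ((nat \<Rightarrow> real) \<Rightarrow> 'a) set" where
  "spheroids k X x = {f. continuous_map (cube k) X f \<and> f ` cube_boundary k \<subseteq> {x}}"

definition spheroid_homotopy ::
    "nat \<Rightarrow> 'a topology \<Rightarrow> 'a \<Rightarrow> (((nat \<Rightarrow> real) \<Rightarrow> 'a) \<times> ((nat \<Rightarrow> real) \<Rightarrow> 'a)) set" where
  "spheroid_homotopy k X x =
     {(f, g). homotopic_with (\<lambda>h. h ` cube_boundary k \<subseteq> {x}) (cube k) X f g}"

definition homotopy_group :: "nat \<Rightarrow> 'a topology \<Rightarrow> 'a \<Rightarrow> ((nat \<Rightarrow> real) \<Rightarrow> 'a) set set" where
  "homotopy_group k X x = spheroids k X x // spheroid_homotopy k X x"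

definition homotopy_group_one :: "nat \<Rightarrow> 'a topology \<Rightarrow> 'a \<Rightarrow> ((nat \<Rightarrow> real) \<Rightarrow> 'a) set" where
  "homotopy_group_one k X x = spheroid_homotopy k X x `` {\<lambda>_. x}"

definition homotopy_group_map ::
    "nat \<Rightarrow> ('a \<Rightarrow> 'b) \<Rightarrow> 'b topology \<Rightarrow> 'b \<Rightarrow> ((nat \<Rightarrow> real) \<Rightarrow> 'a) set \<Rightarrow> ((nat \<Rightarrow> real) \<Rightarrow> 'b) set" where
  "homotopy_group_map k \<phi> Y y c = spheroid_homotopy k Y y `` ((\<lambda>f. \<phi> \<circ> f) ` c)"

lemma equiv_spheroid_homotopy:
  "equiv (spheroids k X x) (spheroid_homotopy k X x)"
proof (rule equivI)
  show "spheroid_homotopy k X x \<subseteq> spheroids k X x \<times> spheroids k X x"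
    by (auto simp: spheroid_homotopy_def spheroids_def
        dest: homotopic_with_imp_continuous_maps homotopic_with_imp_property)
  show "refl_on (spheroids k X x) (spheroid_homotopy k X x)"
    by (auto simp: spheroid_homotopy_def spheroids_def refl_on_def)
  show "sym (spheroid_homotopy k X x)"
    by (auto simp: spheroid_homotopy_def sym_def homotopic_with_sym)
  show "trans (spheroid_homotopy k X x)"
    by (auto simp: spheroid_homotopy_def trans_def intro: homotopic_with_trans)
qed

lemma homotopy_group_map_class:
  assumes "continuous_map X Y \<phi>" "\<phi> x = y" "f \<in> spheroids k X x"
  shows "homotopy_group_map k \<phi> Y y (spheroid_homotopy k X x `` {f})
           = spheroid_homotopy k Y y `` {\<phi> \<circ> f}"
proof -
  have "(\<phi> \<circ> f, \<phi> \<circ> g) \<in> spheroid_homotopy k Y y" if "(f, g) \<in> spheroid_homotopy k X x" for g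
  proof -
    have "homotopic_with (\<lambda>h. h ` cube_boundary k \<subseteq> {x}) (cube k) X f g"
      using that by (simp add: spheroid_homotopy_def)
    then have "homotopic_with (\<lambda>h. h ` cube_boundary k \<subseteq> {y}) (cube k) Y (\<phi> \<circ> f) (\<phi> \<circ> g)"
      by (rule homotopic_with_compose_continuous_map_left [OF _ assms(1)])
         (use assms(2) in force)
    then show ?thesis
      by (simp add: spheroid_homotopy_def)
  qed
  moreover have "(f, f) \<in> spheroid_homotopy k X x"
    using equiv_spheroid_homotopy assms(3) by (rule equiv_class_self [unfolded Image_singleton_iff])
  moreover have "sym (spheroid_homotopy k Y y)" "trans (spheroid_homotopy k Y y)"
    using equiv_spheroid_homotopy[of k Y y] by (auto elim: equivE)
  ultimately show ?thesis
    unfolding homotopy_group_map_def by (blast dest: transD symD)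
qed

definition trivial_on_homotopy_group ::
    "nat \<Rightarrow> 'a topology \<Rightarrow> 'a \<Rightarrow> ('a \<Rightarrow> 'b) \<Rightarrow> 'b topology \<Rightarrow> 'b \<Rightarrow> bool" where
  "trivial_on_homotopy_group k X x \<phi> Y y \<longleftrightarrow>
     (\<forall>c \<in> homotopy_group k X x. homotopy_group_map k \<phi> Y y c = homotopy_group_one k Y y)"

definition essentially_connected ::
    "int \<Rightarrow> 's sset \<Rightarrow> 'i::order set \<Rightarrow> ('i \<Rightarrow> 's sset) \<Rightarrow> bool" where
  "essentially_connected n X A F \<longleftrightarrow>
     (\<exists>x \<in> simplices X 0. \<forall>k. int k \<le> n \<longrightarrow> (\<forall>\<alpha>\<in>A. x \<in> simplices (F \<alpha>) 0 \<longrightarrow>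
        (\<exists>\<beta>\<in>A. \<alpha> \<le> \<beta> \<and>
           trivial_on_homotopy_group k
             (realization (F \<alpha>)) (vertex_point (F \<alpha>) x)
             (realization_inclusion (F \<alpha>) (F \<beta>))
             (realization (F \<beta>)) (vertex_point (F \<beta>) x))))"


section \<open>Characters and \<open>\<Sigma>\<^sup>n\<^sub>t\<^sub>o\<^sub>p\<close>\<close>

text \<open>Following the library class \<^class>\<open>topological_group_add\<close>, the group \<open>G\<close> is a type and its
  operation is written additively, although it need not be commutative.\<close>

definition is_character :: "('a::topological_group_add \<Rightarrow> real) \<Rightarrow> bool" where
  "is_character chi \<longleftrightarrow> continuous_on UNIV chi \<and> (\<forall>x y. chi (x + y) = chi x + chi y)"

definition half :: "('a \<Rightarrow> real) \<Rightarrow> 'a set" where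
  "half chi = {g. 0 \<le> chi g}"

definition E_sset :: "'a set \<Rightarrow> 'a list sset" where
  "E_sset S = \<lparr>simplices = \<lambda>n. {xs. length xs = Suc n \<and> set xs \<subseteq> S},
          face = \<lambda>n i xs. take i xs @ drop (Suc i) xs,
          degen = \<lambda>n i xs. take (Suc i) xs @ drop i xs\<rparr>"

definition half_orbit :: "('a::group_add \<Rightarrow> real) \<Rightarrow> 'a set \<Rightarrow> 'a list sset" where
  "half_orbit chi C =
     (E_sset UNIV)\<lparr>simplices := \<lambda>n. {map ((+) g) xs |g xs. g \<in> half chi \<and> xs \<in> simplices (E_sset C) n}\<rparr>"

definition Sigma_top :: "nat \<Rightarrow> ('a::topological_group_add \<Rightarrow> real) set" where
  "Sigma_top n =
     {chi. is_character chi \<and> essentially_connected (int n - 1) (E_sset UNIV) {C. compact C} (half_orbit chi)}"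

lemma simplicial_set_E: "simplicial_set (E_sset S)"
proof
qed (auto simp: E_sset_def dest!: in_set_takeD in_set_dropD intro!: nth_equalityI
      simp: nth_append less_diff_conv)

lemma simplices_half_orbit:
  "simplices (half_orbit chi C) n =
     {map ((+) g) xs |g xs. 0 \<le> chi g \<and> length xs = Suc n \<and> set xs \<subseteq> C}"
  by (simp add: half_orbit_def half_def E_sset_def)

lemma simplicial_subset_half_orbit: "simplicial_subset (half_orbit chi C) (E_sset UNIV)"
proof -
  interpret E: simplicial_set "E_sset UNIV :: 'a list sset" by (rule simplicial_set_E)
  have ops: "face (half_orbit chi C) = face (E_sset UNIV)" "degen (half_orbit chi C) = degen (E_sset UNIV)"
    by (simp_all add: half_orbit_def)
  have sub: "simplices (half_orbit chi C) n \<subseteq> simplices (E_sset UNIV) n" for n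
    by (auto simp: simplices_half_orbit E_sset_def)
  have "simplicial_set (half_orbit chi C)"
  proof
    fix x :: "'a list" and n i :: nat
    assume "x \<in> simplices (half_orbit chi C) (Suc n)" "i \<le> Suc n"
    then obtain g xs where x: "x = map ((+) g) xs" "0 \<le> chi g" "length xs = Suc (Suc n)" "set xs \<subseteq> C"
      by (auto simp: simplices_half_orbit)
    have "xs \<in> simplices (E_sset C) (Suc n)" using x by (simp add: E_sset_def)
    then have "face (E_sset C) (Suc n) i xs \<in> simplices (E_sset C) n"
      using simplicial_set.face_in[OF simplicial_set_E] \<open>i \<le> Suc n\<close> by blast
    moreover have "face (E_sset UNIV) (Suc n) i x = map ((+) g) (face (E_sset C) (Suc n) i xs)"
      by (simp add: E_sset_def x take_map drop_map)
    ultimately show "face (half_orbit chi C) (Suc n) i x \<in> simplices (half_orbit chi C) n"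
      using x(2) by (auto simp: half_orbit_def half_def)
  next
    fix x :: "'a list" and n i :: nat
    assume "x \<in> simplices (half_orbit chi C) n" "i \<le> n"
    then obtain g xs where x: "x = map ((+) g) xs" "0 \<le> chi g" "length xs = Suc n" "set xs \<subseteq> C"
      by (auto simp: simplices_half_orbit)
    have "xs \<in> simplices (E_sset C) n" using x by (simp add: E_sset_def)
    then have "degen (E_sset C) n i xs \<in> simplices (E_sset C) (Suc n)"
      using simplicial_set.degen_in[OF simplicial_set_E] \<open>i \<le> n\<close> by blast
    moreover have "degen (E_sset UNIV) n i x = map ((+) g) (degen (E_sset C) n i xs)"
      by (simp add: E_sset_def x take_map drop_map)
    ultimately show "degen (half_orbit chi C) n i x \<in> simplices (half_orbit chi C) (Suc n)"
      using x(2) by (auto simp: half_orbit_def half_def)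
  qed (unfold ops, insert sub, (blast intro: E.face_face E.face_degen_less E.face_degen_same
         E.face_degen_greater E.degen_degen)+)
  then show ?thesis
    using sub by (simp add: simplicial_subset_def simplicial_set_E ops)
qed

lemma filtration_half_orbit:
  assumes "is_character chi"
  shows "filtration (E_sset UNIV) {C. compact C} (half_orbit chi)"
  unfolding filtration_def
proof (intro conjI ballI allI impI)
  show "{C::'a set. compact C} \<noteq> {}" by blast
next
  fix a b :: "'a set" assume "a \<in> {C. compact C}" "b \<in> {C. compact C}"
  then show "\<exists>c\<in>{C. compact C}. a \<le> c \<and> b \<le> c"
    by (intro bexI[of _ "a \<union> b"]) (auto intro: compact_Un)
next
  fix a b :: "'a set" and n assume "a \<le> b"
  then show "simplices (half_orbit chi a) n \<subseteq> simplices (half_orbit chi b) n"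
    unfolding simplices_half_orbit by blast
next
  fix n
  have "chi (0 + 0) = chi 0 + chi 0"
    using assms unfolding is_character_def by blast
  then have chi0: "chi 0 = 0" by simp
  have "xs \<in> simplices (half_orbit chi (set xs)) n" if "xs \<in> simplices (E_sset UNIV) n" for xs
  proof -
    have "xs = map ((+) 0) xs" by (simp add: map_idI)
    moreover have "length xs = Suc n" using that by (simp add: E_sset_def)
    ultimately show ?thesis
      unfolding simplices_half_orbit using chi0 by force
  qed
  moreover have "compact (set xs)" for xs :: "'a list"
    by (simp add: finite_imp_compact)
  ultimately show "simplices (E_sset UNIV) n = (\<Union>C\<in>{C. compact C}. simplices (half_orbit chi C) n)"
    using simplicial_subset_half_orbit[of chi] unfolding simplicial_subset_def by blast
qed (rule simplicial_subset_half_orbit)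


section \<open>Generation and presentations along a character\<close>

definition nonneg_track :: "('a::group_add \<Rightarrow> real) \<Rightarrow> 'a list \<Rightarrow> bool" where
  "nonneg_track chi w \<longleftrightarrow> (\<forall>i \<le> length w. 0 \<le> chi (sum_list (take i w)))"

definition generates_along :: "('a::group_add \<Rightarrow> real) \<Rightarrow> 'a set \<Rightarrow> bool" where
  "generates_along chi X \<longleftrightarrow>
     (\<forall>g \<in> half chi. \<exists>w \<in> lists (X \<union> uminus ` X \<union> {0}). sum_list w = g \<and> nonneg_track chi w)"

definition compactly_generated_along :: "('a::topological_group_add \<Rightarrow> real) \<Rightarrow> bool" where
  "compactly_generated_along chi \<longleftrightarrow> (\<exists>X. compact X \<and> generates_along chi X)"

text \<open>The letters of \<open>X\<^sup>\<plusminus>\<close> are \<open>X <+> X\<close>, where \<open>Inl x\<close> stands for \<open>x\<close> and \<open>Inr x\<close> for the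
  formal inverse of \<open>x\<close>.\<close>

type_synonym 'a letter = "'a + 'a"

definition bar_letter :: "'a letter \<Rightarrow> 'a letter" where
  "bar_letter = case_sum Inr Inl"

definition bar_word :: "'a letter list \<Rightarrow> 'a letter list" where
  "bar_word w = rev (map bar_letter w)"

definition read_letter :: "'a::group_add letter \<Rightarrow> 'a" where
  "read_letter = case_sum id uminus"

definition words :: "'a set \<Rightarrow> 'a letter list set" where
  "words X = lists (X <+> X)"

definition relations :: "'a::group_add set \<Rightarrow> 'a letter list set" where
  "relations X = {w \<in> words X. sum_list (map read_letter w) = 0}"

definition nonneg_relations :: "('a::group_add \<Rightarrow> real) \<Rightarrow> 'a set \<Rightarrow> 'a letter list set" where
  "nonneg_relations chi X = {w \<in> relations X. nonneg_track chi (map read_letter w)}"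

inductive free_insertion :: "'a set \<Rightarrow> 'a letter list \<Rightarrow> 'a letter list \<Rightarrow> bool" for X where
  "\<lbrakk>u \<in> words X; v \<in> words X; y \<in> X <+> X\<rbrakk> \<Longrightarrow>
     free_insertion X (u @ v) (u @ [y, bar_letter y] @ v)"

definition freely_equivalent :: "'a set \<Rightarrow> 'a letter list \<Rightarrow> 'a letter list \<Rightarrow> bool" where
  "freely_equivalent X = equivclp (free_insertion X)"

definition follows_along ::
    "('a::group_add \<Rightarrow> real) \<Rightarrow> 'a set \<Rightarrow> 'a letter list set \<Rightarrow> 'a letter list \<Rightarrow> bool" where
  "follows_along chi X R \<rho> \<longleftrightarrow>
     (\<exists>wrs \<in> lists (words X \<times> (R \<union> bar_word ` R)).
        let \<tau> = concat (map (\<lambda>(w, r). w @ r @ bar_word w) wrs)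
        in \<tau> \<in> nonneg_relations chi X \<and> freely_equivalent X \<rho> \<tau>)"

definition presentation_along ::
    "('a::group_add \<Rightarrow> real) \<Rightarrow> 'a set \<Rightarrow> 'a letter list set \<Rightarrow> bool" where
  "presentation_along chi X R \<longleftrightarrow>
     R \<subseteq> relations X \<and> generates_along chi X \<and>
     (\<forall>\<rho> \<in> nonneg_relations chi X. follows_along chi X R \<rho>)"

definition compactly_presented_along :: "('a::topological_group_add \<Rightarrow> real) \<Rightarrow> bool" where
  "compactly_presented_along chi \<longleftrightarrow>
     (\<exists>X R. presentation_along chi X R \<and> compact X \<and> (\<exists>N. \<forall>r \<in> R. length r \<le> N))"

end

theory Submission
  imports Defs
begin

text \<open>The simplicial set \<open>G\<^sub>\<chi> \<cdot> EC\<close> consists of all tuples whose entries lie in one translate \<open>g C\<close> with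
  \<open>g \<in> G\<^sub>\<chi>\<close>. For such a simplicial set, \<open>\<pi>\<^sub>0\<close> and \<open>\<pi>\<^sub>1\<close> of the realization are computed by edge
  paths modulo triangles: the open stars of the vertices cover the realization, vertices whose stars
  have a common point span a simplex, and a star can be coned off to its vertex. Hence paths are
  homotopic to edge paths, and a null homotopy, cut along a fine grid, yields a combinatorial one.

  An edge path in \<open>G\<^sub>\<chi> \<cdot> EC\<close> passes through translates \<open>g C\<close>, and moving from one to the next
  multiplies \<open>g\<close> by an element of a fixed compact set; so edge paths correspond to words of
  non-negative track. Conversely a word traces an edge path. For \<open>\<pi>\<^sub>1\<close> the elements of that compact
  set must be written as words of bounded length, which Baire's theorem for the locally compact space
  \<open>G\<^sub>\<chi>\<close> provides: then triangles become relators of bounded length, and a relator of bounded length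
  traces a loop inside one simplex of \<open>G\<^sub>\<chi> \<cdot> ED\<close> for a larger compact set \<open>D\<close>.\<close>

section \<open>Edge paths in abstract simplicial complexes\<close>

text \<open>The obstacle is height. Words have to stay in the half space, but the vertices of a
  translate \<open>g + C\<close> need not lie there. So words are attached to base points
  \<open>g\<close> in \<open>half chi\<close> of translates that contain a given vertex, not to the
  vertices themselves. The difference of two such base points may descend; then its inverse ascends
  and has a bounded word, and this word read backwards between two points of the half space never
  drops below height 0. The base vertex in the definition of \<open>Sigma_top\<close> is an
  arbitrary \<open>x\<close>. Walks are therefore translated by \<open>x\<close> on the right, which
  commutes with the left action of the group. On the topological side, a point of the realization
  has many representatives, whose tuples and coordinates differ. The set of entries of positive
  weight is common to all of them, so stars are defined by it, and a star is contracted by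
  prepending its centre to a representative.\<close>

inductive edge_step :: "('a set \<Rightarrow> bool) \<Rightarrow> 'a list \<Rightarrow> 'a list \<Rightarrow> bool" for K where
  triangle: "K {u, v, w} \<Longrightarrow> edge_step K (p @ [u, v, w] @ q) (p @ [u, w] @ q)"
| stutter: "K {u} \<Longrightarrow> edge_step K (p @ [u, u] @ q) (p @ [u] @ q)"

text \<open>Backtracking is included: the triangle rule with \<open>w = u\<close> turns
  \<open>u v u\<close> into \<open>u u\<close>, and the stutter rule leaves
  \<open>u\<close>.\<close>

definition edge_homotopic :: "('a set \<Rightarrow> bool) \<Rightarrow> 'a list \<Rightarrow> 'a list \<Rightarrow> bool" where
  "edge_homotopic K = equivclp (edge_step K)"

definition edge_path :: "('a set \<Rightarrow> bool) \<Rightarrow> 'a list \<Rightarrow> bool" where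
  "edge_path K p \<longleftrightarrow> p \<noteq> [] \<and> K {hd p} \<and> successively (\<lambda>u v. K {u, v}) p"

text \<open>\<open>K\<close> need not be closed under subsets here, so the statement about the tail
  is guarded by \<open>K {v}\<close>.\<close>

lemma edge_path_simps [simp]:
  "edge_path K [u] \<longleftrightarrow> K {u}"
  "edge_path K (u # v # p) \<longleftrightarrow> K {u} \<and> K {u, v} \<and> (K {v} \<longrightarrow> edge_path K (v # p)) \<and> successively (\<lambda>u v. K {u, v}) (v # p)"
  by (auto simp: edge_path_def)

lemma edge_homotopic_refl [simp]: "edge_homotopic K p p"
  and edge_homotopic_sym: "edge_homotopic K p q \<Longrightarrow> edge_homotopic K q p"
  and edge_homotopic_trans [trans]: "edge_homotopic K p q \<Longrightarrow> edge_homotopic K q r \<Longrightarrow> edge_homotopic K p r"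
  unfolding edge_homotopic_def by (auto intro: equivclp_sym equivclp_trans)

lemma edge_homotopic_step: "edge_step K p q \<Longrightarrow> edge_homotopic K p q"
  unfolding edge_homotopic_def by (rule r_into_equivclp)

lemma edge_step_context: "edge_step K p q \<Longrightarrow> edge_step K (a @ p @ b) (a @ q @ b)"
proof (induction rule: edge_step.induct)
  case (triangle u v w p q)
  then show ?case using edge_step.triangle[of K u v w "a @ p" "q @ b"] by simp
next
  case (stutter u p q)
  then show ?case using edge_step.stutter[of K u "a @ p" "q @ b"] by simp
qed

lemma edge_homotopic_context:
  assumes "edge_homotopic K p q"
  shows "edge_homotopic K (a @ p @ b) (a @ q @ b)"
  using assms unfolding edge_homotopic_def
proof (induction rule: equivclp_induct)
  case base
  then show ?case by simp
next
  case (step y z)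
  then have "edge_step K (a @ y @ b) (a @ z @ b) \<or> edge_step K (a @ z @ b) (a @ y @ b)"
    using edge_step_context by blast
  then show ?case using step.IH
    by (meson equivclp_into_equivclp)
qed

lemma edge_homotopic_triangle:
  "K {u, v, w} \<Longrightarrow> edge_homotopic K (p @ u # v # w # q) (p @ u # w # q)"
  using edge_homotopic_step[OF edge_step.triangle[of K u v w p q]] by simp

lemma edge_homotopic_stutter:
  "K {u} \<Longrightarrow> edge_homotopic K (p @ u # u # q) (p @ u # q)"
  using edge_homotopic_step[OF edge_step.stutter[of K u p q]] by simp

locale subset_closed =
  fixes K :: "'a set \<Rightarrow> bool"
  assumes subset_closed: "K S \<Longrightarrow> T \<subseteq> S \<Longrightarrow> K T"
begin

lemma edge_step_edge_path:
  assumes "edge_step K p q"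
  shows "edge_path K p \<longleftrightarrow> edge_path K q" "hd p = hd q" "last p = last q" "p \<noteq> []" "q \<noteq> []"
proof -
  show "edge_path K p \<longleftrightarrow> edge_path K q"
    using assms
  proof cases
    case (triangle u v w a b)
    then have "K {u, v}" "K {v, w}" "K {u, w}" "K {u}"
      by (auto intro: subset_closed)
    then show ?thesis using triangle
      by (cases a) (auto simp: edge_path_def successively_append_iff successively_Cons hd_append)
  next
    case (stutter u a b)
    then show ?thesis
      by (cases a) (auto simp: edge_path_def successively_append_iff successively_Cons hd_append)
  qed
  show "hd p = hd q" "last p = last q" "p \<noteq> []" "q \<noteq> []"
    using assms by (cases; auto simp: hd_append)+
qed

lemma simplex_edge_homotopic:
  assumes "K (set p)" "p \<noteq> []"
  shows "edge_homotopic K p [hd p, last p]"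
  using assms
proof (induction p)
  case Nil
  then show ?case by simp
next
  case (Cons u p)
  show ?case
  proof (cases p)
    case Nil
    \<comment> \<open>The target is \<open>[u, u]\<close>, so the stutter rule is applied
      backwards.\<close>
    then show ?thesis
      using edge_homotopic_stutter[of K u "[]" "[]"] Cons.prems by (auto intro: edge_homotopic_sym)
  next
    case (Cons v q)
    have "K (set p)" using Cons.prems(1) by (rule subset_closed) auto
    then have "edge_homotopic K p [hd p, last p]" using Cons.IH Cons by auto
    then have "edge_homotopic K (u # p) [u, hd p, last p]"
      using edge_homotopic_context[of K p _ "[u]" "[]"] by simp
    also have "K {u, hd p, last p}"
      using Cons by (intro subset_closed[OF Cons.prems(1)]) auto
    then have "edge_homotopic K [u, hd p, last p] [u, last p]"
      using edge_homotopic_triangle[of K u "hd p" "last p" "[]" "[]"] by simp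
    finally show ?thesis using Cons by simp
  qed
qed

lemma simplex_edge_homotopic_eq:
  assumes "K (set p \<union> set q)" "p \<noteq> []" "q \<noteq> []" "hd p = hd q" "last p = last q"
  shows "edge_homotopic K (a @ p @ b) (a @ q @ b)"
proof (rule edge_homotopic_context)
  have "K (set p)" "K (set q)" using assms(1) by (auto intro: subset_closed)
  then show "edge_homotopic K p q"
    using simplex_edge_homotopic assms by (metis edge_homotopic_sym edge_homotopic_trans)
qed

lemma ladder_edge_homotopic:
  assumes K: "\<And>j. j < n \<Longrightarrow> K {a j, a (Suc j), b j, b (Suc j)}"
    and eq: "a 0 = b 0" "a n = b n" and "0 < n"
  shows "edge_homotopic K (map a [0..<Suc n]) (map b [0..<Suc n])"
proof -
  \<comment> \<open>\<open>P k\<close> follows \<open>b\<close> up to index \<open>k\<close>,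
    crosses the rung to \<open>a k\<close> and continues along \<open>a\<close>. Moving the crossing
    by one rung changes the path within one simplex; \<open>P 0\<close> and \<open>P n\<close> are
    \<open>a\<close> and \<open>b\<close> up to a stutter at the common end.\<close>
  define P where "P k = map b [0..<Suc k] @ map a [k..<Suc n]" for k
  have "edge_homotopic K (P 0) (P k)" if "k \<le> n" for k
    using that
  proof (induction k)
    case (Suc k)
    have ka: "[k..<Suc n] = k # Suc k # [Suc (Suc k)..<Suc n]"
      using Suc.prems by (simp add: upt_conv_Cons)
    have ks: "[Suc k..<Suc n] = Suc k # [Suc (Suc k)..<Suc n]"
      using Suc.prems by (simp add: upt_conv_Cons)
    have "edge_homotopic K (map b [0..<k] @ [b k, a k, a (Suc k)] @ map a [Suc (Suc k)..<Suc n])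
       (map b [0..<k] @ [b k, b (Suc k), a (Suc k)] @ map a [Suc (Suc k)..<Suc n])"
      by (rule simplex_edge_homotopic_eq) (use K[of k] Suc.prems in \<open>auto elim: subset_closed\<close>)
    then have "edge_homotopic K (P k) (P (Suc k))"
      by (simp add: P_def ka ks del: upt_Suc) (simp add: upt_Suc)
    then show ?case using Suc by (meson Suc_leD edge_homotopic_trans)
  qed simp
  then have "edge_homotopic K (P 0) (P n)" by simp
  moreover have "K {a 0}" "K {b n}"
    using K[of 0] K[of "n - 1"] \<open>0 < n\<close> by (auto elim: subset_closed)
  then have "edge_homotopic K (P 0) (map a [0..<Suc n])"
    using edge_homotopic_stutter[of K "a 0" "[]" "map a [1..<Suc n]"] eq
    by (simp add: P_def upt_conv_Cons del: upt_Suc)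
  moreover have "edge_homotopic K (P n) (map b [0..<Suc n])"
    using edge_homotopic_stutter[of K "b n" "map b [0..<n]" "[]"] eq \<open>K {b n}\<close>
    by (simp add: P_def)
  ultimately show ?thesis
    by (meson edge_homotopic_sym edge_homotopic_trans)
qed

lemma replicate_edge_homotopic:
  assumes "K {u}"
  shows "edge_homotopic K (a @ replicate (Suc n) u @ b) (a @ u # b)"
proof -
  have "K (set (replicate (Suc n) u) \<union> set [u])"
    by (rule subset_closed[OF assms]) auto
  then show ?thesis
    using simplex_edge_homotopic_eq[of "replicate (Suc n) u" "[u]" a b] by auto
qed

text \<open>Compares an edge path with its refinement on a grid \<open>L\<close> times as fine,
  where each vertex is a run of \<open>L\<close> stutters.\<close>

lemma slow_path_edge_homotopic:
  assumes "\<And>i. i < m \<Longrightarrow> K {v i}" and "0 < L"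
  shows "edge_homotopic K (map (\<lambda>j. v (j div L)) [0..<m * L] @ q) (map v [0..<m] @ q)"
  using assms(1)
proof (induction m arbitrary: q)
  case (Suc m)
  obtain l where l: "L = Suc l" using \<open>0 < L\<close> by (cases L) auto
  have "map (\<lambda>j. v (j div L)) [m * L..<m * L + L] = replicate L (v m)"
    using \<open>0 < L\<close> by (intro nth_equalityI) auto
  then have "map (\<lambda>j. v (j div L)) [0..<Suc m * L] @ q =
      map (\<lambda>j. v (j div L)) [0..<m * L] @ (replicate L (v m) @ q)"
    using upt_add_eq_append[of 0 "m * L" L] by (simp add: add.commute)
  also have "edge_homotopic K \<dots> (map v [0..<m] @ (replicate L (v m) @ q))"
    using Suc by simp
  also have "edge_homotopic K \<dots> (map v [0..<m] @ v m # q)"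
    unfolding l by (rule replicate_edge_homotopic) (use Suc in auto)
  finally show ?case by simp
qed simp

end

section \<open>Words and tracks\<close>

abbreviation val :: "'a::group_add letter list \<Rightarrow> 'a" where
  "val w \<equiv> sum_list (map read_letter w)"

lemmas group_simps = diff_conv_add_uminus minus_add add.assoc

lemma bar_letter_simps [simp]:
  "bar_letter (Inl x) = Inr x" "bar_letter (Inr x) = Inl x"
  "bar_letter (bar_letter y) = y"
  by (simp_all add: bar_letter_def split: sum.split)

lemma bar_letter_in [simp]: "bar_letter y \<in> X <+> X \<longleftrightarrow> y \<in> X <+> X"
  by (cases y) auto

lemma read_bar_letter [simp]: "read_letter (bar_letter y) = - read_letter y"
  by (cases y) (auto simp: read_letter_def)

lemma bar_word_simps [simp]:
  "bar_word [] = []" "bar_word (y # w) = bar_word w @ [bar_letter y]"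
  "bar_word (u @ v) = bar_word v @ bar_word u" "length (bar_word w) = length w"
  "bar_word (bar_word w) = w"
  by (auto simp: bar_word_def rev_map[symmetric] o_def)

lemma words_simps [simp]:
  "[] \<in> words X" "y # w \<in> words X \<longleftrightarrow> y \<in> X <+> X \<and> w \<in> words X"
  "u @ v \<in> words X \<longleftrightarrow> u \<in> words X \<and> v \<in> words X"
  by (auto simp: words_def)

lemma bar_word_in_words [simp]: "bar_word w \<in> words X \<longleftrightarrow> w \<in> words X"
  by (induction w) auto

lemma word_value_bar [simp]: "val (bar_word w) = - val w"
  by (induction w) (auto simp: minus_add)

text \<open>Recursive form of \<open>nonneg_track\<close> that carries the current height, so that a
  factor of a word can be examined from the height at which it starts.\<close>

primrec track_from :: "('a::group_add \<Rightarrow> real) \<Rightarrow> real \<Rightarrow> 'a list \<Rightarrow> bool" where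
  "track_from chi h [] \<longleftrightarrow> 0 \<le> h"
| "track_from chi h (x # w) \<longleftrightarrow> 0 \<le> h \<and> track_from chi (h + chi x) w"

abbreviation letter_track :: "('a::group_add \<Rightarrow> real) \<Rightarrow> real \<Rightarrow> 'a letter list \<Rightarrow> bool" where
  "letter_track chi h w \<equiv> track_from chi h (map read_letter w)"

locale additive_character =
  fixes chi :: "'a::group_add \<Rightarrow> real"
  assumes chi_add: "chi (x + y) = chi x + chi y"
begin

lemma chi_zero [simp]: "chi 0 = 0"
  using chi_add[of 0 0] by simp

lemma chi_minus [simp]: "chi (- x) = - chi x"
  using chi_add[of x "- x"] by simp

lemma chi_diff: "chi (x - y) = chi x - chi y"
  using chi_add[of x "- y"] by simp

lemma track_from_iff: "track_from chi h w \<longleftrightarrow> (\<forall>i \<le> length w. 0 \<le> h + chi (sum_list (take i w)))"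
proof (induction w arbitrary: h)
  case (Cons x w)
  have "(\<forall>i \<le> Suc n. P i) \<longleftrightarrow> P 0 \<and> (\<forall>i \<le> n. P (Suc i))" for n and P :: "nat \<Rightarrow> bool"
    by (metis Suc_le_mono le0 not0_implies_Suc)
  then show ?case by (simp add: Cons.IH chi_add add.assoc)
qed simp

lemma nonneg_track_eq: "nonneg_track chi w \<longleftrightarrow> track_from chi 0 w"
  by (simp add: nonneg_track_def track_from_iff)

lemma track_from_start: "track_from chi h w \<Longrightarrow> 0 \<le> h"
  by (cases w) auto

lemma track_from_end: "track_from chi h w \<Longrightarrow> 0 \<le> h + chi (sum_list w)"
proof (induction w arbitrary: h)
  case (Cons x w)
  then show ?case using Cons.IH[of "h + chi x"] by (simp add: chi_add add.assoc)
qed simp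

lemma track_from_append [simp]:
  "track_from chi h (u @ v) \<longleftrightarrow> track_from chi h u \<and> track_from chi (h + chi (sum_list u)) v"
  by (induction u arbitrary: h) (auto simp: chi_add add.assoc dest: track_from_start)

text \<open>The inverse word, started at the end of \<open>w\<close>, passes through the same
  heights in reverse order.\<close>

lemma letter_track_bar: "letter_track chi (h + chi (val w)) (bar_word w) \<longleftrightarrow> letter_track chi h w"
proof (induction w arbitrary: h)
  case (Cons y w)
  show ?case
    using Cons.IH[of "h + chi (read_letter y)"]
    by (auto simp: chi_add add.assoc dest: track_from_start)
qed simp

lemma nonneg_relations_iff:
  "w \<in> nonneg_relations chi X \<longleftrightarrow> w \<in> words X \<and> val w = 0 \<and> letter_track chi 0 w"
  by (auto simp: nonneg_relations_def relations_def nonneg_track_eq)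

end

section \<open>Free equivalence and consequences of relations\<close>

lemma freely_equivalent_refl [simp]: "freely_equivalent X w w"
  and freely_equivalent_sym: "freely_equivalent X u v \<Longrightarrow> freely_equivalent X v u"
  and freely_equivalent_trans [trans]:
    "freely_equivalent X u v \<Longrightarrow> freely_equivalent X v w \<Longrightarrow> freely_equivalent X u w"
  unfolding freely_equivalent_def by (auto intro: equivclp_sym equivclp_trans)

lemma freely_equivalent_context:
  assumes "freely_equivalent X u v" "a \<in> words X" "b \<in> words X"
  shows "freely_equivalent X (a @ u @ b) (a @ v @ b)"
proof -
  have ctx: "free_insertion X (a @ y @ b) (a @ z @ b)" if yz: "free_insertion X y z" for y z
    using yz
  proof cases
    case (1 u v y)
    then show ?thesis
      using free_insertion.intros[of "a @ u" X "v @ b" y] assms by simp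
  qed
  show ?thesis
    using assms(1) unfolding freely_equivalent_def
  proof (induction rule: equivclp_induct)
    case (step y z)
    then show ?case using ctx by (meson equivclp_into_equivclp)
  qed simp
qed

lemma freely_equivalent_cancel:
  assumes "a \<in> words X" "w \<in> words X" "b \<in> words X"
  shows "freely_equivalent X (a @ w @ bar_word w @ b) (a @ b)"
  using assms
proof (induction w arbitrary: a b)
  case (Cons y w)
  have "freely_equivalent X ((a @ [y]) @ w @ bar_word w @ ([bar_letter y] @ b)) ((a @ [y]) @ ([bar_letter y] @ b))"
    using Cons by (intro Cons.IH) auto
  also have "freely_equivalent X \<dots> (a @ b)"
    unfolding freely_equivalent_def
    using free_insertion.intros[of a X b y] Cons.prems
    by (intro equivclp_sym[OF r_into_equivclp]) auto
  finally show ?case by simp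
qed simp

context additive_character
begin

abbreviation conjugates :: "('a letter list \<times> 'a letter list) list \<Rightarrow> 'a letter list" where
  "conjugates wrs \<equiv> concat (map (\<lambda>(w, r). w @ r @ bar_word w) wrs)"

lemma follows_along_nil: "follows_along chi X R []"
  unfolding follows_along_def
  by (rule bexI[of _ "[]"]) (auto simp: nonneg_relations_iff)

text \<open>Replacing \<open>u\<close> by \<open>v\<close> amounts to multiplying by the conjugate of the relator \<open>v u\<inverse>\<close> by the
  prefix \<open>a\<close>; its track stays among the values of the tracks of \<open>a u\<close> and \<open>a v\<close>.\<close>

lemma follows_along_replace:
  assumes f: "follows_along chi X R (a @ u @ b)"
    and R: "\<And>r. r \<in> relations X \<Longrightarrow> length r \<le> length u + length v \<Longrightarrow> r \<in> R"
    and X: "a \<in> words X" "u \<in> words X" "v \<in> words X" "b \<in> words X"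
    and eq: "val u = val v"
    and track: "letter_track chi 0 (a @ u)" "letter_track chi 0 (a @ v)"
  shows "follows_along chi X R (a @ v @ b)"
proof -
  obtain wrs where wrs: "wrs \<in> lists (words X \<times> (R \<union> bar_word ` R))"
    and t: "conjugates wrs \<in> nonneg_relations chi X"
    and fe: "freely_equivalent X (a @ u @ b) (conjugates wrs)"
    using f unfolding follows_along_def Let_def by blast
  define t where "t = conjugates wrs"
  define r where "r = v @ bar_word u"
  have r: "r \<in> R"
    using R[of r] X eq by (simp add: r_def relations_def)
  \<comment> \<open>As \<open>u\<close> and \<open>v\<close> have the same value,
    \<open>bar_word u\<close> after \<open>a @ v\<close> retraces \<open>u\<close>
    backwards.\<close>
  have track_u: "letter_track chi (chi (val (a @ u))) (bar_word u)"
    using letter_track_bar[of "chi (val a)" u] track(1) by (simp add: chi_add)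
  have track_a: "letter_track chi (chi (val a)) (bar_word a)"
    using letter_track_bar[of 0 a] track(1) by simp
  have "val (a @ r @ bar_word a) = 0"
    using eq by (simp add: r_def diff_conv_add_uminus del: add_uminus_conv_diff)
  then have "val ((a @ r @ bar_word a) @ t) = 0"
    using t by (simp only: map_append sum_list_append nonneg_relations_iff t_def) simp
  moreover have "letter_track chi 0 ((a @ r @ bar_word a) @ t)"
    using t track track_u track_a eq by (simp add: nonneg_relations_iff r_def t_def[symmetric] chi_add)
  moreover have "(a @ r @ bar_word a) @ t \<in> words X"
    using t X by (simp add: nonneg_relations_iff r_def t_def[symmetric])
  ultimately have "(a @ r @ bar_word a) @ t \<in> nonneg_relations chi X"
    unfolding nonneg_relations_iff by blast
  moreover have "freely_equivalent X (a @ v @ b) ((a @ r @ bar_word a) @ t)"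
  proof -
    \<comment> \<open>In the conjugate of \<open>r\<close> followed by \<open>a @ u @ b\<close>,
      first \<open>bar_word a\<close> cancels against \<open>a\<close>, then
      \<open>bar_word u\<close> against \<open>u\<close>; what remains is
      \<open>a @ v @ b\<close>.\<close>
    have "freely_equivalent X ((a @ v @ bar_word u) @ bar_word a @ a @ (u @ b)) ((a @ v @ bar_word u) @ (u @ b))"
      using freely_equivalent_cancel[of "a @ v @ bar_word u" X "bar_word a" "u @ b"] X by simp
    also have "freely_equivalent X \<dots> ((a @ v) @ b)"
      using freely_equivalent_cancel[of "a @ v" X "bar_word u" b] X by simp
    finally have "freely_equivalent X (a @ v @ b) ((a @ r @ bar_word a) @ (a @ u @ b))"
      by (simp add: r_def freely_equivalent_sym)
    also have "freely_equivalent X \<dots> ((a @ r @ bar_word a) @ t)"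
      using freely_equivalent_context[OF fe, of "a @ r @ bar_word a" "[]"] X
      by (simp add: t_def r_def)
    finally show ?thesis .
  qed
  ultimately show ?thesis
    unfolding follows_along_def Let_def
    using wrs r X by (intro bexI[of _ "(a, r) # wrs"]) (auto simp: t_def)
qed

end

text \<open>Reducing letter by letter from the right gives a normal form for free equivalence that is
  reached by deletions only; deletions, unlike insertions, preserve non-negative tracks.\<close>

definition reduce_Cons :: "'a letter \<Rightarrow> 'a letter list \<Rightarrow> 'a letter list" where
  "reduce_Cons y w = (if w \<noteq> [] \<and> hd w = bar_letter y then tl w else y # w)"

abbreviation reduce :: "'a letter list \<Rightarrow> 'a letter list" where
  "reduce w \<equiv> foldr reduce_Cons w []"

inductive free_deletion :: "'a letter list \<Rightarrow> 'a letter list \<Rightarrow> bool" where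
  "free_deletion (u @ y # bar_letter y # v) (u @ v)"

fun reduced :: "'a letter list \<Rightarrow> bool" where
  "reduced (x # y # w) \<longleftrightarrow> y \<noteq> bar_letter x \<and> reduced (y # w)"
| "reduced _ \<longleftrightarrow> True"

lemma reduced_tl: "reduced (x # w) \<Longrightarrow> reduced w"
  by (cases w) auto

lemma reduced_reduce: "reduced (reduce w)"
proof (induction w)
  case (Cons y w)
  have "reduced (reduce_Cons y v)" if "reduced v" for v
    using that by (cases v) (auto simp: reduce_Cons_def dest: reduced_tl)
  then show ?case using Cons by simp
qed simp

text \<open>If \<open>w\<close> begins with \<open>y\<close>, the inner step removes this letter and
  the outer one restores it; that it does not cancel against the second letter of \<open>w\<close>
  is where reducedness enters.\<close>

lemma reduce_Cons_bar: "reduced w \<Longrightarrow> reduce_Cons y (reduce_Cons (bar_letter y) w) = w"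
  by (cases w rule: reduced.cases) (auto simp: reduce_Cons_def)

lemma reduce_free_deletion: "reduce (u @ y # bar_letter y # v) = reduce (u @ v)"
  using reduce_Cons_bar[OF reduced_reduce, of y v] by simp

lemma reduce_freely_equivalent: "freely_equivalent X u v \<Longrightarrow> reduce u = reduce v"
  unfolding freely_equivalent_def
proof (induction rule: equivclp_induct)
  case (step y z)
  have "reduce y' = reduce z'" if "free_insertion X y' z'" for y' z'
    using that
  proof cases
    case (1 u v y)
    then show ?thesis using reduce_free_deletion[of u y v] by simp
  qed
  then show ?case using step by metis
qed simp

lemma free_deletion_Cons: "free_deletion u v \<Longrightarrow> free_deletion (y # u) (y # v)"
proof (induction rule: free_deletion.induct)
  case (1 u z v)
  then show ?case using free_deletion.intros[of "y # u" z v] by simp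
qed

lemma free_deletions_reduce: "free_deletion\<^sup>*\<^sup>* w (reduce w)"
proof (induction w)
  case (Cons y w)
  have "free_deletion\<^sup>*\<^sup>* (y # w) (y # reduce w)"
    using Cons
  proof (induction rule: rtranclp_induct)
    case (step u v)
    then show ?case by (meson free_deletion_Cons rtranclp.rtrancl_into_rtrancl)
  qed simp
  moreover have "free_deletion\<^sup>*\<^sup>* (y # reduce w) (reduce_Cons y (reduce w))"
    using free_deletion.intros[of "[]" y "tl (reduce w)"]
    by (cases "reduce w") (auto simp: reduce_Cons_def)
  ultimately show ?case by simp
qed simp

section \<open>Bounded word length\<close>

lemma is_character_additive: "is_character chi \<Longrightarrow> additive_character chi"
  by (simp add: is_character_def additive_character_def)

definition short_values :: "('a::group_add \<Rightarrow> real) \<Rightarrow> 'a set \<Rightarrow> nat \<Rightarrow> 'a set" where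
  "short_values chi X m = {val w |w. w \<in> words X \<and> length w \<le> m \<and> letter_track chi 0 w}"

context additive_character
begin

lemma short_values_mono: "m \<le> n \<Longrightarrow> short_values chi X m \<subseteq> short_values chi X n"
  by (auto simp: short_values_def)

lemma short_values_0: "short_values chi X 0 = {0}"
  by (force simp: short_values_def intro: exI[of _ "[]"])

lemma short_values_half: "short_values chi X m \<subseteq> half chi"
  using track_from_end[of 0] by (auto simp: short_values_def half_def)

text \<open>Recursion on the last letter. Once the prefix has a non-negative track only the new end
  point has to be tested, so one intersection with \<open>half chi\<close> suffices; in this form
  compactness passes from \<open>m\<close> to \<open>Suc m\<close>.\<close>

lemma short_values_Suc:
  "short_values chi X (Suc m) = short_values chi X m \<union>
     ((\<lambda>(g, y). g + y) ` (short_values chi X m \<times> (X \<union> uminus ` X)) \<inter> half chi)" (is "_ = ?r")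
proof (intro equalityI subsetI)
  fix g assume g: "g \<in> short_values chi X (Suc m)"
  then obtain w where w: "g = val w" "w \<in> words X" "length w \<le> Suc m" "letter_track chi 0 w"
    by (auto simp: short_values_def)
  show "g \<in> ?r"
  proof (cases "length w \<le> m")
    case True
    then show ?thesis using w by (auto simp: short_values_def)
  next
    case False
    then obtain v y where v: "w = v @ [y]" by (cases w rule: rev_cases) auto
    have y: "read_letter y \<in> X \<union> uminus ` X"
      using w v by (auto simp: read_letter_def)
    have "val v \<in> short_values chi X m"
      using w v by (auto simp: short_values_def)
    moreover have "g = val v + read_letter y" using w v by simp
    moreover have "g \<in> half chi" using g short_values_half by blast
    ultimately show ?thesis using y by force
  qed
next
  fix g assume "g \<in> ?r"
  then show "g \<in> short_values chi X (Suc m)"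
  proof
    assume "g \<in> (\<lambda>(g, y). g + y) ` (short_values chi X m \<times> (X \<union> uminus ` X)) \<inter> half chi"
    then obtain w y where w: "w \<in> words X" "length w \<le> m" "letter_track chi 0 w"
      and y: "y \<in> X \<union> uminus ` X" and g: "g = val w + y" "0 \<le> chi g"
      by (auto simp: short_values_def half_def)
    define l where "l = (if y \<in> X then Inl y else Inr (- y))"
    have l: "l \<in> X <+> X" "read_letter l = y" using y by (auto simp: l_def read_letter_def)
    show ?thesis
      unfolding short_values_def
      using w l g by (intro CollectI exI[of _ "w @ [l]"]) (auto simp: chi_add dest: track_from_end)
  qed (use short_values_mono[of m "Suc m"] in auto)
qed

lemma Union_short_values:
  assumes "generates_along chi X"
  shows "(\<Union>m. short_values chi X m) = half chi"
proof (intro equalityI subsetI)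
  fix g assume "g \<in> half chi"
  then obtain w where w: "w \<in> lists (X \<union> uminus ` X \<union> {0})" "sum_list w = g" "track_from chi 0 w"
    using assms unfolding generates_along_def nonneg_track_eq by metis
  have "sum_list w \<in> short_values chi X (length w)"
    using w(1,3)
  proof (induction w rule: rev_induct)
    case Nil
    then show ?case by (simp add: short_values_0)
  next
    case (snoc y w)
    then have "sum_list w \<in> short_values chi X (length w)" "sum_list (w @ [y]) \<in> half chi"
      using track_from_end[of 0 "w @ [y]"] by (auto simp: half_def)
    then show ?case
      using snoc.prems unfolding length_append_singleton short_values_Suc
      \<comment> \<open>\<open>generates_along\<close> admits the letter \<open>0\<close>; it is
        dropped here, which changes neither the value nor the bound on the length.\<close>
      by (cases "y = 0") force+
  qed
  then show "g \<in> (\<Union>m. short_values chi X m)" using w by blast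
qed (use short_values_half in blast)

text \<open>The words of \<open>a\<close> and \<open>b\<close> may start at any height above 0. The
  word of \<open>c\<close> is read backwards; it then ends at height \<open>chi (a + b - c)\<close>,
  and seen from there it is the forward word lifted by a non-negative amount.\<close>

lemma short_values_add_diff:
  assumes "a \<in> short_values chi X k" "b \<in> short_values chi X l" "c \<in> short_values chi X m" "0 \<le> chi (a + b - c)"
  shows "a + b - c \<in> short_values chi X (k + l + m)"
proof -
  obtain u v w where u: "u \<in> words X" "a = val u" "length u \<le> k" "letter_track chi 0 u"
    and v: "v \<in> words X" "b = val v" "length v \<le> l" "letter_track chi 0 v"
    and w: "w \<in> words X" "c = val w" "length w \<le> m" "letter_track chi 0 w"
    using assms by (auto simp: short_values_def)
  have mono: "letter_track chi h' x" if "letter_track chi h x" "h \<le> h'" for h h' x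
    using that by (force simp: track_from_iff)
  have "letter_track chi (chi a) v"
    using mono[OF v(4)] track_from_end[OF u(4)] u(2) by simp
  moreover have "letter_track chi (chi (a + b)) (bar_word w)"
    using mono[OF w(4) assms(4)] letter_track_bar[of "chi (a + b - c)" w] w(2) by (simp add: chi_diff)
  ultimately have "letter_track chi 0 (u @ v @ bar_word w)"
    using u v w by (simp add: chi_add)
  moreover have "val (u @ v @ bar_word w) = a + b - c"
    using u v w by (simp add: add.assoc diff_conv_add_uminus del: add_uminus_conv_diff)
  moreover have "u @ v @ bar_word w \<in> words X" "length (u @ v @ bar_word w) \<le> k + l + m"
    using u v w by auto
  ultimately show ?thesis
    unfolding short_values_def
    by (intro CollectI exI[of _ "u @ v @ bar_word w"] conjI) (rule sym, assumption | assumption)+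
qed

text \<open>For steps between two points of the half space. If the step descends, the word of
  \<open>- g\<close> is started at the target and read backwards.\<close>

lemma short_word_from_height:
  assumes g: "g \<in> short_values chi X M \<or> - g \<in> short_values chi X M" and h: "0 \<le> h" "0 \<le> h + chi g"
  shows "\<exists>w \<in> words X. length w \<le> M \<and> val w = g \<and> letter_track chi h w"
  using g
proof
  assume "g \<in> short_values chi X M"
  then obtain w where "w \<in> words X" "g = val w" "length w \<le> M" "letter_track chi 0 w"
    by (auto simp: short_values_def)
  moreover from this have "letter_track chi h w"
    using h by (force simp: track_from_iff)
  ultimately show ?thesis by blast
next
  assume "- g \<in> short_values chi X M"
  then obtain w where w: "w \<in> words X" "- g = val w" "length w \<le> M" "letter_track chi 0 w"
    by (auto simp: short_values_def)
  have "letter_track chi (h + chi g) w"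
    using w h by (force simp: track_from_iff)
  moreover have "h + chi g + chi (val w) = h"
    using w(2)[symmetric] by simp
  ultimately have "letter_track chi h (bar_word w)"
    using letter_track_bar[of "h + chi g" w] by metis
  moreover have "val (bar_word w) = g"
    using w(2)[symmetric] by simp
  ultimately show ?thesis
    using w by (intro bexI[of _ "bar_word w"]) auto
qed

end

lemma closed_half:
  fixes chi :: "'a::topological_group_add \<Rightarrow> real"
  assumes "is_character chi"
  shows "closed (half chi)"
  using assms unfolding is_character_def half_def by (auto intro: closed_Collect_le)

lemma compact_short_values:
  fixes chi :: "'a::topological_group_add \<Rightarrow> real"
  assumes "is_character chi" "compact X"
  shows "compact (short_values chi X m)"
proof -
  interpret additive_character chi using assms(1) by (rule is_character_additive)
  show ?thesis
  proof (induction m)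
    case 0
    then show ?case by (simp add: short_values_0)
  next
    case (Suc m)
    have "compact (X \<union> uminus ` X)"
      using assms(2) by (intro compact_Un compact_continuous_image continuous_intros) auto
    then have "compact ((\<lambda>(g, y). g + y) ` (short_values chi X m \<times> (X \<union> uminus ` X)))"
      using Suc by (intro compact_continuous_image compact_Times) (auto simp: split_def intro!: continuous_intros)
    then show ?case
      unfolding short_values_Suc using Suc assms by (intro compact_Un compact_Int_closed closed_half)
  qed
qed

text \<open>By Baire's theorem some \<open>short_values chi X m\<close> contains a relatively open subset
  \<open>U \<inter> half chi\<close> with a point \<open>u\<close>. An element \<open>e\<close> close to \<open>0\<close> is then a difference of two elements of
  \<open>U \<inter> half chi\<close>, one of which is \<open>u\<close>, so that lengths of words are locally bounded.\<close>

lemma compact_bounded_length: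
  fixes chi :: "'a::{topological_group_add, t2_space} \<Rightarrow> real"
  assumes lc: "locally_compact_space (euclidean :: 'a topology)"
    and chi: "is_character chi" and X: "compact X" "generates_along chi X" and C: "compact C"
  shows "\<exists>M. C \<inter> half chi \<subseteq> short_values chi X M"
proof -
  interpret additive_character chi using chi by (rule is_character_additive)
  let ?H = "top_of_set (half chi)"
  have "locally_compact_space ?H"
    by (rule locally_compact_space_closed_subset[OF lc]) (simp add: closed_half[OF chi])
  moreover have "Hausdorff_space ?H"
    by (intro Hausdorff_space_subtopology) (simp add: Hausdorff_space_def disjnt_def separation_t2)
  ultimately have lcr: "locally_compact_space ?H \<and> regular_space ?H"
    using locally_compact_Hausdorff_imp_regular_space by blast
  have "\<exists>m. ?H interior_of short_values chi X m \<noteq> {}"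
  proof (rule ccontr)
    assume "\<nexists>m. ?H interior_of short_values chi X m \<noteq> {}"
    then have "?H interior_of \<Union> (range (short_values chi X)) = {}"
      by (intro Baire_category_alt)
         (use lcr subsetD[OF short_values_half] compact_imp_closed[OF compact_short_values[OF chi X(1)]] in
          \<open>auto simp: closedin_closed_eq[OF closed_half[OF chi]]\<close>)
    then have "half chi = {}"
      using Union_short_values[OF X(2)] interior_of_topspace[of ?H] by simp
    moreover have "0 \<in> half chi" by (simp add: half_def)
    ultimately show False by blast
  qed
  then obtain m u where "u \<in> ?H interior_of short_values chi X m" by blast
  then obtain U where U: "open U" "u \<in> U" "U \<inter> half chi \<subseteq> short_values chi X m" "u \<in> half chi"
    by (auto simp: interior_of_def openin_open)
  \<comment> \<open>Both signs occur: if \<open>e\<close> ascends, \<open>e + u\<close> stays in the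
    half space and \<open>e = (e + u) - u\<close>; if it descends, \<open>- e + u\<close> does and
    \<open>e = u - (- e + u)\<close>.\<close>
  define W where "W = {e. e + u \<in> U} \<inter> {e. - e + u \<in> U}"
  have "open W"
    unfolding W_def using U(1)
    by (intro open_Int) (auto simp: vimage_def[symmetric]
        intro!: open_vimage continuous_intros)
  have step: "g \<in> short_values chi X (k + m + m)"
    if c: "c \<in> short_values chi X k" and g: "g \<in> half chi" and e: "- c + g \<in> W" for c g k
  proof (cases "0 \<le> chi (- c + g)")
    case True
    then have "- c + g + u \<in> short_values chi X m" "u \<in> short_values chi X m"
      using U e by (auto simp: W_def half_def chi_add)
    then have "c + (- c + g + u) - u \<in> short_values chi X (k + m + m)"
      using c g by (intro short_values_add_diff) (auto simp: half_def chi_add chi_diff)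
    then show ?thesis by (simp add: add.assoc[symmetric])
  next
    case False
    then have "- (- c + g) + u \<in> short_values chi X m" "u \<in> short_values chi X m"
      using U e by (auto simp: W_def half_def chi_add)
    then have "c + u - (- (- c + g) + u) \<in> short_values chi X (k + m + m)"
      using c g by (intro short_values_add_diff) (auto simp: half_def chi_add chi_diff)
    moreover have "c + u - (- (- c + g) + u) = g"
      by (simp add: group_simps del: add_uminus_conv_diff)
    ultimately show ?thesis by simp
  qed
  let ?N = "\<lambda>c. {g. - c + g \<in> W}"
  have "compact (C \<inter> half chi)" using C closed_half[OF chi] by (rule compact_Int_closed)
  moreover have "open (?N c)" if "c \<in> C \<inter> half chi" for c
    using \<open>open W\<close> by (auto simp: vimage_def[symmetric] intro!: open_vimage continuous_intros)
  moreover have "C \<inter> half chi \<subseteq> (\<Union>c \<in> C \<inter> half chi. ?N c)"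
    using U by (auto simp: W_def)
  ultimately obtain F where F: "F \<subseteq> C \<inter> half chi" "finite F" "C \<inter> half chi \<subseteq> (\<Union>c\<in>F. ?N c)"
    by (rule compactE_image)
  have "\<forall>c\<in>F. \<exists>k. c \<in> short_values chi X k"
    using F(1) Union_short_values[OF X(2)] by blast
  then obtain k where k: "\<And>c. c \<in> F \<Longrightarrow> c \<in> short_values chi X (k c)" by metis
  \<comment> \<open>Each point is near one of the finitely many \<open>c\<close>; the correction
    \<open>- c + g\<close> costs two words of length at most \<open>m\<close>.\<close>
  have "C \<inter> half chi \<subseteq> short_values chi X (Max (k ` F) + m + m)"
  proof
    fix g assume "g \<in> C \<inter> half chi"
    then obtain c where c: "c \<in> F" "- c + g \<in> W" "g \<in> half chi" using F(3) by blast
    then have "g \<in> short_values chi X (k c + m + m)" using step k by blast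
    moreover have "k c \<le> Max (k ` F)" using F(2) c(1) by simp
    ultimately show "g \<in> short_values chi X (Max (k ` F) + m + m)"
      using short_values_mono[of "k c + m + m" "Max (k ` F) + m + m"] by auto
  qed
  then show ?thesis by blast
qed

section \<open>The complexes of translates\<close>

text \<open>The abstract simplicial complex behind \<open>half_orbit chi C\<close>: by
  \<open>half_orbit_eq\<close> the simplices of the latter are the tuples that span a simplex
  here.\<close>

definition orbit_complex :: "('a::group_add \<Rightarrow> real) \<Rightarrow> 'a set \<Rightarrow> 'a set \<Rightarrow> bool" where
  "orbit_complex chi C S \<longleftrightarrow> (\<exists>g \<in> half chi. S \<subseteq> (+) g ` C)"

interpretation orbit_complex: subset_closed "orbit_complex chi C"
  by unfold_locales (auto simp: orbit_complex_def)

lemma mem_left_translate: "v \<in> (+) g ` C \<longleftrightarrow> - g + v \<in> (C :: 'a::group_add set)"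
proof
  assume "- g + v \<in> C"
  then have "g + (- g + v) \<in> (+) g ` C" by blast
  then show "v \<in> (+) g ` C" by simp
qed auto

lemma edge_path_snoc:
  "edge_path K (p @ [v]) \<longleftrightarrow> (if p = [] then K {v} else edge_path K p \<and> K {last p, v})"
  by (auto simp: edge_path_def successively_append_iff)

primrec walk :: "'a::group_add \<Rightarrow> 'a letter list \<Rightarrow> 'a list" where
  "walk h [] = [h]"
| "walk h (y # w) = h # walk (h + read_letter y) w"

lemma walk_nonempty [simp]: "walk h w \<noteq> []"
  and hd_walk [simp]: "hd (walk h w) = h"
  and last_walk [simp]: "last (walk h w) = h + val w"
  by (induction w arbitrary: h) (auto simp: add.assoc)

lemma walk_append: "walk h (u @ v) = butlast (walk h u) @ walk (h + val u) v"
  by (induction u arbitrary: h) (auto simp: add.assoc)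

lemma walk_append_last: "butlast (walk h w) @ [h + val w] = walk h w"
  using append_butlast_last_id[of "walk h w"] by simp

lemma walk_hd_tl: "h # tl (walk h w) = walk h w"
  by (cases w) auto

lemma walk_append_tl: "walk h (u @ v) = walk h u @ tl (walk (h + val u) v)"
  by (induction u arbitrary: h) (auto simp: add.assoc walk_hd_tl)

lemma mem_walkE:
  assumes "x \<in> set (walk h w)"
  obtains u v where "w = u @ v" "x = h + val u"
proof -
  have "\<exists>u v. w = u @ v \<and> x = h + val u"
    using assms
  proof (induction w arbitrary: h)
    case Nil
    then show ?case by simp
  next
    case (Cons y w)
    show ?case
    proof (cases "x = h")
      case True
      then show ?thesis by (intro exI[of _ "[]"] exI[of _ "y # w"]) simp
    next
      case False
      then obtain u v where "w = u @ v" "x = h + read_letter y + val u"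
        using Cons.IH[of "h + read_letter y"] Cons.prems by auto
      then show ?thesis by (intro exI[of _ "y # u"] exI[of _ v]) (simp add: add.assoc)
    qed
  qed
  then show ?thesis using that by blast
qed

lemma read_letter_in: "y \<in> X <+> X \<Longrightarrow> read_letter y \<in> X \<union> uminus ` X"
  by (auto simp: read_letter_def)

text \<open>There is no condition on tracks: only the base point of a translate must lie in the half
  space, its vertices may be below.\<close>

definition ball_values :: "'a::group_add set \<Rightarrow> nat \<Rightarrow> 'a set" where
  "ball_values X L = {val w |w. w \<in> words X \<and> length w \<le> L}"

lemma set_walk_ball:
  assumes "w \<in> words X" "length w \<le> L"
  shows "set (walk h w) \<subseteq> (+) h ` ball_values X L"
proof
  fix v assume "v \<in> set (walk h w)"
  then obtain a b where ab: "v = h + val a" "w = a @ b"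
    by (auto elim: mem_walkE)
  then have "a \<in> words X" "length a \<le> L" using assms by auto
  then show "v \<in> (+) h ` ball_values X L" using ab by (auto simp: ball_values_def)
qed

text \<open>For the zero character every track is non-negative, so this is an instance of
  \<open>compact_short_values\<close>.\<close>

lemma compact_ball_values:
  fixes X :: "'a::topological_group_add set"
  assumes "compact X"
  shows "compact (ball_values X L)"
proof -
  have "track_from (\<lambda>_. 0) 0 w" for w :: "'a list"
    by (induction w) auto
  then have "ball_values X L = short_values (\<lambda>_. 0) X L"
    by (simp add: ball_values_def short_values_def)
  then show ?thesis
    using compact_short_values[of "\<lambda>_. 0" X L] assms by (simp add: is_character_def)
qed

context additive_character
begin

text \<open>The edge from \<open>g\<close> to \<open>g + y\<close> lies in \<open>g + C\<close>
  because \<open>0\<close> and \<open>y\<close> belong to \<open>C\<close>, and the track condition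
  puts the points \<open>g\<close> into the half space.\<close>

lemma edge_path_walk:
  assumes "w \<in> words X" "letter_track chi (chi h) w" "insert 0 (X \<union> uminus ` X) \<subseteq> C"
  shows "edge_path (orbit_complex chi C) (walk h w)"
  using assms(1,2)
proof (induction w rule: rev_induct)
  case Nil
  then have "orbit_complex chi C {h}"
    using assms(3) unfolding orbit_complex_def half_def by (auto intro!: exI[of _ h] simp: mem_left_translate)
  then show ?case by simp
next
  case (snoc y w)
  define g where "g = h + val w"
  have "g \<in> half chi"
    using snoc.prems track_from_end[of "chi h" "map read_letter w"] by (simp add: g_def half_def chi_add)
  moreover have "read_letter y \<in> C"
    using snoc.prems assms(3) read_letter_in[of y X] by auto
  moreover have "0 \<in> C" using assms(3) by simp
  ultimately have "orbit_complex chi C {g, g + read_letter y}"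
    unfolding orbit_complex_def by (intro bexI[of _ g]) (auto simp: mem_left_translate)
  moreover have "walk h (w @ [y]) = walk h w @ [g + read_letter y]"
    by (simp add: walk_append_tl g_def)
  ultimately show ?case
    using snoc by (simp add: edge_path_snoc g_def)
qed

text \<open>A vertex of \<open>g + C\<close> is reached by walking from \<open>0\<close> to
  \<open>g\<close> and adding one edge inside \<open>g + D\<close>.\<close>

lemma generates_along_connected:
  assumes X: "generates_along chi X" and D: "insert 0 (X \<union> uminus ` X \<union> C) \<subseteq> D"
    and v: "orbit_complex chi C {v}"
  shows "\<exists>p. edge_path (orbit_complex chi D) p \<and> hd p = 0 \<and> last p = v"
proof -
  obtain g where g: "g \<in> half chi" "- g + v \<in> C"
    using v by (auto simp: orbit_complex_def)
  then obtain m where "g \<in> short_values chi X m" using Union_short_values[OF X] by blast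
  then obtain w where w: "w \<in> words X" "g = val w" "letter_track chi 0 w"
    by (auto simp: short_values_def)
  have "edge_path (orbit_complex chi D) (walk 0 w)"
    using w D by (intro edge_path_walk) auto
  moreover have "orbit_complex chi D {last (walk 0 w), v}"
    using g w D by (auto simp: orbit_complex_def mem_left_translate intro!: bexI[of _ g])
  ultimately show ?thesis
    by (intro exI[of _ "walk 0 w @ [v]"]) (simp add: edge_path_snoc)
qed

text \<open>Consecutive edges lie in translates \<open>g0 + D\<close> and \<open>g + D\<close> with
  a common vertex \<open>v\<close>, so \<open>- g0 + g = (- g0 + v) - (- g + v)\<close> is a
  difference of elements of \<open>D\<close>. The track of the resulting word consists of the
  heights of base points, all of which are in the half space.\<close>

lemma connected_generates_along:
  assumes x: "x \<in> D"
    and conn: "\<And>h. h \<in> half chi \<Longrightarrow> \<exists>p. edge_path (orbit_complex chi D) p \<and> hd p = x \<and> last p = h + x"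
  shows "generates_along chi {a - b |a b. a \<in> D \<and> b \<in> D}"
proof -
  define Y where "Y = {a - b |a b. a \<in> D \<and> b \<in> D}"
  have Y: "a - b \<in> Y" if "a \<in> D" "b \<in> D" for a b
    using that by (auto simp: Y_def)
  \<comment> \<open>\<open>g\<close> is any base point whose translate contains the last vertex: the
    next edge comes with a base point of its own, to which the induction hypothesis must
    apply.\<close>
  have *: "\<exists>w \<in> lists Y. sum_list w = g \<and> track_from chi 0 w"
    if "edge_path (orbit_complex chi D) p" "hd p = x" "g \<in> half chi" "- g + last p \<in> D" for p g
    using that
  proof (induction p arbitrary: g rule: rev_induct)
    case Nil
    then show ?case by (simp add: edge_path_def)
  next
    case (snoc v p)
    show ?case
    proof (cases "p = []")
      case True
      have "x - (- g + v) = g" using snoc.prems(2) True by (simp add: diff_conv_add_uminus minus_add del: add_uminus_conv_diff)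
      then have "g \<in> Y" using Y[OF x, of "- g + v"] snoc.prems(4) by simp
      then show ?thesis using snoc.prems(3) by (intro bexI[of _ "[g]"]) (auto simp: half_def)
    next
      case False
      then obtain g0 where g0: "g0 \<in> half chi" "- g0 + last p \<in> D" "- g0 + v \<in> D"
        using snoc.prems(1) by (auto simp: edge_path_snoc orbit_complex_def)
      obtain w where w: "w \<in> lists Y" "sum_list w = g0" "track_from chi 0 w"
        using snoc.IH[of g0] snoc.prems g0 False by (auto simp: edge_path_snoc)
      have "- g0 + g = (- g0 + v) - (- g + v)"
        by (simp add: group_simps del: add_uminus_conv_diff)
      then have "- g0 + g \<in> Y" using Y[OF g0(3)] snoc.prems(4) by simp
      then show ?thesis
        using w snoc.prems(3) g0(1)
        by (intro bexI[of _ "w @ [- g0 + g]"]) (auto simp: half_def chi_add)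
    qed
  qed
  show ?thesis
    unfolding generates_along_def Y_def[symmetric]
  proof
    fix h assume h: "h \<in> half chi"
    obtain p where "edge_path (orbit_complex chi D) p" "hd p = x" "last p = h + x"
      using conn[OF h] by blast
    then obtain w where "w \<in> lists Y" "sum_list w = h" "track_from chi 0 w"
      using *[of p h] h x by auto
    moreover from this have "w \<in> lists (Y \<union> uminus ` Y \<union> {0})" by auto
    ultimately show "\<exists>w\<in>lists (Y \<union> uminus ` Y \<union> {0}). sum_list w = h \<and> nonneg_track chi w"
      unfolding nonneg_track_eq by blast
  qed
qed

text \<open>Here relations and free cancellations of a word become homotopies of the walk that it
  describes. Replacing the free equivalence by deletions keeps all walks in the half space.\<close>

lemma relation_walk_edge_homotopic:
  assumes D: "insert 0 (ball_values X N) \<subseteq> D" "X \<union> uminus ` X \<subseteq> D"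
    and R: "\<And>r. r \<in> R \<Longrightarrow> length r \<le> N" "R \<subseteq> relations X"
    and f: "follows_along chi X R \<rho>" and \<rho>: "\<rho> \<in> nonneg_relations chi X"
  shows "edge_homotopic (orbit_complex chi D) (walk 0 \<rho>) [0]"
proof -
  let ?K = "orbit_complex chi D"
  let ?ok = "\<lambda>w. w \<in> words X \<and> letter_track chi 0 w"
  have half: "val u \<in> half chi" if "letter_track chi 0 u" for u
    using that track_from_end[of 0 "map read_letter u"] by (simp add: half_def)
  have deletion: "edge_homotopic ?K (walk 0 u) (walk 0 v) \<and> ?ok v" if "?ok u" "free_deletion u v" for u v
    using that(2,1)
  proof cases
    case (1 u' y v')
    let ?g = "val u'"
    have g: "?g \<in> half chi" using that 1 half by auto
    have "read_letter y \<in> D" using that 1 D read_letter_in[of y X] by auto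
    \<comment> \<open>Deleting a letter and its inverse removes a backtrack along one edge.\<close>
    then have K: "?K {?g, ?g + read_letter y, ?g}" "?K {?g}"
      unfolding orbit_complex_def using g D by (auto intro!: bexI[of _ ?g] simp: mem_left_translate)
    have u: "walk 0 u = butlast (walk 0 u') @ ?g # (?g + read_letter y) # ?g # tl (walk ?g v')"
      using 1 by (simp add: walk_append[of 0 u'] walk_hd_tl add.assoc)
    have v: "walk 0 v = butlast (walk 0 u') @ ?g # tl (walk ?g v')"
      using 1 by (simp add: walk_append[of 0 u'] walk_hd_tl)
    have "edge_homotopic ?K (walk 0 u) (walk 0 v)"
      unfolding u v
      using edge_homotopic_triangle[of ?K ?g "?g + read_letter y" ?g "butlast (walk 0 u')" "tl (walk ?g v')"]
        edge_homotopic_stutter[of ?K ?g "butlast (walk 0 u')" "tl (walk ?g v')"] K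
      by (blast intro: edge_homotopic_trans)
    moreover have "?ok v" using that 1 by (auto simp: chi_add)
    ultimately show ?thesis by blast
  qed
  have red: "edge_homotopic ?K (walk 0 w) (walk 0 (reduce w))" if "?ok w" for w
  proof -
    have "edge_homotopic ?K (walk 0 w) (walk 0 w') \<and> ?ok w'" if "free_deletion\<^sup>*\<^sup>* w w'" for w'
      using that
    proof (induction rule: rtranclp_induct)
      case base
      then show ?case using \<open>?ok w\<close> by simp
    next
      case (step y z)
      then show ?case using deletion edge_homotopic_trans by blast
    qed
    then show ?thesis using free_deletions_reduce by blast
  qed
  have free: "edge_homotopic ?K (walk 0 u) (walk 0 v)" if "?ok u" "?ok v" "freely_equivalent X u v" for u v
    using red[OF that(1)] red[OF that(2)] reduce_freely_equivalent[OF that(3)]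
    by (metis edge_homotopic_sym edge_homotopic_trans)
  obtain wrs where wrs: "wrs \<in> lists (words X \<times> (R \<union> bar_word ` R))"
    and t: "conjugates wrs \<in> nonneg_relations chi X"
    and fe: "freely_equivalent X \<rho> (conjugates wrs)"
    using f unfolding follows_along_def Let_def by blast
  have "edge_homotopic ?K (walk 0 (conjugates wrs)) [0]"
    using wrs t
  proof (induction wrs rule: list.induct)
    case (Cons wr wrs)
    obtain w r where wr: "wr = (w, r)" by (cases wr)
    define t where "t = conjugates wrs"
    have w: "w \<in> words X" and r: "r \<in> R \<union> bar_word ` R"
      using Cons.prems(1) unfolding wr Cons_in_lists_iff by blast+
    have r': "r \<in> words X" "val r = 0" "length r \<le> N"
      using r R by (auto simp: relations_def)
    have full: "w @ r @ bar_word w @ t \<in> nonneg_relations chi X"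
      using Cons.prems wr by (simp add: t_def)
    \<comment> \<open>As \<open>val r = 0\<close>, leaving out \<open>r\<close> does not change the
      heights of the letters after it.\<close>
    then have tw: "letter_track chi 0 w" "letter_track chi 0 (w @ bar_word w @ t)" "letter_track chi 0 t"
      and tn: "t \<in> nonneg_relations chi X"
      using r' by (auto simp: nonneg_relations_iff add.assoc[symmetric])
    let ?g = "val w"
    \<comment> \<open>The loop of the relator stays in the translate \<open>?g + D\<close>, that is,
      in one simplex, and contracts there.\<close>
    have "set (walk ?g r) \<union> set [?g] \<subseteq> (+) ?g ` D"
      using set_walk_ball[OF r'(1,3), of ?g] D by (auto simp: mem_left_translate)
    then have K: "?K (set (walk ?g r) \<union> set [?g])"
      unfolding orbit_complex_def using half[OF tw(1)] by blast
    have "walk 0 (w @ r @ bar_word w @ t) = butlast (walk 0 w) @ walk ?g r @ tl (walk ?g (bar_word w @ t))"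
      using r' by (simp add: walk_append[of 0 w] walk_append_tl[of ?g r])
    also have "edge_homotopic ?K \<dots> (butlast (walk 0 w) @ [?g] @ tl (walk ?g (bar_word w @ t)))"
      using K r' by (intro orbit_complex.simplex_edge_homotopic_eq) auto
    also have "butlast (walk 0 w) @ [?g] @ tl (walk ?g (bar_word w @ t)) = walk 0 (w @ bar_word w @ t)"
      by (simp add: walk_append[of 0 w] walk_hd_tl)
    also have "edge_homotopic ?K \<dots> (walk 0 t)"
      using free[of "w @ bar_word w @ t" t] freely_equivalent_cancel[of "[]" X w t] tw tn w
      by (simp add: nonneg_relations_iff)
    also have "edge_homotopic ?K \<dots> [0]"
      using Cons tn by (simp add: t_def)
    finally show ?case by (simp add: wr t_def)
  qed simp
  moreover have "edge_homotopic ?K (walk 0 \<rho>) (walk 0 (conjugates wrs))"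
    using free fe \<rho> t by (simp add: nonneg_relations_iff)
  ultimately show ?thesis using edge_homotopic_trans by blast
qed

text \<open>An edge path through vertices \<open>v \<in> g + C\<close> is pushed to the walk through the base points \<open>g\<close>.\<close>

lemma edge_path_homotopic_walk:
  assumes C: "0 \<in> C" and short: "\<And>c d. c \<in> C \<Longrightarrow> d \<in> C \<Longrightarrow> c - d \<in> half chi \<Longrightarrow> c - d \<in> short_values chi X M"
    and D: "C \<union> ball_values X M \<subseteq> D"
    and p: "edge_path (orbit_complex chi C) p" "hd p = 0" and g: "g \<in> half chi" "- g + last p \<in> C"
  shows "\<exists>\<rho> \<in> words X. letter_track chi 0 \<rho> \<and> val \<rho> = g \<and>
           edge_homotopic (orbit_complex chi D) p (walk 0 \<rho> @ [last p])"
proof -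
  let ?K = "orbit_complex chi D"
  \<comment> \<open>Both translates contain \<open>v\<close>, so \<open>- a + b\<close> and its
    inverse are differences of elements of \<open>C\<close>; \<open>short\<close> applies to
    whichever of the two ascends.\<close>
  have word: "\<exists>w \<in> words X. length w \<le> M \<and> val w = - a + b \<and> letter_track chi (chi a) w"
    if "a \<in> half chi" "b \<in> half chi" "- a + v \<in> C" "- b + v \<in> C" for a b v
  proof (rule short_word_from_height)
    have ab: "- a + b = (- a + v) - (- b + v)" "- (- a + b) = (- b + v) - (- a + v)"
      by (simp_all add: group_simps del: add_uminus_conv_diff)
    have "- a + b \<in> half chi \<or> - (- a + b) \<in> half chi"
      unfolding half_def by (simp add: chi_add) linarith
    then show "- a + b \<in> short_values chi X M \<or> - (- a + b) \<in> short_values chi X M"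
      using short[OF that(3,4)] short[OF that(4,3)] unfolding ab[symmetric] by blast
  qed (use that in \<open>auto simp: half_def chi_add\<close>)
  show ?thesis
    using p g
  proof (induction p arbitrary: g rule: rev_induct)
    case Nil
    then show ?case by (simp add: edge_path_def)
  next
    case (snoc v p)
    show ?case
    proof (cases "p = []")
      case True
      then have v: "v = 0" using snoc.prems by simp
      obtain w where w: "w \<in> words X" "length w \<le> M" "val w = g" "letter_track chi 0 w"
        using word[of 0 g 0] snoc.prems C v by (auto simp: half_def)
      \<comment> \<open>Even when the path is the single vertex \<open>0\<close>, the prescribed
        base point \<open>g\<close> may differ from \<open>0\<close>; going to \<open>g\<close> and
        back takes place in \<open>0 + D\<close>.\<close>
      have "set [0] \<union> set (walk 0 w @ [0]) \<subseteq> (+) 0 ` D"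
        using set_walk_ball[OF w(1,2), of 0] C D by auto
      moreover have "0 \<in> half chi" by (simp add: half_def)
      ultimately have "?K (set [0] \<union> set (walk 0 w @ [0]))"
        unfolding orbit_complex_def by blast
      then have "edge_homotopic ?K ([] @ [0] @ []) ([] @ (walk 0 w @ [0]) @ [])"
        by (intro orbit_complex.simplex_edge_homotopic_eq) auto
      then show ?thesis using w v True by auto
    next
      case False
      then obtain g0 where g0: "g0 \<in> half chi" "- g0 + last p \<in> C" "- g0 + v \<in> C"
        using snoc.prems(1) by (auto simp: edge_path_snoc orbit_complex_def)
      obtain \<rho> where \<rho>: "\<rho> \<in> words X" "letter_track chi 0 \<rho>" "val \<rho> = g0"
          "edge_homotopic ?K p (walk 0 \<rho> @ [last p])"
        using snoc.IH[of g0] snoc.prems g0 False by (auto simp: edge_path_snoc)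
      obtain w where w: "w \<in> words X" "length w \<le> M" "val w = - g0 + g" "letter_track chi (chi g0) w"
        using word[of g0 g v] snoc.prems g0 by auto
      \<comment> \<open>The detour over \<open>last p\<close> and the walk from the old to the new
        base point span one simplex with \<open>v\<close>, so one may replace the other.\<close>
      have "set [g0, last p, v] \<union> set (walk g0 w @ [v]) \<subseteq> (+) g0 ` D"
        using set_walk_ball[OF w(1,2), of g0] C D g0 by (auto simp: mem_left_translate subset_iff)
      then have K: "?K (set [g0, last p, v] \<union> set (walk g0 w @ [v]))"
        unfolding orbit_complex_def using g0(1) by blast
      have "edge_homotopic ?K (p @ [v]) (walk 0 \<rho> @ [last p] @ [v])"
        using edge_homotopic_context[OF \<rho>(4), of "[]" "[v]"] by simp
      also have "walk 0 \<rho> @ [last p] @ [v] = butlast (walk 0 \<rho>) @ [g0, last p, v] @ []"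
        using \<rho>(3) by (subst walk_append_last[of 0 \<rho>, symmetric]) simp
      also have "edge_homotopic ?K \<dots> (butlast (walk 0 \<rho>) @ (walk g0 w @ [v]) @ [])"
        using K by (intro orbit_complex.simplex_edge_homotopic_eq) auto
      also have "\<dots> = walk 0 (\<rho> @ w) @ [v]"
        using \<rho>(3) by (simp add: walk_append)
      finally have "edge_homotopic ?K (p @ [v]) (walk 0 (\<rho> @ w) @ [v])" .
      then show ?thesis
        using \<rho> w by (intro bexI[of _ "\<rho> @ w"]) auto
    qed
  qed
qed

end

section \<open>Null homotopies of edge paths and presentations\<close>

lemma presented_imp_edge_homotopic:
  fixes chi :: "'a::{topological_group_add, t2_space} \<Rightarrow> real"
  assumes lc: "locally_compact_space (euclidean :: 'a topology)" and chi: "is_character chi"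
    and P: "presentation_along chi X R" "compact X" "\<And>r. r \<in> R \<Longrightarrow> length r \<le> N"
    and C: "compact C" "0 \<in> C"
  shows "\<exists>D. compact D \<and> C \<subseteq> D \<and> (\<forall>p. edge_path (orbit_complex chi C) p \<longrightarrow> hd p = 0 \<longrightarrow> last p = 0 \<longrightarrow>
           edge_homotopic (orbit_complex chi D) p [0])"
proof -
  interpret additive_character chi using chi by (rule is_character_additive)
  have "compact ((\<lambda>(c, d). c - d) ` (C \<times> C))"
    using C(1) by (intro compact_continuous_image compact_Times) (auto simp: split_def intro!: continuous_intros)
  then obtain M where M: "(\<lambda>(c, d). c - d) ` (C \<times> C) \<inter> half chi \<subseteq> short_values chi X M"
    using compact_bounded_length[OF lc chi P(2)] P(1) unfolding presentation_along_def by metis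
  \<comment> \<open>\<open>C\<close> and the values of words of length \<open>M\<close> serve to
    push the path onto a walk, the letters serve free cancellation, and the values of words of
    length \<open>N\<close> fill the relators.\<close>
  define D where "D = C \<union> (X \<union> uminus ` X) \<union> ball_values X M \<union> ball_values X N"
  have "compact D"
    unfolding D_def using C P(2)
    by (intro compact_Un compact_ball_values compact_continuous_image) (auto intro!: continuous_intros)
  moreover have "C \<subseteq> D" by (auto simp: D_def)
  moreover have "edge_homotopic (orbit_complex chi D) p [0]"
    if p: "edge_path (orbit_complex chi C) p" "hd p = 0" "last p = 0" for p
  proof -
    have short: "c - d \<in> short_values chi X M" if "c \<in> C" "d \<in> C" "c - d \<in> half chi" for c d
    proof -
      have "c - d \<in> (\<lambda>(c, d). c - d) ` (C \<times> C)" using that by force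
      then show ?thesis using M that(3) by blast
    qed
    have "\<exists>\<rho> \<in> words X. letter_track chi 0 \<rho> \<and> val \<rho> = 0 \<and>
        edge_homotopic (orbit_complex chi D) p (walk 0 \<rho> @ [last p])"
      using C(2) p by (intro edge_path_homotopic_walk[of C X M]) (auto simp: D_def half_def intro: short)
    then obtain \<rho> where \<rho>: "\<rho> \<in> words X" "letter_track chi 0 \<rho>" "val \<rho> = 0"
      "edge_homotopic (orbit_complex chi D) p (walk 0 \<rho> @ [0])"
      using p(3) by auto
    then have rel: "\<rho> \<in> nonneg_relations chi X" by (simp add: nonneg_relations_iff)
    have "orbit_complex chi D {0}"
      using C(2) \<open>C \<subseteq> D\<close> by (auto simp: orbit_complex_def half_def mem_left_translate intro!: exI[of _ 0])
    then have "edge_homotopic (orbit_complex chi D) (butlast (walk 0 \<rho>) @ [0, 0]) (butlast (walk 0 \<rho>) @ [0])"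
      using edge_homotopic_stutter[of "orbit_complex chi D" 0 "butlast (walk 0 \<rho>)" "[]"] by simp
    moreover have "walk 0 \<rho> = butlast (walk 0 \<rho>) @ [0]"
      using walk_append_last[of 0 \<rho>] \<rho>(3) by simp
    ultimately have "edge_homotopic (orbit_complex chi D) (walk 0 \<rho> @ [0]) (walk 0 \<rho>)"
      by (metis append.assoc append_Cons append_Nil)
    moreover have "edge_homotopic (orbit_complex chi D) (walk 0 \<rho>) [0]"
      by (rule relation_walk_edge_homotopic[where R = R and N = N and X = X])
        (use P rel C(2) in \<open>auto simp: presentation_along_def D_def\<close>)
    ultimately show ?thesis
      using \<rho>(4) edge_homotopic_trans by blast
  qed
  ultimately show ?thesis by blast
qed

fun path_word :: "('v \<Rightarrow> 'v \<Rightarrow> 'l list) \<Rightarrow> 'v list \<Rightarrow> 'l list" where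
  "path_word E (u # v # p) = E u v @ path_word E (v # p)"
| "path_word E _ = []"

lemma path_word_append: "path_word E (p @ u # q) = path_word E (p @ [u]) @ path_word E (u # q)"
proof (induction p)
  case (Cons v p)
  then show ?case by (cases p) auto
qed simp

text \<open>Each vertex gets a base point and each edge a bounded word between base points, so an
  edge path spells a word. A null homotopy of the walk of a relation then becomes a sequence of
  replacements by bounded relators, and further bounded relators turn the word spelled by the walk
  back into the relation.\<close>

lemma edge_homotopic_imp_presented:
  fixes chi :: "'a::{topological_group_add, t2_space} \<Rightarrow> real"
  assumes lc: "locally_compact_space (euclidean :: 'a topology)" and chi: "is_character chi"
    and X: "compact X" "generates_along chi X"
    and null: "\<And>C. compact C \<Longrightarrow> x \<in> C \<Longrightarrow> \<exists>D. compact D \<and> C \<subseteq> D \<and>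
      (\<forall>p. edge_path (orbit_complex chi C) p \<longrightarrow> hd p = x \<longrightarrow> last p = x \<longrightarrow>
           edge_homotopic (orbit_complex chi D) p [x])"
  shows "compactly_presented_along chi"
proof -
  interpret additive_character chi using chi by (rule is_character_additive)
  \<comment> \<open>A step of a walk is translated to the edge from \<open>h + x\<close> to
    \<open>h + y + x\<close>, which lies in \<open>h + C\<close>.\<close>
  define C where "C = insert x ((\<lambda>y. y + x) ` (X \<union> uminus ` X))"
  have "compact C"
    unfolding C_def using X
    by (intro compact_insert compact_continuous_image compact_Un) (auto intro!: continuous_intros)
  then obtain D where D: "compact D" "C \<subseteq> D"
    and nullD: "\<And>p. edge_path (orbit_complex chi C) p \<Longrightarrow> hd p = x \<Longrightarrow> last p = x \<Longrightarrow>
        edge_homotopic (orbit_complex chi D) p [x]"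
    using null[of C] by (auto simp: C_def)
  let ?K = "orbit_complex chi D"
  have xD: "x \<in> D" using D(2) by (auto simp: C_def)
  \<comment> \<open>Holds the differences of base points of adjacent vertices \<open>u\<close> and
    \<open>v\<close>: one passes from \<open>base u\<close> to \<open>u\<close>, to the base point
    of a translate containing both, to \<open>v\<close>, and to \<open>base v\<close>. Each passage
    contributes one element of \<open>D\<close>.\<close>
  define Q where "Q = (\<lambda>(a, b, c, d). a - b + c - d) ` (D \<times> D \<times> D \<times> D)"
  have "compact Q"
    unfolding Q_def using D(1) by (intro compact_continuous_image compact_Times) (auto simp: split_def intro!: continuous_intros)
  then obtain M where M: "Q \<inter> half chi \<subseteq> short_values chi X M"
    using compact_bounded_length[OF lc chi X] by blast
  \<comment> \<open>On vertices \<open>h + x\<close> with \<open>h\<close> in the half space the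
    base point must be \<open>h\<close>, so that the translated walk leads back to the original
    prefixes; at other vertices any translate containing \<open>v\<close> will do.\<close>
  define base where "base v = (if 0 \<le> chi (v - x) then v - x else SOME g. g \<in> half chi \<and> - g + v \<in> D)" for v
  have base: "base v \<in> half chi \<and> - base v + v \<in> D" if "?K {v}" for v
  proof (cases "0 \<le> chi (v - x)")
    case True
    have "- (v - x) + v = x" by (simp add: group_simps del: add_uminus_conv_diff)
    then show ?thesis using True xD by (simp add: base_def half_def)
  next
    case False
    have "\<exists>g. g \<in> half chi \<and> - g + v \<in> D"
      using that by (auto simp: orbit_complex_def)
    then show ?thesis using False unfolding base_def by (simp only: if_False) (rule someI_ex)
  qed
  have base_translate: "base (h + x) = h" if "0 \<le> chi h" for h
    using that by (simp add: base_def add_diff_eq[symmetric])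
  have base_x: "base x = 0" using base_translate[of 0] by simp
  have word: "\<exists>w. w \<in> words X \<and> length w \<le> M \<and> val w = - base u + base v \<and> letter_track chi (chi (base u)) w"
    if uv: "?K {u, v}" for u v
  proof -
    obtain g where g: "g \<in> half chi" "- g + u \<in> D" "- g + v \<in> D"
      using uv by (auto simp: orbit_complex_def)
    have b: "base u \<in> half chi" "- base u + u \<in> D" "base v \<in> half chi" "- base v + v \<in> D"
      using base[of u] base[of v] orbit_complex.subset_closed[OF uv] by auto
    have Q: "a - b + c - d \<in> Q" if "a \<in> D" "b \<in> D" "c \<in> D" "d \<in> D" for a b c d
      using that unfolding Q_def by force
    have e: "(- base u + u) - (- g + u) + (- g + v) - (- base v + v) = - base u + base v"
      "(- base v + v) - (- g + v) + (- g + u) - (- base u + u) = - (- base u + base v)"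
      by (simp_all add: group_simps del: add_uminus_conv_diff)
    have "- base u + base v \<in> Q" "- (- base u + base v) \<in> Q"
      using Q[OF b(2) g(2,3) b(4)] Q[OF b(4) g(3,2) b(2)] unfolding e by auto
    moreover have "- base u + base v \<in> half chi \<or> - (- base u + base v) \<in> half chi"
      unfolding half_def by (simp add: chi_add) linarith
    ultimately have "- base u + base v \<in> short_values chi X M \<or> - (- base u + base v) \<in> short_values chi X M"
      using M by blast
    then have "\<exists>w\<in>words X. length w \<le> M \<and> val w = - base u + base v \<and> letter_track chi (chi (base u)) w"
      by (rule short_word_from_height) (use b in \<open>auto simp: half_def chi_add\<close>)
    then show ?thesis by blast
  qed
  then obtain E where E: "\<And>u v. ?K {u, v} \<Longrightarrow> E u v \<in> words X \<and> length (E u v) \<le> M \<and>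
      val (E u v) = - base u + base v \<and> letter_track chi (chi (base u)) (E u v)"
    by metis
  have path_word: "path_word E p \<in> words X \<and> val (path_word E p) = - base (hd p) + base (last p) \<and>
      letter_track chi (chi (base (hd p))) (path_word E p)" if "edge_path ?K p" for p
    using that
  proof (induction p rule: induct_list012)
    case (2 v)
    then show ?case using base[of v] by (simp add: half_def)
  next
    case (3 u v p)
    have "?K {v}" "?K {u, v}"
      using 3 by (auto intro: orbit_complex.subset_closed)
    then have "edge_path ?K (v # p)" using 3 by simp
    then show ?case
      using 3 E[OF \<open>?K {u, v}\<close>] by (auto simp: chi_add add.assoc)
  qed (simp add: edge_path_def)
  \<comment> \<open>A triangle involves three edge words of length at most \<open>M\<close>.
    Replacing an edge word by a single letter needs relators of length \<open>M + 1\<close>.\<close>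
  define R where "R = {r \<in> relations X. length r \<le> 3 * M + 1}"
  let ?F = "follows_along chi X R"
  have replace: "?F (a @ u @ b) \<longleftrightarrow> ?F (a @ v @ b)"
    if "length u + length v \<le> 3 * M + 1" "a \<in> words X" "u \<in> words X" "v \<in> words X" "b \<in> words X"
      "val u = val v" "letter_track chi 0 (a @ u)" "letter_track chi 0 (a @ v)" for a u v b
    using that follows_along_replace[of X R a u b v] follows_along_replace[of X R a v b u] by (auto simp: R_def)
  have step: "?F (path_word E p) \<longleftrightarrow> ?F (path_word E q)"
    if st: "edge_step ?K p q" and p: "edge_path ?K p" "hd p = x" for p q
    using st
  proof cases
    case (triangle u v w a b)
    have K: "?K {u, v}" "?K {v, w}" "?K {u, w}"
      using triangle by (auto intro: orbit_complex.subset_closed)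
    have pa: "edge_path ?K (a @ [u])" "edge_path ?K (w # b)" "hd (a @ [u]) = x"
      using p triangle K by (auto simp: edge_path_def successively_append_iff hd_append intro: orbit_complex.subset_closed split: if_splits)
    have eq: "path_word E p = path_word E (a @ [u]) @ (E u v @ E v w) @ path_word E (w # b)"
      "path_word E q = path_word E (a @ [u]) @ E u w @ path_word E (w # b)"
      using triangle path_word_append[of E a u "v # w # b"] path_word_append[of E a u "w # b"] by auto
    have "letter_track chi (chi (base u) + (- chi (base u) + chi (base v))) (E v w)"
      using E[OF K(2)] by simp
    then show ?thesis
      unfolding eq using path_word[OF pa(1)] path_word[OF pa(2)] E[OF K(1)] E[OF K(2)] E[OF K(3)] pa(3)
      by (intro replace) (auto simp: base_x add.assoc chi_add)
  next
    case (stutter u a b)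
    have K: "?K {u, u}"
      using stutter by (auto intro: orbit_complex.subset_closed)
    have pa: "edge_path ?K (a @ [u])" "edge_path ?K (u # b)" "hd (a @ [u]) = x"
      using p stutter K by (auto simp: edge_path_def successively_append_iff hd_append intro: orbit_complex.subset_closed split: if_splits)
    have eq: "path_word E p = path_word E (a @ [u]) @ E u u @ path_word E (u # b)"
      "path_word E q = path_word E (a @ [u]) @ [] @ path_word E (u # b)"
      using stutter path_word_append[of E a u "u # b"] path_word_append[of E a u b] by auto
    show ?thesis
      unfolding eq using path_word[OF pa(1)] path_word[OF pa(2)] E[OF K] pa(3)
      by (intro replace) (auto simp: base_x)
  qed
  have homotopic: "?F (path_word E p)" if "edge_homotopic ?K p [x]" for p
  proof -
    \<comment> \<open>The homotopy is followed backwards from \<open>[x]\<close>, whose word is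
      empty and hence a consequence of \<open>R\<close>.\<close>
    have "edge_path ?K q \<and> hd q = x \<and> ?F (path_word E q)" if "edge_homotopic ?K [x] q" for q
      using that unfolding edge_homotopic_def
    proof (induction rule: equivclp_induct)
      case base
      have "?K {x}" using xD by (auto simp: orbit_complex_def half_def mem_left_translate intro!: exI[of _ 0])
      then show ?case by (simp add: follows_along_nil)
    next
      case (step p q)
      then show ?case
        using orbit_complex.edge_step_edge_path[of chi D p q] orbit_complex.edge_step_edge_path[of chi D q p]
          \<open>\<And>p q. \<lbrakk>edge_step ?K p q; edge_path ?K p; hd p = x\<rbrakk> \<Longrightarrow> ?F (path_word E p) \<longleftrightarrow> ?F (path_word E q)\<close>
        by metis
    qed
    then show ?thesis using that edge_homotopic_sym by blast
  qed
  have "?F \<rho>" if \<rho>: "\<rho> \<in> nonneg_relations chi X" for \<rho>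
  proof -
    have edge: "?K {h + x, h + read_letter y + x}" "edge_path (orbit_complex chi C) [h + x, h + read_letter y + x]"
      if "0 \<le> chi h" "0 \<le> chi (h + read_letter y)" "y \<in> X <+> X" for h y
    proof -
      have "read_letter y + x \<in> C" using read_letter_in[OF that(3)] by (auto simp: C_def)
      moreover have "x \<in> C" by (simp add: C_def)
      ultimately have "orbit_complex chi C {h + x, h + read_letter y + x}"
        unfolding orbit_complex_def using that
        by (intro bexI[of _ h]) (auto simp: mem_left_translate half_def add.assoc)
      then show "?K {h + x, h + read_letter y + x}"
        "edge_path (orbit_complex chi C) [h + x, h + read_letter y + x]"
        using D(2) by (auto simp: orbit_complex_def)
    qed
    have path: "edge_path (orbit_complex chi C) (map (\<lambda>h. h + x) (walk h w))"
      if "w \<in> words X" "letter_track chi (chi h) w" for h w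
      using that
    proof (induction w arbitrary: h)
      case Nil
      then show ?case
        by (auto simp: orbit_complex_def half_def mem_left_translate C_def intro!: exI[of _ h])
    next
      case (Cons y w)
      have IH: "edge_path (orbit_complex chi C) (map (\<lambda>h. h + x) (walk (h + read_letter y) w))"
        using Cons by (intro Cons.IH) (auto simp: chi_add)
      have "edge_path (orbit_complex chi C) [h + x, h + read_letter y + x]"
        using Cons.prems track_from_start by (intro edge) (auto simp: chi_add)
      then show ?case
        using IH by (auto simp: edge_path_def successively_Cons hd_map)
    qed
    have "edge_homotopic ?K (map (\<lambda>h. h + x) (walk 0 \<rho>)) [x]"
      using \<rho> by (intro nullD path) (auto simp: nonneg_relations_iff hd_map last_map)
    then have "?F ([] @ path_word E (map (\<lambda>h. h + x) (walk 0 \<rho>)))"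
      using homotopic by simp
    \<comment> \<open>Letters are restored from the left: \<open>u\<close> is already part of the
      original relation, the rest is still spelled by edge words.\<close>
    moreover have "?F (u @ w)" if "?F (u @ path_word E (map (\<lambda>h. h + x) (walk (val u) w)))"
      "u \<in> words X" "w \<in> words X" "letter_track chi 0 (u @ w)" for u w
      using that
    proof (induction w arbitrary: u)
      case (Cons y w)
      let ?g = "val u" and ?b = "path_word E (map (\<lambda>h. h + x) (walk (val u + read_letter y) w))"
      have nn: "0 \<le> chi ?g" "0 \<le> chi (?g + read_letter y)"
        using Cons.prems(4) track_from_start by (auto simp: chi_add)
      have y: "y \<in> X <+> X" using Cons.prems by simp
      note K = edge(1)[OF nn y]
      have EE: "val (E (?g + x) (?g + read_letter y + x)) = read_letter y"
        "letter_track chi (chi ?g) (E (?g + x) (?g + read_letter y + x))"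
        using E[OF K] nn by (simp_all add: base_translate)
      have "edge_path ?K (map (\<lambda>h. h + x) (walk (?g + read_letter y) w))"
        using path[of w "?g + read_letter y"] Cons.prems D(2)
        by (auto simp: edge_path_def orbit_complex_def chi_add elim!: successively_mono)
      then have "?b \<in> words X" using path_word by blast
      have "path_word E (map (\<lambda>h. h + x) (walk ?g (y # w))) = E (?g + x) (?g + read_letter y + x) @ ?b"
        by (cases w) auto
      then have "?F (u @ E (?g + x) (?g + read_letter y + x) @ ?b)"
        using Cons.prems(1) by simp
      then have "?F (u @ [y] @ ?b)"
        using Cons.prems E[OF K] EE y \<open>?b \<in> words X\<close>
        by (subst (asm) replace[where v = "[y]"]) (auto dest: track_from_start)
      then have "?F ((u @ [y]) @ w)"
        using Cons.prems by (intro Cons.IH) auto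
      then show ?case by simp
    qed simp
    from this[of "[]" \<rho>] show ?thesis
      using \<rho> calculation by (simp add: nonneg_relations_iff)
  qed
  then have "presentation_along chi X R"
    using X by (auto simp: presentation_along_def R_def)
  moreover have "\<forall>r\<in>R. length r \<le> 3 * M + 1" by (simp add: R_def)
  ultimately show ?thesis
    unfolding compactly_presented_along_def using X by blast
qed

section \<open>Path homotopies\<close>

definition path_homotopic :: "'a topology \<Rightarrow> (real \<Rightarrow> 'a) \<Rightarrow> (real \<Rightarrow> 'a) \<Rightarrow> bool" where
  "path_homotopic T p q \<longleftrightarrow>
     homotopic_with (\<lambda>h. h 0 = p 0 \<and> h 1 = p 1) (top_of_set {0..1}) T p q"

definition path_join :: "(real \<Rightarrow> 'a) \<Rightarrow> (real \<Rightarrow> 'a) \<Rightarrow> real \<Rightarrow> 'a" where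
  "path_join p q t = (if t \<le> 1/2 then p (2 * t) else q (2 * t - 1))"

lemma path_homotopicD:
  assumes "path_homotopic T p q"
  shows "pathin T p" "pathin T q" "p 0 = q 0" "p 1 = q 1"
  using homotopic_with_imp_continuous_maps[OF assms[unfolded path_homotopic_def]]
    homotopic_with_imp_property[OF assms[unfolded path_homotopic_def]]
  by (auto simp: pathin_def)

lemma path_homotopic_iff:
  "path_homotopic T p q \<longleftrightarrow>
     (\<exists>h. continuous_map (prod_topology (top_of_set {0..1}) (top_of_set {0..1})) T h \<and>
       (\<forall>t\<in>{0..1}. h (0, t) = p t \<and> h (1, t) = q t \<and> h (t, 0) = p 0 \<and> h (t, 1) = p 1))"
  unfolding path_homotopic_def by (subst homotopic_with) auto

lemma path_homotopic_eq:
  assumes "pathin T p" "\<And>t. 0 \<le> t \<Longrightarrow> t \<le> 1 \<Longrightarrow> p t = q t"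
  shows "path_homotopic T p q"
  unfolding path_homotopic_def by (rule homotopic_with_equal) (use assms in \<open>auto simp: pathin_def\<close>)

lemma path_homotopic_refl: "pathin T p \<Longrightarrow> path_homotopic T p p"
  by (rule path_homotopic_eq) auto

lemma path_homotopic_sym:
  assumes "path_homotopic T p q"
  shows "path_homotopic T q p"
proof -
  have "homotopic_with (\<lambda>h. h 0 = p 0 \<and> h 1 = p 1) (top_of_set {0..1}) T q p"
    using assms unfolding path_homotopic_def by (rule homotopic_with_symD)
  then show ?thesis
    unfolding path_homotopic_def path_homotopicD(3,4)[OF assms] .
qed

lemma path_homotopic_trans [trans]:
  assumes "path_homotopic T p q" "path_homotopic T q r"
  shows "path_homotopic T p r"
  using assms(2) unfolding path_homotopic_def path_homotopicD(3,4)[OF assms(1), symmetric]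
  by (rule homotopic_with_trans[OF assms(1)[unfolded path_homotopic_def]])

lemma path_homotopic_compose:
  assumes "path_homotopic S p q" "continuous_map S T f"
  shows "path_homotopic T (f \<circ> p) (f \<circ> q)"
  using assms unfolding path_homotopic_def
  by (rule homotopic_with_compose_continuous_map_left) auto

lemma path_join_compose: "path_join (f \<circ> p) (f \<circ> q) = f \<circ> path_join p q"
  by (auto simp: path_join_def fun_eq_iff)

lemma path_join_ends [simp]: "path_join p q 0 = p 0" "path_join p q 1 = q 1"
  by (auto simp: path_join_def)

lemma continuous_map_cases_le_const:
  fixes c :: real
  assumes p: "continuous_on S p"
    and f: "continuous_map (top_of_set {x \<in> S. p x \<le> c}) T f"
    and g: "continuous_map (top_of_set {x \<in> S. c \<le> p x}) T g"
    and eq: "\<And>x. x \<in> S \<Longrightarrow> p x = c \<Longrightarrow> f x = g x"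
  shows "continuous_map (top_of_set S) T (\<lambda>x. if p x \<le> c then f x else g x)"
proof -
  have "S \<inter> {x \<in> S. P x} = {x \<in> S. P x}" for P by auto
  then show ?thesis
    using assms by (intro continuous_map_cases_le) (auto simp: subtopology_subtopology)
qed

lemma pathin_path_join:
  assumes "pathin T p" "pathin T q" "p 1 = q 0"
  shows "pathin T (path_join p q)"
  unfolding pathin_def path_join_def
proof (rule continuous_map_cases_le_const)
  have "continuous_map (top_of_set {x \<in> {0..1}. x \<le> 1/2}) T (p \<circ> (\<lambda>t. 2 * t))"
    by (rule continuous_map_compose[OF _ assms(1)[unfolded pathin_def]])
      (auto intro!: continuous_intros)
  then show "continuous_map (top_of_set {x \<in> {0..1}. x \<le> 1/2}) T (\<lambda>t. p (2 * t))"
    by (simp add: o_def)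
  have "continuous_map (top_of_set {x \<in> {0..1}. 1/2 \<le> x}) T (q \<circ> (\<lambda>t. 2 * t - 1))"
    by (rule continuous_map_compose[OF _ assms(2)[unfolded pathin_def]])
      (auto intro!: continuous_intros)
  then show "continuous_map (top_of_set {x \<in> {0..1}. 1/2 \<le> x}) T (\<lambda>t. q (2 * t - 1))"
    by (simp add: o_def)
next
  show "p (2 * t) = q (2 * t - 1)" if "t = 1/2" for t :: real
    unfolding that using assms(3) by simp
qed auto

lemma path_homotopic_join:
  assumes "path_homotopic T p p'" "path_homotopic T q q'" "p 1 = q 0"
  shows "path_homotopic T (path_join p q) (path_join p' q')"
proof -
  let ?J = "{0..1::real} \<times> {0..1::real}"
  obtain h where h: "continuous_map (top_of_set ?J) T h"
    "\<And>t. t \<in> {0..1} \<Longrightarrow> h (0, t) = p t \<and> h (1, t) = p' t \<and> h (t, 0) = p 0 \<and> h (t, 1) = p 1"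
    using assms(1) unfolding path_homotopic_iff prod_topology_subtopology_eu by metis
  obtain k where k: "continuous_map (top_of_set ?J) T k"
    "\<And>t. t \<in> {0..1} \<Longrightarrow> k (0, t) = q t \<and> k (1, t) = q' t \<and> k (t, 0) = q 0 \<and> k (t, 1) = q 1"
    using assms(2) unfolding path_homotopic_iff prod_topology_subtopology_eu by metis
  define H where "H = (\<lambda>z. if snd z \<le> 1/2 then h (fst z, 2 * snd z) else k (fst z, 2 * snd z - 1))"
  have "continuous_map (top_of_set ?J) T H"
    unfolding H_def
  proof (rule continuous_map_cases_le_const)
    have "continuous_map (top_of_set {x \<in> ?J. snd x \<le> 1/2}) T (h \<circ> (\<lambda>z. (fst z, 2 * snd z)))"
      by (rule continuous_map_compose[OF _ h(1)]) (auto intro!: continuous_intros)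
    then show "continuous_map (top_of_set {x \<in> ?J. snd x \<le> 1/2}) T (\<lambda>z. h (fst z, 2 * snd z))"
      by (simp add: o_def)
    have "continuous_map (top_of_set {x \<in> ?J. 1/2 \<le> snd x}) T (k \<circ> (\<lambda>z. (fst z, 2 * snd z - 1)))"
      by (rule continuous_map_compose[OF _ k(1)]) (auto intro!: continuous_intros)
    then show "continuous_map (top_of_set {x \<in> ?J. 1/2 \<le> snd x}) T (\<lambda>z. k (fst z, 2 * snd z - 1))"
      by (simp add: o_def)
  next
    fix z :: "real \<times> real"
    assume "z \<in> ?J" "snd z = 1/2"
    then show "h (fst z, 2 * snd z) = k (fst z, 2 * snd z - 1)"
      using h(2)[of "fst z"] k(2)[of "fst z"] assms(3) by (cases z) (auto simp del: eq_divide_eq_numeral1)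
  qed (auto intro!: continuous_intros)
  then show ?thesis
    unfolding path_homotopic_iff prod_topology_subtopology_eu
    by (intro exI[of _ H]) (auto simp: H_def path_join_def h(2) k(2))
qed

lemma path_homotopic_convex:
  fixes p q :: "real \<Rightarrow> 'a::real_normed_vector"
  assumes "convex Z" "continuous_on {0..1} p" "continuous_on {0..1} q" "p ` {0..1} \<subseteq> Z" "q ` {0..1} \<subseteq> Z"
    and "p 0 = q 0" "p 1 = q 1"
  shows "path_homotopic (top_of_set Z) p q"
proof -
  define h where "h = (\<lambda>(s, t). (1 - s) *\<^sub>R p t + s *\<^sub>R q t)"
  have "continuous_on ({0..1} \<times> {0..1}) h"
    unfolding h_def split_def
    by (intro continuous_intros continuous_on_compose2[OF assms(2)] continuous_on_compose2[OF assms(3)]) auto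
  moreover have "h z \<in> Z" if "z \<in> {0..1} \<times> {0..1}" for z
    using that assms by (auto simp: h_def split_def intro!: convexD)
  ultimately have "continuous_map (prod_topology (top_of_set {0..1}) (top_of_set {0..1})) (top_of_set Z) h"
    by (auto simp: prod_topology_subtopology_eu)
  then show ?thesis
    unfolding path_homotopic_iff
    using assms(6,7) by (intro exI[of _ h]) (auto simp: h_def scaleR_left_diff_distrib)
qed

abbreviation "\<Delta> \<equiv> standard_simplex"

text \<open>The straight line homotopy once more, now coordinatewise: the space of sequences with
  the product topology carries no norm.\<close>

lemma path_homotopic_simplex:
  assumes "continuous_on {0..1} p" "continuous_on {0..1} q"
    and "p ` {0..1} \<subseteq> \<Delta> n" "q ` {0..1} \<subseteq> \<Delta> n"
    and "p 0 = q 0" "p 1 = q 1"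
  shows "path_homotopic (top_of_set (\<Delta> n)) p q"
proof -
  define h where "h = (\<lambda>(s, t) i. (1 - s) * p t i + s * q t i)"
  have snd: "continuous_on ({0..1} \<times> {0..1}) (\<lambda>z. f (snd z) i)"
    if "continuous_on {0..1} f" for f :: "real \<Rightarrow> nat \<Rightarrow> real" and i
    by (rule continuous_on_compose2[OF continuous_on_product_then_coordinatewise[OF that]])
      (auto intro: continuous_on_snd)
  have "continuous_on ({0..1} \<times> {0..1}) (\<lambda>z. h z i)" for i
    unfolding h_def split_def
    by (intro continuous_on_add continuous_on_mult continuous_on_diff continuous_on_const
        continuous_on_fst continuous_on_id snd assms(1,2))
  then have "continuous_on ({0..1} \<times> {0..1}) h"
    by (rule continuous_on_coordinatewise_then_product)
  moreover have "h z \<in> \<Delta> n" if z01: "z \<in> {0..1} \<times> {0..1}" for z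
  proof -
    obtain s t where z: "z = (s, t)" "s \<in> {0..1}" "t \<in> {0..1}" using z01 by blast
    then have "p t \<in> \<Delta> n" "q t \<in> \<Delta> n" using assms by auto
    then show ?thesis
      using convex_standard_simplex[of "p t" n "q t" s] z by (simp add: h_def)
  qed
  ultimately have "continuous_map (prod_topology (top_of_set {0..1}) (top_of_set {0..1}))
      (top_of_set (\<Delta> n)) h"
    by (auto simp: prod_topology_subtopology_eu)
  then show ?thesis
    unfolding path_homotopic_iff
    using assms(5,6) by (intro exI[of _ h]) (auto simp: h_def algebra_simps fun_eq_iff)
qed

text \<open>The homotopy takes place in the convex parameter interval. The laws of association,
  units and subdivision below are instances.\<close>

lemma path_homotopic_reparametrize:
  assumes "pathin T f" "continuous_on {0..1} p" "continuous_on {0..1} q"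
    and "p ` {0..1} \<subseteq> {0..1}" "q ` {0..1} \<subseteq> {0..1}" "p 0 = q 0" "p 1 = q 1"
  shows "path_homotopic T (f \<circ> p) (f \<circ> q)"
proof (rule path_homotopic_compose)
  show "path_homotopic (top_of_set {0..1}) p q"
    using assms by (intro path_homotopic_convex) auto
qed (use assms in \<open>simp add: pathin_def\<close>)

lemma path_homotopic_assoc:
  assumes "pathin T p" "pathin T q" "pathin T r" "p 1 = q 0" "q 1 = r 0"
  shows "path_homotopic T (path_join (path_join p q) r) (path_join p (path_join q r))"
proof -
  let ?f = "path_join p (path_join q r)"
  \<comment> \<open>The reparametrization has slopes 2, 1 and 1/2 with breaks at 1/4 and 1/2. Being
    concave, it is the minimum of its linear pieces, which makes continuity immediate.\<close>
  define s where "s t = min (2 * t) (min (t + 1/4) ((t + 1) / 2))" for t :: real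
  have f: "pathin T ?f" using assms by (intro pathin_path_join) auto
  have "path_homotopic T (?f \<circ> s) (?f \<circ> id)"
    using f by (rule path_homotopic_reparametrize) (auto simp: s_def min_le_iff_disj intro!: continuous_intros)
  moreover have "path_join (path_join p q) r = ?f \<circ> s"
  proof
    fix t :: real
    consider "t \<le> 1/4" | "1/4 < t" "t \<le> 1/2" | "1/2 < t" by linarith
    then show "path_join (path_join p q) r t = (?f \<circ> s) t"
    proof cases
      case 1
      then have "s t = 2 * t" by (simp add: s_def)
      then show ?thesis using 1 by (simp add: path_join_def)
    next
      case 2
      then have "s t = t + 1/4" by (simp add: s_def)
      then show ?thesis using 2 by (simp add: path_join_def algebra_simps)
    next
      case 3
      then have "s t = (t + 1) / 2" by (simp add: s_def)
      then show ?thesis using 3 by (simp add: path_join_def algebra_simps)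
    qed
  qed
  ultimately show ?thesis by simp
qed

lemma path_homotopic_rid:
  assumes "pathin T p"
  shows "path_homotopic T (path_join p (\<lambda>_. p 1)) p"
proof -
  define s where "s t = min (2 * t) 1" for t :: real
  have "path_homotopic T (p \<circ> s) (p \<circ> id)"
    using assms by (rule path_homotopic_reparametrize) (auto simp: s_def intro!: continuous_intros)
  moreover have "path_join p (\<lambda>_. p 1) = p \<circ> s"
    by (auto simp: path_join_def s_def fun_eq_iff min_def)
  ultimately show ?thesis by simp
qed

lemma path_homotopic_lid:
  assumes "pathin T p"
  shows "path_homotopic T (path_join (\<lambda>_. p 0) p) p"
proof -
  have mm: "min (2 * t) 1 = (if t \<le> 1/2 then 2 * t else 1)" "max 0 (2 * t - 1) = (if t \<le> 1/2 then 0 else 2 * t - 1)" for t :: real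
    by auto
  define s where "s t = max 0 (2 * t - 1)" for t :: real
  have "path_homotopic T (p \<circ> s) (p \<circ> id)"
    using assms by (rule path_homotopic_reparametrize) (auto simp: s_def intro!: continuous_intros)
  moreover have "path_join (\<lambda>_. p 0) p = p \<circ> s"
    by (auto simp: path_join_def s_def fun_eq_iff mm)
  ultimately show ?thesis by simp
qed

lemma path_homotopic_join_subpath:
  assumes "pathin T f" "0 \<le> a" "a \<le> b" "b \<le> 1"
  shows "path_homotopic T (path_join (\<lambda>t. f (t * a)) (\<lambda>t. f (a + t * (b - a)))) (\<lambda>t. f (t * b))"
proof -
  have mm: "min (2 * t) 1 = (if t \<le> 1/2 then 2 * t else 1)" "max 0 (2 * t - 1) = (if t \<le> 1/2 then 0 else 2 * t - 1)" for t :: real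
    by auto
  \<comment> \<open>The first half of the time runs from 0 to \<open>a\<close>, the second from
    \<open>a\<close> to \<open>b\<close>, written as a sum of two clamped ramps.\<close>
  define s where "s t = min (2 * t) 1 * a + max 0 (2 * t - 1) * (b - a)" for t :: real
  have "s t \<in> {0..1}" if "t \<in> {0..1}" for t
  proof -
    have "min (2 * t) 1 * a \<le> 1 * a" "max 0 (2 * t - 1) * (b - a) \<le> 1 * (b - a)"
      using that assms by (intro mult_right_mono; auto)+
    then show ?thesis using that assms by (auto simp: s_def)
  qed
  moreover have "t * b \<in> {0..1}" if "t \<in> {0..1}" for t
    using that assms mult_le_one[of t b] by auto
  moreover have "continuous_on {0..1} s" "continuous_on {0..1} (\<lambda>t. t * b)"
    unfolding s_def by (intro continuous_intros)+
  moreover have "s 0 = 0 * b" "s 1 = 1 * b" by (simp_all add: s_def)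
  ultimately have "path_homotopic T (f \<circ> s) (f \<circ> (\<lambda>t. t * b))"
    by (intro path_homotopic_reparametrize[OF assms(1)]) blast+
  moreover have "path_join (\<lambda>t. f (t * a)) (\<lambda>t. f (a + t * (b - a))) = f \<circ> s"
    by (auto simp: path_join_def s_def fun_eq_iff mm)
  ultimately show ?thesis by (simp add: o_def)
qed

section \<open>Geometric realizations\<close>

text \<open>The characteristic map of the simplex \<open>x\<close>.\<close>

definition cell :: "('s, 'm) sset_scheme \<Rightarrow> nat \<Rightarrow> 's \<Rightarrow> (nat \<Rightarrow> real) \<Rightarrow> (nat \<times> 's \<times> (nat \<Rightarrow> real)) set" where
  "cell X n x t = realization_rel X `` {(n, x, t)}"

lemma topspace_realization:
  "topspace (realization X) = {cell X n x t |n x t. x \<in> simplices X n \<and> t \<in> \<Delta> n}"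
  by (auto simp: realization_def topspace_prerealization cell_def)

lemma cell_in_topspace: "x \<in> simplices X n \<Longrightarrow> t \<in> \<Delta> n \<Longrightarrow> cell X n x t \<in> topspace (realization X)"
  by (auto simp: topspace_realization)

lemma mem_cell: "x \<in> simplices X n \<Longrightarrow> t \<in> \<Delta> n \<Longrightarrow> (n, x, t) \<in> cell X n x t"
  by (auto simp: cell_def realization_rel_def topspace_prerealization)

lemma cell_eqI:
  assumes "(p, q) \<in> realization_rel X"
  shows "realization_rel X `` {p} = realization_rel X `` {q}"
  using equiv_realization_rel assms by (rule equiv_class_eq)

lemma quotient_map_realization:
  "quotient_map (prerealization X) (realization X) (\<lambda>p. realization_rel X `` {p})"
  unfolding realization_def by (rule quotient_map_quotient_topology)

lemma powertop_simplex:
  "subtopology (powertop_real UNIV) (\<Delta> n) = top_of_set (\<Delta> n)"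
  by (simp add: euclidean_product_topology)

text \<open>Since the sets of simplices are discrete, a neighbourhood of \<open>(n, x, t)\<close>
  may keep \<open>n\<close> and \<open>x\<close> fixed.\<close>

lemma openin_prerealization:
  assumes "U \<subseteq> topspace (prerealization X)"
    and "\<And>n x. x \<in> simplices X n \<Longrightarrow> openin (top_of_set (\<Delta> n)) {t \<in> \<Delta> n. (n, x, t) \<in> U}"
  shows "openin (prerealization X) U"
  unfolding prerealization_def openin_sum_topology powertop_simplex
proof (intro conjI ballI)
  show "U \<subseteq> Sigma UNIV (topspace \<circ> (\<lambda>n. prod_topology (discrete_topology (simplices X n)) (top_of_set (\<Delta> n))))"
    using assms(1) by (auto simp: topspace_prerealization)
  fix n :: nat
  show "openin (prod_topology (discrete_topology (simplices X n)) (top_of_set (\<Delta> n))) {z. (n, z) \<in> U}"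
    unfolding openin_prod_topology_alt
  proof (intro allI impI)
    fix x t assume z: "(x, t) \<in> {z. (n, z) \<in> U}"
    then have "x \<in> simplices X n" "t \<in> \<Delta> n"
      using assms(1) by (auto simp: topspace_prerealization)
    then show "\<exists>V W. openin (discrete_topology (simplices X n)) V \<and> openin (top_of_set (\<Delta> n)) W \<and>
        x \<in> V \<and> t \<in> W \<and> V \<times> W \<subseteq> {z. (n, z) \<in> U}"
      using assms(2)[of x n] z
      by (intro exI[of _ "{x}"] exI[of _ "{t \<in> \<Delta> n. (n, x, t) \<in> U}"]) auto
  qed
qed

lemma continuous_map_prerealization_simplex:
  assumes "x \<in> simplices X n"
  shows "continuous_map (top_of_set (\<Delta> n)) (prerealization X) (\<lambda>t. (n, x, t))"
proof -
  have "continuous_map (top_of_set (\<Delta> n))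
      (prod_topology (discrete_topology (simplices X n)) (top_of_set (\<Delta> n))) (\<lambda>t. (x, t))"
    using assms by (intro continuous_map_pairedI) auto
  then have "continuous_map (top_of_set (\<Delta> n)) (prerealization X) ((\<lambda>z. (n, z)) \<circ> (\<lambda>t. (x, t)))"
    unfolding prerealization_def powertop_simplex
    by (rule continuous_map_compose) (rule continuous_map_component_injection, simp)
  then show ?thesis by (simp add: o_def)
qed

lemma continuous_map_cell:
  assumes "x \<in> simplices X n"
  shows "continuous_map (top_of_set (\<Delta> n)) (realization X) (cell X n x)"
  using continuous_map_compose[OF continuous_map_prerealization_simplex[OF assms]
      quotient_imp_continuous_map[OF quotient_map_realization]]
  by (simp add: o_def cell_def[abs_def])

lemma simplex_collapse_in_standard_simplex:
  assumes t: "t \<in> \<Delta> (Suc n)" and k: "k \<le> n"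
  shows "simplex_collapse k t \<in> \<Delta> n"
proof -
  have "(\<Sum>i\<le>n. simplex_collapse k t i) = (\<Sum>i\<le>Suc n. t i)"
    using k
  proof (induction n)
    case 0
    then show ?case by (simp add: simplex_collapse_def)
  next
    case (Suc n)
    show ?case
    proof (cases "k = Suc n")
      case True
      then have "(\<Sum>i\<le>n. simplex_collapse k t i) = (\<Sum>i\<le>n. t i)"
        by (intro sum.cong) (auto simp: simplex_collapse_def)
      then show ?thesis using True by (simp add: simplex_collapse_def)
    next
      case False
      then have "(\<Sum>i\<le>n. simplex_collapse k t i) = (\<Sum>i\<le>Suc n. t i)" using Suc by auto
      then show ?thesis using False Suc.prems by (simp add: simplex_collapse_def)
    qed
  qed
  then have s: "(\<Sum>i\<le>n. simplex_collapse k t i) = 1" using t by (simp add: standard_simplex_def)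
  have nonneg: "0 \<le> simplex_collapse k t i" for i
    using t by (auto simp: simplex_collapse_def standard_simplex_def)
  have zero: "simplex_collapse k t i = 0" if "i > n" for i
    using t k that by (auto simp: simplex_collapse_def standard_simplex_def)
  have "simplex_collapse k t i \<le> 1" for i
  proof (cases "i \<le> n")
    case True
    then show ?thesis using member_le_sum[of i "{..n}" "simplex_collapse k t"] nonneg s by auto
  qed (use zero in auto)
  then show ?thesis using s nonneg zero by (auto simp: standard_simplex_def)
qed

lemma simplical_face_simplex:
  "t \<in> \<Delta> n \<Longrightarrow> i \<le> Suc n \<Longrightarrow> simplical_face i t \<in> \<Delta> (Suc n)"
  using simplical_face_in_standard_simplex[of "Suc n" i t] by simp

context simplicial_set
begin

lemma realization_gluing_topspace:
  assumes "(p, q) \<in> realization_gluing X"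
  shows "p \<in> topspace (prerealization X) \<and> q \<in> topspace (prerealization X)"
proof -
  obtain m x s n y t where pq: "p = (m, x, s)" "q = (n, y, t)"
    by (metis prod.exhaust)
  have "((m, x, s), (n, y, t)) \<in> realization_gluing X"
    using assms pq by simp
  then show ?thesis
    unfolding pq topspace_prerealization mem_Collect_eq case_prod_conv
  proof cases
    case (face i)
    then show "(x \<in> simplices X m \<and> s \<in> \<Delta> m) \<and> (y \<in> simplices X n \<and> t \<in> \<Delta> n)"
      using face_in[of x n i] simplical_face_simplex[of t n i] by simp
  next
    case (degen i)
    then show "(x \<in> simplices X m \<and> s \<in> \<Delta> m) \<and> (y \<in> simplices X n \<and> t \<in> \<Delta> n)"
      using degen_in[of x m i] simplex_collapse_in_standard_simplex[of t m i] by simp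
  qed
qed

lemma realization_gluing_rel: "(p, q) \<in> realization_gluing X \<Longrightarrow> (p, q) \<in> realization_rel X"
  using realization_gluing_topspace[of p q] unfolding realization_rel_def by blast

lemma cell_face:
  assumes "x \<in> simplices X (Suc n)" "t \<in> \<Delta> n" "i \<le> Suc n"
  shows "cell X (Suc n) x (simplical_face i t) = cell X n (face X (Suc n) i x) t"
  unfolding cell_def
  by (intro cell_eqI realization_gluing_rel realization_gluing.face assms)

lemma cell_degen:
  assumes "x \<in> simplices X n" "t \<in> \<Delta> (Suc n)" "i \<le> n"
  shows "cell X n x (simplex_collapse i t) = cell X (Suc n) (degen X n i x) t"
  unfolding cell_def
  by (intro cell_eqI realization_gluing_rel realization_gluing.degen assms)

lemma realization_rel_invariant:
  assumes "(p, q) \<in> realization_rel X"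
    and inv: "\<And>p q. (p, q) \<in> realization_gluing X \<Longrightarrow> f p = f q"
  shows "f p = f q"
proof -
  have "(p, q) \<in> (realization_gluing X \<union> (realization_gluing X)\<inverse>)\<^sup>*"
    using assms(1) unfolding realization_rel_def by blast
  then show ?thesis
  proof (induction rule: rtrancl_induct)
    case (step y z)
    then have "f y = f z" using inv[of y z] inv[of z y] by fastforce
    then show ?case using step.IH by simp
  qed simp
qed

end

text \<open>Simplicial sets whose simplices are all the tuples that span a simplex of an abstract
  simplicial complex. They are not determined by barycentric coordinates: the tuples \<open>(u, v)\<close> and
  \<open>(v, u)\<close> are different simplices.\<close>

definition tuple_sset :: "('a set \<Rightarrow> bool) \<Rightarrow> 'a list sset" where
  "tuple_sset K = (E_sset UNIV)\<lparr>simplices := \<lambda>n. {xs. length xs = Suc n \<and> K (set xs)}\<rparr>"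

lemma simplices_tuple_sset [simp]: "simplices (tuple_sset K) n = {xs. length xs = Suc n \<and> K (set xs)}"
  and face_tuple_sset [simp]: "face (tuple_sset K) n i xs = take i xs @ drop (Suc i) xs"
  and degen_tuple_sset [simp]: "degen (tuple_sset K) n i xs = take (Suc i) xs @ drop i xs"
  by (simp_all add: tuple_sset_def E_sset_def)

text \<open>The vertices of positive weight. Unlike the tuple and its coordinates, this set is
  preserved by faces and degeneracies, hence defined for points of the realization.\<close>

definition support :: "'a list \<Rightarrow> (nat \<Rightarrow> real) \<Rightarrow> 'a set" where
  "support xs t = {xs ! i |i. i < length xs \<and> 0 < t i}"

lemma simplex_support_subset: "support xs t \<subseteq> set xs"
  by (auto simp: support_def)

lemma simplex_support_face:
  assumes "i < length xs"
  shows "support xs (simplical_face i t) = support (take i xs @ drop (Suc i) xs) t"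
proof (intro equalityI subsetI)
  fix v assume "v \<in> support xs (simplical_face i t)"
  then obtain j where j: "v = xs ! j" "j < length xs" "0 < simplical_face i t j"
    by (auto simp: support_def)
  define k where "k = (if j < i then j else j - 1)"
  have "j \<noteq> i" using j by (auto simp: simplical_face_def)
  then show "v \<in> support (take i xs @ drop (Suc i) xs) t"
    using j assms unfolding support_def
    by (intro CollectI exI[of _ k]) (auto simp: k_def simplical_face_def nth_append)
next
  fix v assume "v \<in> support (take i xs @ drop (Suc i) xs) t"
  then obtain j where j: "v = (take i xs @ drop (Suc i) xs) ! j" "j < length xs - 1" "0 < t j"
    using assms by (auto simp: support_def)
  define k where "k = (if j < i then j else Suc j)"
  show "v \<in> support xs (simplical_face i t)"
    using j assms unfolding support_def
    by (intro CollectI exI[of _ k]) (auto simp: k_def simplical_face_def nth_append)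
qed

lemma simplex_support_degen:
  assumes "i < length xs" "\<And>j. 0 \<le> t j"
  shows "support xs (simplex_collapse i t) = support (take (Suc i) xs @ drop i xs) t"
proof (intro equalityI subsetI)
  fix v assume "v \<in> support xs (simplex_collapse i t)"
  then obtain j where j: "v = xs ! j" "j < length xs" "0 < simplex_collapse i t j"
    by (auto simp: support_def)
  \<comment> \<open>If the collapsed weight at \<open>i\<close> is positive, at least one of the two
    merged weights is, and \<open>k\<close> picks it; both positions carry the entry
    \<open>xs ! i\<close>.\<close>
  define k where "k = (if j < i \<or> (j = i \<and> 0 < t i) then j else Suc j)"
  have nth: "(take (Suc i) xs @ drop i xs) ! k = xs ! (if k \<le> i then k else k - 1)" if "k \<le> length xs" for k
    using that assms(1) by (auto simp: nth_append min_def not_le Suc_diff_le intro!: arg_cong[of _ _ "(!) xs"])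
  have "k \<le> length xs" using j by (auto simp: k_def)
  moreover have "0 < t k" using j assms(2)[of i] by (auto simp: k_def simplex_collapse_def split: if_splits)
  moreover have "v = (take (Suc i) xs @ drop i xs) ! k"
    unfolding nth[OF \<open>k \<le> length xs\<close>] using j by (auto simp: k_def)
  ultimately show "v \<in> support (take (Suc i) xs @ drop i xs) t"
    using assms(1) unfolding support_def by (intro CollectI exI[of _ k]) auto
next
  fix v assume "v \<in> support (take (Suc i) xs @ drop i xs) t"
  then obtain j where j: "v = (take (Suc i) xs @ drop i xs) ! j" "j < Suc (length xs)" "0 < t j"
    using assms by (auto simp: support_def)
  define k where "k = (if j \<le> i then j else j - 1)"
  have nth: "(take (Suc i) xs @ drop i xs) ! j = xs ! k"
    using j(2) assms(1) by (auto simp: k_def nth_append min_def not_le Suc_diff_le intro!: arg_cong[of _ _ "(!) xs"])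
  have "j < i \<or> j = i \<or> j = Suc i \<or> Suc i < j" by auto
  then have "0 < simplex_collapse i t k"
    using j(3) assms(2)[of i] assms(2)[of "Suc i"]
    by (elim disjE) (auto simp: k_def simplex_collapse_def add_pos_nonneg add_nonneg_pos)
  moreover have "k < length xs" using j(2) assms(1) by (auto simp: k_def)
  ultimately show "v \<in> support xs (simplex_collapse i t)"
    using j(1) nth unfolding support_def by auto
qed

text \<open>The join with a new vertex of index 0 and weight \<open>s\<close>; \<open>s = 0\<close>
  gives the opposite face and \<open>s = 1\<close> the new vertex.\<close>

definition cone_coords :: "real \<Rightarrow> (nat \<Rightarrow> real) \<Rightarrow> nat \<Rightarrow> real" where
  "cone_coords s t i = (case i of 0 \<Rightarrow> s | Suc j \<Rightarrow> (1 - s) * t j)"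

definition first_vertex :: "nat \<Rightarrow> real" where
  "first_vertex i = (if i = 0 then 1 else 0)"

text \<open>With \<open>1 - s\<close> the edge runs from its first to its second vertex, opposite to
  the direction of \<open>cone_coords\<close>.\<close>

definition segment :: "real \<Rightarrow> nat \<Rightarrow> real" where
  "segment s = cone_coords (1 - s) first_vertex"

lemma first_vertex_in_simplex: "first_vertex \<in> \<Delta> n"
  by (auto simp: standard_simplex_def first_vertex_def[abs_def] sum.delta)

lemma cone_coords_in_simplex:
  assumes "t \<in> \<Delta> n" "s \<in> {0..1}"
  shows "cone_coords s t \<in> \<Delta> (Suc n)"
proof -
  have "(\<Sum>i\<le>Suc n. cone_coords s t i) = s + (1 - s) * (\<Sum>i\<le>n. t i)"
    by (subst sum.atMost_Suc_shift) (simp add: cone_coords_def sum_distrib_left)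
  moreover have "(1 - s) * t j \<le> 1" for j
    using assms by (intro mult_le_one) (auto simp: standard_simplex_def)
  ultimately show ?thesis
    using assms by (auto simp: standard_simplex_def cone_coords_def split: nat.splits)
qed

lemma segment_in_simplex: "s \<in> {0..1} \<Longrightarrow> segment s \<in> \<Delta> (Suc 0)"
  unfolding segment_def by (rule cone_coords_in_simplex) (auto intro: first_vertex_in_simplex)

text \<open>Prepending a vertex shifts the index by one. This and the analogue for collapses make
  \<open>cone\<close> independent of representatives.\<close>

lemma cone_coords_face: "cone_coords s (simplical_face i t) = simplical_face (Suc i) (cone_coords s t)"
proof
  fix j
  show "cone_coords s (simplical_face i t) j = simplical_face (Suc i) (cone_coords s t) j"
    by (cases j; cases "j - 1") (auto simp: cone_coords_def simplical_face_def split: nat.splits)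
qed

lemma cone_coords_collapse: "cone_coords s (simplex_collapse i t) = simplex_collapse (Suc i) (cone_coords s t)"
proof
  fix j
  show "cone_coords s (simplex_collapse i t) j = simplex_collapse (Suc i) (cone_coords s t) j"
    by (cases j) (auto simp: cone_coords_def simplex_collapse_def algebra_simps)
qed

lemma cone_coords_0: "cone_coords 0 t = simplical_face 0 t"
  by (auto simp: cone_coords_def simplical_face_def fun_eq_iff split: nat.splits)

lemma cone_coords_1: "cone_coords 1 t = first_vertex"
  by (auto simp: cone_coords_def first_vertex_def fun_eq_iff split: nat.splits)

lemma segment_ends: "segment 0 = first_vertex" "segment 1 = simplical_face 0 first_vertex"
  by (simp_all add: segment_def cone_coords_0 cone_coords_1)

lemma segment_collapse: "simplex_collapse 0 (segment s) = first_vertex"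
  by (auto simp: segment_def cone_coords_def first_vertex_def simplex_collapse_def fun_eq_iff split: nat.splits)

lemma continuous_on_cone_coords:
  assumes "continuous_on S f" "continuous_on S g"
  shows "continuous_on S (\<lambda>x. cone_coords (f x) (g x))"
proof (rule continuous_on_coordinatewise_then_product)
  fix i show "continuous_on S (\<lambda>x. cone_coords (f x) (g x) i)"
  proof (cases i)
    case (Suc j)
    have "continuous_on S (\<lambda>x. (1 - f x) * g x j)"
      by (intro continuous_on_mult continuous_on_diff continuous_on_const assms(1)
          continuous_on_product_then_coordinatewise[OF assms(2)])
    then show ?thesis by (simp add: cone_coords_def Suc)
  qed (simp add: cone_coords_def assms(1))
qed

lemma continuous_on_segment: "continuous_on S f \<Longrightarrow> continuous_on S (\<lambda>x. segment (f x))"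
  unfolding segment_def by (intro continuous_on_cone_coords continuous_on_diff continuous_on_const)

section \<open>Open stars, edges and cones in the realization of a complex\<close>

type_synonym 'a point = "(nat \<times> 'a list \<times> (nat \<Rightarrow> real)) set"

text \<open>All representatives contribute the same set, see \<open>class_support_cell\<close>; the
  union merely avoids a choice.\<close>

definition class_support :: "'a point \<Rightarrow> 'a set" where
  "class_support c = (\<Union>(n, x, t)\<in>c. support x t)"

context subset_closed
begin

abbreviation cplx :: "'a list sset" where
  "cplx \<equiv> tuple_sset K"

abbreviation "cspace \<equiv> realization cplx"

abbreviation homotopic where
  "homotopic \<equiv> path_homotopic cspace"

sublocale tuples: simplicial_set cplx
proof -
  interpret E: simplicial_set "E_sset UNIV :: 'a list sset" by (rule simplicial_set_E)
  have ops: "face cplx = face (E_sset UNIV)" "degen cplx = degen (E_sset UNIV)"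
    by (simp_all add: tuple_sset_def)
  have sub: "x \<in> simplices cplx n \<Longrightarrow> x \<in> simplices (E_sset UNIV) n" for x n
    by (simp add: E_sset_def)
  show "simplicial_set cplx"
  proof
    fix x :: "'a list" and n i :: nat
    assume x: "x \<in> simplices cplx (Suc n)" "i \<le> Suc n"
    then have "K (set x)" by simp
    then have "K (set (take i x @ drop (Suc i) x))"
      by (rule subset_closed) (auto dest: in_set_takeD in_set_dropD)
    then show "face cplx (Suc n) i x \<in> simplices cplx n" using x by auto
  next
    fix x :: "'a list" and n i :: nat
    assume x: "x \<in> simplices cplx n" "i \<le> n"
    then have "K (set x)" by simp
    then have "K (set (take (Suc i) x @ drop i x))"
      by (rule subset_closed) (auto dest: in_set_takeD in_set_dropD)
    then show "degen cplx n i x \<in> simplices cplx (Suc n)" using x by auto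
  qed (unfold ops, (blast intro: sub E.face_face E.face_degen_less E.face_degen_same
         E.face_degen_greater E.degen_degen)+)
qed

lemma gluing_invariant:
  assumes face: "\<And>n x t i. \<lbrakk>length x = Suc (Suc n); K (set x); t \<in> \<Delta> n; i \<le> Suc n\<rbrakk> \<Longrightarrow>
      f (Suc n, x, simplical_face i t) = f (n, take i x @ drop (Suc i) x, t)"
    and degen: "\<And>n x t i. \<lbrakk>length x = Suc n; K (set x); t \<in> \<Delta> (Suc n); i \<le> n\<rbrakk> \<Longrightarrow>
      f (n, x, simplex_collapse i t) = f (Suc n, take (Suc i) x @ drop i x, t)"
    and rel: "(p, q) \<in> realization_rel cplx"
  shows "f p = f q"
  using rel
proof (rule tuples.realization_rel_invariant)
  fix p q assume pq: "(p, q) \<in> realization_gluing cplx"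
  obtain m x s n y t where e: "p = (m, x, s)" "q = (n, y, t)"
    by (cases p, cases q) blast
  show "f p = f q"
    using pq unfolding e by cases (simp_all add: face degen)
qed

lemma class_support_cell:
  assumes "length x = Suc n" "K (set x)" "t \<in> \<Delta> n"
  shows "class_support (cell cplx n x t) = support x t"
proof -
  have "(case p of (n, x, t) \<Rightarrow> support x t) = (case q of (n, x, t) \<Rightarrow> support x t)"
    if "(p, q) \<in> realization_rel cplx" for p q
    using that
    by (rule gluing_invariant[rotated 2]) (simp_all add: simplex_support_face simplex_support_degen standard_simplex_def)
  from this[of "(n, x, t)"] have "(case q of (n, x, t) \<Rightarrow> support x t) = support x t"
    if "q \<in> cell cplx n x t" for q
    using that by (simp add: cell_def)
  moreover have "(n, x, t) \<in> cell cplx n x t" using assms by (intro mem_cell) auto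
  ultimately show ?thesis
    unfolding class_support_def by blast
qed

definition open_star :: "'a \<Rightarrow> 'a point set" where
  "open_star v = {c \<in> topspace cspace. v \<in> class_support c}"

lemma topspace_cplxE:
  assumes "c \<in> topspace cspace"
  obtains n x t where "c = cell cplx n x t" "length x = Suc n" "K (set x)" "t \<in> \<Delta> n"
  using assms by (auto simp: topspace_realization)

lemma cell_in_open_star:
  assumes "length x = Suc n" "K (set x)" "t \<in> \<Delta> n"
  shows "cell cplx n x t \<in> open_star v \<longleftrightarrow> v \<in> support x t"
  using assms by (auto simp: open_star_def class_support_cell intro: cell_in_topspace)

text \<open>On each simplex the star is the union of the open conditions \<open>0 < t i\<close> over
  the positions \<open>i\<close> that carry \<open>v\<close>.\<close>

lemma openin_open_star: "openin cspace (open_star v)"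
  unfolding realization_def openin_quotient_topology
proof
  show "open_star v \<subseteq> (\<lambda>p. realization_rel cplx `` {p}) ` topspace (prerealization cplx)"
    unfolding open_star_def realization_def by auto
  show "openin (prerealization cplx) {p \<in> topspace (prerealization cplx). realization_rel cplx `` {p} \<in> open_star v}"
  proof (rule openin_prerealization)
    fix n x assume x: "x \<in> simplices cplx n"
    have "{t \<in> \<Delta> n. (n, x, t) \<in> {p \<in> topspace (prerealization cplx). realization_rel cplx `` {p} \<in> open_star v}}
        = {t \<in> \<Delta> n. \<exists>i<length x. x ! i = v \<and> 0 < t i}"
      using x cell_in_open_star[of x n _ v]
      by (auto simp: topspace_prerealization cell_def[symmetric] support_def)
    also have "\<dots> = \<Delta> n \<inter> (\<Union>i\<in>{i. i < length x \<and> x ! i = v}. {t. 0 < t i})"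
      by auto
    also have "openin (top_of_set (\<Delta> n)) \<dots>"
    proof (intro openin_open_Int open_UN ballI)
      show "open {t :: nat \<Rightarrow> real. 0 < t i}" for i
        by (rule open_Collect_less[OF continuous_on_const
            continuous_on_product_then_coordinatewise[OF continuous_on_id]])
    qed
    finally show "openin (top_of_set (\<Delta> n)) {t \<in> \<Delta> n.
        (n, x, t) \<in> {p \<in> topspace (prerealization cplx). realization_rel cplx `` {p} \<in> open_star v}}" .
  qed auto
qed

lemma open_star_cover:
  assumes "c \<in> topspace cspace"
  shows "\<exists>v. c \<in> open_star v"
proof -
  obtain n x t where c: "c = cell cplx n x t" "length x = Suc n" "K (set x)" "t \<in> \<Delta> n"
    using assms by (rule topspace_cplxE)
  have "\<exists>i\<le>n. 0 < t i"
  proof (rule ccontr)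
    assume "\<not> (\<exists>i\<le>n. 0 < t i)"
    then have "(\<Sum>i\<le>n. t i) \<le> 0" by (intro sum_nonpos) auto
    then show False using c(4) by (simp add: standard_simplex_def)
  qed
  then obtain i where "i \<le> n" "0 < t i" by blast
  then have "c \<in> open_star (x ! i)"
    using c by (auto simp: cell_in_open_star support_def)
  then show ?thesis ..
qed

lemma open_star_simplex:
  assumes "\<And>v. v \<in> S \<Longrightarrow> c \<in> open_star v" "S \<noteq> {}"
  shows "K S"
proof -
  have "c \<in> topspace cspace" using assms by (auto simp: open_star_def)
  then obtain n x t where c: "c = cell cplx n x t" "length x = Suc n" "K (set x)" "t \<in> \<Delta> n"
    by (rule topspace_cplxE)
  then have "S \<subseteq> set x"
    using assms simplex_support_subset[of x t] by (auto simp: cell_in_open_star)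
  then show ?thesis using c(3) subset_closed by blast
qed

definition vertex :: "'a \<Rightarrow> 'a point" where
  "vertex v = cell cplx 0 [v] first_vertex"

lemma vertex_point_eq: "vertex_point cplx [v] = vertex v"
  by (simp add: vertex_point_def vertex_def cell_def first_vertex_def[abs_def])

text \<open>Appended entries have weight 0, so \<open>t\<close> is its own image under the inclusion
  of the last face.\<close>

lemma cell_append:
  assumes "length x = Suc n" "K (set (x @ y))" "t \<in> \<Delta> n"
  shows "cell cplx (n + length y) (x @ y) t = cell cplx n x t"
  using assms(2)
proof (induction y rule: rev_induct)
  case (snoc z y)
  have Ky: "K (set (x @ y))" using snoc.prems by (rule subset_closed) auto
  have t: "t \<in> \<Delta> (n + length y)"
    using assms(3) standard_simplex_mono[of n "n + length y"] by auto
  have "t j = 0" if "j > n" for j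
    using assms(3) that by (simp add: standard_simplex_def)
  then have "t = simplical_face (Suc (n + length y)) t"
    by (auto simp: simplical_face_def fun_eq_iff)
  then have "cell cplx (n + length (y @ [z])) (x @ y @ [z]) t =
      cell cplx (Suc (n + length y)) (x @ y @ [z]) (simplical_face (Suc (n + length y)) t)"
    by simp
  also have "\<dots> = cell cplx (n + length y) (x @ y) t"
    using tuples.cell_face[of "x @ y @ [z]" "n + length y" t "Suc (n + length y)"] t assms(1) snoc.prems by simp
  finally show ?case using snoc.IH Ky by simp
qed simp

lemma cell_first_vertex:
  assumes "length x = n" "K (set (v # x))"
  shows "cell cplx n (v # x) first_vertex = vertex v"
  using cell_append[of "[v]" 0 x first_vertex] assms by (simp add: vertex_def first_vertex_in_simplex)

lemma class_support_vertex: "K {v} \<Longrightarrow> class_support (vertex v) = {v}"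
  unfolding vertex_def
  by (subst class_support_cell) (auto simp: support_def first_vertex_def first_vertex_in_simplex)

lemma vertex_in_topspace: "K {v} \<Longrightarrow> vertex v \<in> topspace cspace"
  unfolding vertex_def by (intro cell_in_topspace) (auto simp: first_vertex_in_simplex)

lemma vertex_in_open_star: "K {v} \<Longrightarrow> vertex v \<in> open_star w \<longleftrightarrow> v = w"
  by (auto simp: open_star_def class_support_vertex vertex_in_topspace)

definition edge :: "'a \<Rightarrow> 'a \<Rightarrow> real \<Rightarrow> 'a point" where
  "edge u v s = cell cplx (Suc 0) [u, v] (segment s)"

lemma edge_ends:
  assumes "K {u, v}"
  shows "edge u v 0 = vertex u" "edge u v 1 = vertex v"
  using cell_first_vertex[of "[v]" "Suc 0" u] tuples.cell_face[of "[u, v]" 0 first_vertex 0] assms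
  by (simp_all add: edge_def segment_ends first_vertex_in_simplex vertex_def)

lemma pathin_edge: "K {u, v} \<Longrightarrow> pathin cspace (edge u v)"
  unfolding pathin_def edge_def[abs_def]
  by (rule continuous_map_compose[OF _ continuous_map_cell, unfolded o_def])
    (auto intro: continuous_on_segment continuous_on_id segment_in_simplex)

lemma class_support_edge:
  assumes "K {u, v}" "s \<in> {0..1}"
  shows "class_support (edge u v s) \<subseteq> {u, v}"
  using assms simplex_support_subset[of "[u, v]" "segment s"]
  by (simp add: edge_def class_support_cell segment_in_simplex)

lemma edge_degenerate: "K {u} \<Longrightarrow> s \<in> {0..1} \<Longrightarrow> edge u u s = vertex u"
  using tuples.cell_degen[of "[u]" 0 "segment s" 0]
  by (simp add: edge_def vertex_def segment_in_simplex segment_collapse)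

text \<open>Contracts the star of \<open>v\<close> by shifting weight to a new entry
  \<open>v\<close> in front. Since \<open>v\<close> already occurs in \<open>x\<close>, the longer
  tuple spans the same simplex of \<open>K\<close>. On the star the chosen representative does not
  matter, by \<open>cone_cell\<close>.\<close>

definition cone :: "'a \<Rightarrow> 'a point \<Rightarrow> real \<Rightarrow> 'a point" where
  "cone v c s = (case SOME p. p \<in> c of (n, x, t) \<Rightarrow> cell cplx (Suc n) (v # x) (cone_coords s t))"

lemma K_cone: "v \<in> support x t \<Longrightarrow> K (set x) \<Longrightarrow> K (set (v # x))"
  using simplex_support_subset[of x t] by (auto simp: insert_absorb)

lemma cone_cell:
  assumes x: "length x = Suc n" "K (set x)" "t \<in> \<Delta> n" and v: "v \<in> support x t"
    and s: "s \<in> {0..1}"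
  shows "cone v (cell cplx n x t) s = cell cplx (Suc n) (v # x) (cone_coords s t)"
proof -
  \<comment> \<open>The default \<open>{}\<close> outside the star makes \<open>f\<close> a total
    function, whose invariance can be tested on all gluings.\<close>
  define f where "f = (\<lambda>(n, x, t). if v \<in> support x t then cell cplx (Suc n) (v # x) (cone_coords s t) else {})"
  have inv: "f p = f q" if "(p, q) \<in> realization_rel cplx" for p q
    using that
  proof (rule gluing_invariant[rotated 2])
    fix n x t i
    assume a: "length x = Suc (Suc n)" "K (set x)" "t \<in> \<Delta> n" "i \<le> Suc n"
    show "f (Suc n, x, simplical_face i t) = f (n, take i x @ drop (Suc i) x, t)"
    proof (cases "v \<in> support x (simplical_face i t)")
      case True
      have "cell cplx (Suc (Suc n)) (v # x) (simplical_face (Suc i) (cone_coords s t)) =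
          cell cplx (Suc n) (v # (take i x @ drop (Suc i) x)) (cone_coords s t)"
        using tuples.cell_face[of "v # x" "Suc n" "cone_coords s t" "Suc i"] a s K_cone[OF True]
        by (simp add: cone_coords_in_simplex)
      then show ?thesis
        using a True by (simp add: f_def cone_coords_face flip: simplex_support_face)
    next
      case False
      then show ?thesis
        using a by (simp add: f_def flip: simplex_support_face)
    qed
  next
    fix n x t i
    assume a: "length x = Suc n" "K (set x)" "t \<in> \<Delta> (Suc n)" "i \<le> n"
    have supp: "support x (simplex_collapse i t) = support (take (Suc i) x @ drop i x) t"
      using a by (intro simplex_support_degen) (auto simp: standard_simplex_def)
    show "f (n, x, simplex_collapse i t) = f (Suc n, take (Suc i) x @ drop i x, t)"
    proof (cases "v \<in> support x (simplex_collapse i t)")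
      case True
      have "cell cplx (Suc n) (v # x) (simplex_collapse (Suc i) (cone_coords s t)) =
          cell cplx (Suc (Suc n)) (v # (take (Suc i) x @ drop i x)) (cone_coords s t)"
        using tuples.cell_degen[of "v # x" "Suc n" "cone_coords s t" "Suc i"] a s K_cone[OF True]
        by (simp add: cone_coords_in_simplex)
      then show ?thesis
        using True supp by (simp add: f_def cone_coords_collapse)
    next
      case False
      then show ?thesis
        using supp by (simp add: f_def)
    qed
  qed
  define p where "p = (SOME p. p \<in> cell cplx n x t)"
  have "(n, x, t) \<in> cell cplx n x t" using x by (intro mem_cell) auto
  then have "p \<in> cell cplx n x t" unfolding p_def by (rule someI)
  then have "f (n, x, t) = f p" by (intro inv) (simp add: cell_def)
  \<comment> \<open>Nonempty, hence different from the default of \<open>f\<close>: the chosen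
    representative \<open>p\<close> also has \<open>v\<close> in its support.\<close>
  moreover have "cell cplx (Suc n) (v # x) (cone_coords s t) \<noteq> {}"
    using mem_cell[of "v # x" cplx "Suc n" "cone_coords s t"] x s K_cone[OF v] cone_coords_in_simplex by auto
  ultimately show ?thesis
    using v by (auto simp: cone_def f_def p_def[symmetric] split: if_splits prod.splits)
qed

end

section \<open>Stars and cones\<close>

lemma continuous_map_prerealization_coord:
  "continuous_map (prerealization X) euclideanreal (\<lambda>p. snd (snd p) j)"
  unfolding continuous_map_def
proof (intro conjI allI impI)
  fix V :: "real set" assume "openin euclidean V"
  then have V: "open V" by simp
  show "openin (prerealization X) {p \<in> topspace (prerealization X). snd (snd p) j \<in> V}"
  proof (rule openin_prerealization)
    fix n x assume "x \<in> simplices X n"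
    then have "{t \<in> \<Delta> n. (n, x, t) \<in> {p \<in> topspace (prerealization X). snd (snd p) j \<in> V}}
        = \<Delta> n \<inter> (\<lambda>t. t j) -` V"
      by (auto simp: topspace_prerealization)
    moreover have "open ((\<lambda>t :: nat \<Rightarrow> real. t j) -` V)"
      by (rule open_vimage[OF V continuous_on_product_then_coordinatewise[OF continuous_on_id]])
    ultimately show "openin (top_of_set (\<Delta> n))
        {t \<in> \<Delta> n. (n, x, t) \<in> {p \<in> topspace (prerealization X). snd (snd p) j \<in> V}}"
      by (simp add: openin_open_Int)
  qed auto
qed auto

lemma continuous_map_into_functions:
  fixes f :: "'a \<Rightarrow> nat \<Rightarrow> real"
  assumes "\<And>i. continuous_map X euclideanreal (\<lambda>z. f z i)"
  shows "continuous_map X euclidean f"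
  using assms by (simp add: continuous_map_componentwise_UNIV flip: euclidean_product_topology)

context subset_closed
begin

lemma cone_ends:
  assumes "c \<in> open_star v"
  shows "cone v c 0 = c" "cone v c 1 = vertex v"
proof -
  have "c \<in> topspace cspace" using assms by (simp add: open_star_def)
  then obtain n x t where c: "c = cell cplx n x t" "length x = Suc n" "K (set x)" "t \<in> \<Delta> n"
    by (rule topspace_cplxE)
  have v: "v \<in> support x t" using assms c by (simp add: cell_in_open_star)
  have K: "K (set (v # x))" using v c(3) by (rule K_cone)
  show "cone v c 0 = c"
    using tuples.cell_face[of "v # x" n t 0] c K by (simp add: cone_cell v cone_coords_0)
  show "cone v c 1 = vertex v"
    using cell_first_vertex[of x "Suc n" v] c K by (simp add: cone_cell v cone_coords_1)
qed

lemma cone_vertex: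
  assumes "K {v}" "s \<in> {0..1}"
  shows "cone v (vertex v) s = vertex v"
proof -
  have "cone v (vertex v) s = cell cplx (Suc 0) [v, v] (segment (1 - s))"
    unfolding vertex_def using assms
    by (subst cone_cell) (auto simp: segment_def support_def first_vertex_def first_vertex_in_simplex)
  also have "\<dots> = vertex v"
    using edge_degenerate[of v "1 - s"] assms by (simp add: edge_def)
  finally show ?thesis .
qed

text \<open>Only here does it matter that the product of a quotient map with the identity of a locally
  compact space is a quotient map.\<close>

lemma continuous_map_cone:
  "continuous_map (prod_topology (subtopology cspace (open_star v)) (top_of_set {0..1}))
     cspace (\<lambda>(c, s). cone v c s)"
proof -
  define U where "U = {p \<in> topspace (prerealization cplx). realization_rel cplx `` {p} \<in> open_star v}"
  let ?P = "subtopology (prerealization cplx) U" and ?I = "top_of_set {0..1::real}"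
  let ?g = "\<lambda>z. cone v (realization_rel cplx `` {fst z}) (snd z)"
  have "quotient_map ?P (subtopology cspace (open_star v)) (\<lambda>p. realization_rel cplx `` {p})"
    using quotient_map_realization U_def[symmetric] openin_open_star by (intro quotient_map_restriction) auto
  then have quot: "quotient_map (prod_topology ?P ?I)
      (prod_topology (subtopology cspace (open_star v)) ?I)
      (\<lambda>(p, s). (realization_rel cplx `` {p}, s))"
    by (intro quotient_map_prod_left)
      (auto intro!: compact_imp_locally_compact_space simp: compact_space_subtopology compactin_subtopology Hausdorff_space_subtopology)
  \<comment> \<open>Upstairs the star is a disjoint union of open pieces, one for each simplex
    containing \<open>v\<close>; on a piece \<open>cone\<close> is \<open>cell\<close> after
    \<open>cone_coords\<close>.\<close>
  define J where "J = {(n, x). x \<in> simplices cplx n \<and> v \<in> set x}"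
  define T where "T = (\<lambda>(n, x). {p \<in> U. fst p = n \<and> fst (snd p) = x} \<times> {0..1::real})"
  have U: "U \<subseteq> topspace (prerealization cplx)" by (auto simp: U_def)
  have "continuous_map (prod_topology ?P ?I) cspace ?g"
  proof (rule pasting_lemma[where I = J and T = T and f = "\<lambda>_. ?g"])
    fix i assume "i \<in> J"
    then obtain n x where i: "i = (n, x)" "x \<in> simplices cplx n" "v \<in> set x" by (auto simp: J_def)
    have "openin (prerealization cplx) {p \<in> topspace (prerealization cplx). fst p = n \<and> fst (snd p) = x}"
    proof (rule openin_prerealization)
      fix m y assume "y \<in> simplices cplx m"
      then have "{t \<in> \<Delta> m. (m, y, t) \<in> {p \<in> topspace (prerealization cplx). fst p = n \<and> fst (snd p) = x}}
          = (if m = n \<and> y = x then \<Delta> m else {})"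
        by (auto simp: topspace_prerealization)
      then show "openin (top_of_set (\<Delta> m))
          {t \<in> \<Delta> m. (m, y, t) \<in> {p \<in> topspace (prerealization cplx). fst p = n \<and> fst (snd p) = x}}"
        by simp
    qed auto
    then have "openin ?P ({p \<in> topspace (prerealization cplx). fst p = n \<and> fst (snd p) = x} \<inter> U)"
      by (rule openin_subtopology_Int)
    moreover have "{p \<in> topspace (prerealization cplx). fst p = n \<and> fst (snd p) = x} \<inter> U = {p \<in> U. fst p = n \<and> fst (snd p) = x}"
      using U by blast
    ultimately show "openin (prod_topology ?P ?I) (T i)"
      unfolding T_def i by (simp add: openin_prod_Times_iff)
    let ?Q = "subtopology (prod_topology ?P ?I) (T i)"
    have memT: "\<exists>t. p = (n, x, t) \<and> t \<in> \<Delta> n \<and> v \<in> support x t \<and> s \<in> {0..1}"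
      if "(p, s) \<in> T i" for p s
      using that i(2) U
      by (auto simp: T_def i(1) U_def topspace_prerealization cell_def[symmetric] cell_in_open_star)
    have vx: "v # x \<in> simplices cplx (Suc n)" using i by (auto simp: insert_absorb)
    have "continuous_map ?Q euclidean (\<lambda>z. cone_coords (snd z) (snd (snd (fst z))))"
    proof (rule continuous_map_into_functions)
      fix k
      have s: "continuous_map ?Q euclideanreal snd"
        using continuous_map_snd[of ?P ?I] continuous_map_in_subtopology
        by (intro continuous_map_from_subtopology) blast
      have t: "continuous_map ?Q euclideanreal (\<lambda>z. snd (snd (fst z)) j)" for j
      proof -
        have "continuous_map ?P euclideanreal (\<lambda>p. snd (snd p) j)"
          by (rule continuous_map_from_subtopology) (rule continuous_map_prerealization_coord)
        from continuous_map_compose[OF continuous_map_fst this]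
        show ?thesis by (intro continuous_map_from_subtopology) (simp add: o_def)
      qed
      show "continuous_map ?Q euclideanreal (\<lambda>z. cone_coords (snd z) (snd (snd (fst z))) k)"
      proof (cases k)
        case 0
        then show ?thesis using s by (simp add: cone_coords_def)
      next
        case (Suc j)
        then show ?thesis
          by (simp add: cone_coords_def) (intro continuous_map_real_mult continuous_map_diff s t, simp)
      qed
    qed
    moreover have "cone_coords (snd z) (snd (snd (fst z))) \<in> \<Delta> (Suc n)" if "z \<in> topspace ?Q" for z
      using that memT[of "fst z" "snd z"] by (auto intro!: cone_coords_in_simplex)
    ultimately have "continuous_map ?Q (top_of_set (\<Delta> (Suc n))) (\<lambda>z. cone_coords (snd z) (snd (snd (fst z))))"
      by (auto simp: continuous_map_in_subtopology)
    from continuous_map_compose[OF this continuous_map_cell[OF vx]]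
    show "continuous_map ?Q cspace ?g"
    proof (rule continuous_map_eq)
      fix z assume "z \<in> topspace ?Q"
      then obtain t where "fst z = (n, x, t)" "t \<in> \<Delta> n" "v \<in> support x t" "snd z \<in> {0..1}"
        using memT[of "fst z" "snd z"] by auto
      then show "(cell cplx (Suc n) (v # x) \<circ> (\<lambda>z. cone_coords (snd z) (snd (snd (fst z))))) z = ?g z"
        using cone_cell[of x n t v "snd z"] i(2) by (simp add: cell_def)
    qed
  next
    fix z assume "z \<in> topspace (prod_topology ?P ?I)"
    then obtain n x t s where z: "z = ((n, x, t), s)" "(n, x, t) \<in> U" "s \<in> {0..1}"
      by (cases z) auto
    then have "x \<in> simplices cplx n" "v \<in> support x t"
      using cell_in_open_star[of x n t v] by (auto simp: U_def topspace_prerealization cell_def)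
    then have "(n, x) \<in> J" using simplex_support_subset[of x t] by (auto simp: J_def)
    then show "\<exists>i. i \<in> J \<and> z \<in> T i \<and> ?g z = ?g z"
      using z by (intro exI[of _ "(n, x)"]) (auto simp: T_def)
  qed auto
  then have "continuous_map (prod_topology ?P ?I) cspace
      ((\<lambda>(c, s). cone v c s) \<circ> (\<lambda>(p, s). (realization_rel cplx `` {p}, s)))"
    by (simp add: o_def split_def)
  then show ?thesis by (rule continuous_compose_quotient_map[OF quot])
qed

lemma pathin_cone:
  assumes "c \<in> open_star v"
  shows "pathin cspace (cone v c)"
proof -
  have "continuous_map (top_of_set {0..1::real})
      (prod_topology (subtopology cspace (open_star v)) (top_of_set {0..1})) (\<lambda>s. (c, s))"
    using assms by (intro continuous_map_pairedI) (auto simp: open_star_def)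
  from continuous_map_compose[OF this continuous_map_cone]
  show ?thesis by (simp add: pathin_def o_def)
qed

text \<open>Apply the cone to the rectangle with sides \<open>[a, b]\<close> and
  \<open>[0, 1]\<close>. Its two boundary routes from \<open>(a, 0)\<close> to \<open>(b, 1)\<close>
  are homotopic, and the side at height 1 is mapped to the constant \<open>vertex v\<close>.\<close>

lemma star_path_homotopic:
  assumes f: "pathin cspace f" and ab: "0 \<le> a" "a \<le> b" "b \<le> 1"
    and star: "\<And>t. a \<le> t \<Longrightarrow> t \<le> b \<Longrightarrow> f t \<in> open_star v"
  shows "homotopic
    (path_join (\<lambda>t. f (a + t * (b - a))) (cone v (f b))) (cone v (f a))"
proof -
  let ?R = "realization cplx"
  define Z where "Z = {a..b} \<times> {0..1::real}"
  define F where "F = (\<lambda>z. cone v (f (fst z)) (snd z))"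
  have fab: "continuous_map (top_of_set {a..b}) (subtopology ?R (open_star v)) f"
    using f ab star unfolding pathin_def continuous_map_in_subtopology
    by (auto elim!: continuous_map_from_subtopology_mono)
  have "continuous_map (top_of_set Z) (top_of_set {a..b}) fst"
    by (auto simp: Z_def intro!: continuous_on_fst continuous_on_id)
  from continuous_map_compose[OF this fab]
  have "continuous_map (top_of_set Z) (subtopology ?R (open_star v)) (\<lambda>z. f (fst z))"
    by (simp add: o_def)
  moreover have "continuous_map (top_of_set Z) (top_of_set {0..1}) snd"
    by (auto simp: Z_def intro: continuous_intros)
  ultimately have "continuous_map (top_of_set Z) (prod_topology (subtopology ?R (open_star v)) (top_of_set {0..1}))
      (\<lambda>z. (f (fst z), snd z))"
    by (rule continuous_map_pairedI)
  from continuous_map_compose[OF this continuous_map_cone]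
  have F: "continuous_map (top_of_set Z) ?R F" by (simp add: F_def o_def)
  \<comment> \<open>\<open>p1\<close> and \<open>p2\<close> are the lower and right sides of the
    rectangle, \<open>q1\<close> and \<open>q2\<close> the left and upper ones.\<close>
  define p1 p2 q1 q2 where "p1 t = (a + t * (b - a), 0::real)" "p2 s = (b, s)" "q1 s = (a, s)"
    "q2 t = (a + t * (b - a), 1::real)" for s t :: real
  have mem: "a \<le> a + t * (b - a)" "a + t * (b - a) \<le> b" if "t \<in> {0..1}" for t
    using that ab mult_right_mono[of t 1 "b - a"] by auto
  have paths: "pathin (top_of_set Z) p1" "pathin (top_of_set Z) p2" "pathin (top_of_set Z) q1" "pathin (top_of_set Z) q2"
    using mem ab by (auto simp: pathin_def p1_p2_q1_q2_def Z_def intro!: continuous_intros)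
  have join: "pathin (top_of_set Z) (path_join p1 p2)" "pathin (top_of_set Z) (path_join q1 q2)"
    using paths by (auto intro!: pathin_path_join simp: p1_p2_q1_q2_def)
  have "path_homotopic (top_of_set Z) (path_join p1 p2) (path_join q1 q2)"
  proof (rule path_homotopic_convex)
    show "convex Z" unfolding Z_def by (intro convex_Times) auto
  qed (use join in \<open>auto simp: pathin_def p1_p2_q1_q2_def\<close>)
  then have FF: "homotopic (path_join (F \<circ> p1) (F \<circ> p2)) (path_join (F \<circ> q1) (F \<circ> q2))"
    unfolding path_join_compose using F by (rule path_homotopic_compose)
  have "homotopic (path_join (F \<circ> p1) (F \<circ> p2)) (path_join (\<lambda>t. f (a + t * (b - a))) (cone v (f b)))"
  proof (rule path_homotopic_eq)
    fix t :: real assume "0 \<le> t" "t \<le> 1"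
    then show "path_join (F \<circ> p1) (F \<circ> p2) t = path_join (\<lambda>t. f (a + t * (b - a))) (cone v (f b)) t"
      using mem[of "2 * t"] star by (simp add: path_join_def F_def p1_p2_q1_q2_def cone_ends)
  qed (rule path_homotopicD[OF FF])
  moreover have "homotopic (path_join (F \<circ> q1) (F \<circ> q2)) (path_join (cone v (f a)) (\<lambda>_. cone v (f a) 1))"
  proof (rule path_homotopic_eq)
    fix t :: real assume "0 \<le> t" "t \<le> 1"
    then show "path_join (F \<circ> q1) (F \<circ> q2) t = path_join (cone v (f a)) (\<lambda>_. cone v (f a) 1) t"
      using mem[of "2 * t - 1"] star ab by (simp add: path_join_def F_def p1_p2_q1_q2_def cone_ends)
  qed (rule path_homotopicD[OF FF])
  moreover have "homotopic (path_join (cone v (f a)) (\<lambda>_. cone v (f a) 1)) (cone v (f a))"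
    using star[of a] ab by (intro path_homotopic_rid pathin_cone) auto
  ultimately show ?thesis
    using FF by (meson path_homotopic_sym path_homotopic_trans)
qed

text \<open>If three paths lift to the same simplex, the straight line homotopy there can be pushed
  forward by \<open>cell\<close>.\<close>

lemma simplex_path_homotopic:
  assumes x: "x \<in> simplices cplx n"
    and "continuous_on {0..1} a" "continuous_on {0..1} b" "continuous_on {0..1} c"
    and "a ` {0..1} \<subseteq> \<Delta> n" "b ` {0..1} \<subseteq> \<Delta> n" "c ` {0..1} \<subseteq> \<Delta> n"
    and "a 1 = b 0" "c 0 = a 0" "c 1 = b 1"
    and p: "\<And>s. s \<in> {0..1} \<Longrightarrow> p s = cell cplx n x (a s)"
    and q: "\<And>s. s \<in> {0..1} \<Longrightarrow> q s = cell cplx n x (b s)"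
    and r: "\<And>s. s \<in> {0..1} \<Longrightarrow> r s = cell cplx n x (c s)"
  shows "homotopic (path_join p q) r"
proof -
  let ?F = "cell cplx n x"
  have "pathin (top_of_set (\<Delta> n)) (path_join a b)"
    using assms by (intro pathin_path_join) (auto simp: pathin_def)
  then have "path_homotopic (top_of_set (\<Delta> n)) (path_join a b) c"
    using assms by (intro path_homotopic_simplex) (auto simp: pathin_def)
  then have h: "homotopic (path_join (?F \<circ> a) (?F \<circ> b)) (?F \<circ> c)"
    unfolding path_join_compose by (rule path_homotopic_compose) (rule continuous_map_cell[OF x])
  have "homotopic (path_join (?F \<circ> a) (?F \<circ> b)) (path_join p q)"
    by (rule path_homotopic_eq[OF path_homotopicD(1)[OF h]]) (simp add: path_join_def p q)
  moreover have "homotopic (?F \<circ> c) r"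
    by (rule path_homotopic_eq[OF path_homotopicD(2)[OF h]]) (simp add: r)
  ultimately show ?thesis using h by (meson path_homotopic_sym path_homotopic_trans)
qed

text \<open>All three paths lift to the tuple \<open>v # w # x\<close>, which spans a simplex of
  \<open>K\<close> because \<open>v\<close> and \<open>w\<close> occur in \<open>x\<close>
  already.\<close>

lemma cone_edge_homotopic:
  assumes v: "c \<in> open_star v" and w: "c \<in> open_star w"
  shows "homotopic (path_join (cone v c) (edge v w)) (cone w c)"
proof -
  have "c \<in> topspace cspace" using assms by (simp add: open_star_def)
  then obtain n x t where c: "c = cell cplx n x t" "length x = Suc n" "K (set x)" "t \<in> \<Delta> n"
    by (rule topspace_cplxE)
  have v: "v \<in> support x t" and w: "w \<in> support x t"
    using assms c by (simp_all add: cell_in_open_star)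
  then have set: "v \<in> set x" "w \<in> set x" using simplex_support_subset[of x t] by auto
  have K: "K (set (v # w # x))" "K (set (v # x))" "K (set (w # x))"
    using set c(3) by (simp_all add: insert_absorb)
  have face_simplex: "simplical_face i u \<in> \<Delta> (Suc (Suc n))"
    if "u \<in> \<Delta> (Suc n)" "i \<le> 1" for u i
    using that by (intro simplical_face_simplex) auto
  show ?thesis
  proof (rule simplex_path_homotopic[of "v # w # x" "Suc (Suc n)"])
    show "continuous_on {0..1} (\<lambda>s. cone_coords s (cone_coords 0 t))"
      "continuous_on {0..1} (\<lambda>s. segment s)" "continuous_on {0..1} (\<lambda>s. cone_coords 0 (cone_coords s t))"
      by (intro continuous_on_cone_coords continuous_on_segment continuous_on_id continuous_on_const)+
    show "(\<lambda>s. cone_coords s (cone_coords 0 t)) ` {0..1} \<subseteq> \<Delta> (Suc (Suc n))"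
      "(\<lambda>s. cone_coords 0 (cone_coords s t)) ` {0..1} \<subseteq> \<Delta> (Suc (Suc n))"
      using c(4) by (auto intro!: cone_coords_in_simplex)
    show "(\<lambda>s. segment s) ` {0..1} \<subseteq> \<Delta> (Suc (Suc n))"
      using segment_in_simplex standard_simplex_mono[of "Suc 0" "Suc (Suc n)"] by fastforce
    show "cone_coords 1 (cone_coords 0 t) = segment 0"
      by (simp add: cone_coords_1 segment_ends)
    show "cone_coords 0 (cone_coords 1 t) = segment 1"
      by (simp add: cone_coords_0 cone_coords_1 segment_ends)
    fix s :: real assume s: "s \<in> {0..1}"
    have cc: "cone_coords s t \<in> \<Delta> (Suc n)" using c(4) s by (rule cone_coords_in_simplex)
    show "cone v c s = cell cplx (Suc (Suc n)) (v # w # x) (cone_coords s (cone_coords 0 t))"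
      using tuples.cell_face[of "v # w # x" "Suc n" "cone_coords s t" "Suc 0"] cc K c s v
      by (simp add: cone_coords_0 cone_coords_face cone_cell)
    show "edge v w s = cell cplx (Suc (Suc n)) (v # w # x) (segment s)"
      using cell_append[of "[v, w]" "Suc 0" x "segment s"] K c s by (simp add: edge_def segment_in_simplex)
    show "cone w c s = cell cplx (Suc (Suc n)) (v # w # x) (cone_coords 0 (cone_coords s t))"
      using tuples.cell_face[of "v # w # x" "Suc n" "cone_coords s t" 0] cc K c s w
      by (simp add: cone_coords_0[of "cone_coords s t"] cone_cell)
  qed (use K c in auto)
qed

lemma edge_triangle_homotopic:
  assumes K: "K {u, v, w}"
  shows "homotopic (path_join (edge u v) (edge v w)) (edge u w)"
proof -
  have K2: "K {u, v}" "K {v, w}" "K {u, w}" using K by (auto intro: subset_closed)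
  show ?thesis
  proof (rule simplex_path_homotopic[where x = "[u, v, w]" and n = 2 and a = segment
        and b = "\<lambda>s. simplical_face 0 (segment s)" and c = "\<lambda>s. simplical_face 1 (segment s)"])
    have "continuous_on {0..1} (\<lambda>s. simplical_face i (segment s))" for i
    proof (rule continuous_on_coordinatewise_then_product)
      fix j
      have "continuous_on {0..1} (\<lambda>s. segment s k)" for k
        by (rule continuous_on_product_then_coordinatewise[OF continuous_on_segment[OF continuous_on_id]])
      then show "continuous_on {0..1} (\<lambda>s. simplical_face i (segment s) j)"
        by (cases "j < i"; cases "j = i") (simp_all add: simplical_face_def)
    qed
    then show "continuous_on {0..1} (\<lambda>s. simplical_face 0 (segment s))" "continuous_on {0..1} (\<lambda>s. simplical_face 1 (segment s))"
      by auto
    show "continuous_on {0..1} segment" using continuous_on_segment[OF continuous_on_id] .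
    show "segment ` {0..1} \<subseteq> \<Delta> 2"
      using segment_in_simplex standard_simplex_mono[of "Suc 0" 2] by fastforce
    show "(\<lambda>s. simplical_face 0 (segment s)) ` {0..1} \<subseteq> \<Delta> 2"
      "(\<lambda>s. simplical_face 1 (segment s)) ` {0..1} \<subseteq> \<Delta> 2"
      using simplical_face_simplex[OF segment_in_simplex, of _ 0] simplical_face_simplex[OF segment_in_simplex, of _ 1]
      by (auto simp: numeral_2_eq_2)
    show "segment 1 = simplical_face 0 (segment 0)" "simplical_face 1 (segment 1) = simplical_face 0 (segment 1)"
      "simplical_face 1 (segment 0) = segment 0"
      by (auto simp: segment_ends simplical_face_def first_vertex_def fun_eq_iff)
    fix s :: real assume s: "s \<in> {0..1}"
    show "edge u v s = cell cplx 2 [u, v, w] (segment s)"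
      using cell_append[of "[u, v]" "Suc 0" "[w]" "segment s"] K s
      by (simp add: edge_def segment_in_simplex numeral_2_eq_2)
    show "edge v w s = cell cplx 2 [u, v, w] (simplical_face 0 (segment s))"
      "edge u w s = cell cplx 2 [u, v, w] (simplical_face 1 (segment s))"
      using tuples.cell_face[of "[u, v, w]" "Suc 0" "segment s" 0] tuples.cell_face[of "[u, v, w]" "Suc 0" "segment s" 1] K s
      by (simp_all add: edge_def segment_in_simplex numeral_2_eq_2)
  qed (use K in auto)
qed

end

section \<open>Simplicial approximation\<close>

lemma square_grid:
  assumes h: "continuous_map (top_of_set ({0..1::real} \<times> {0..1::real})) T h"
    and cover: "\<And>c. c \<in> topspace T \<Longrightarrow> \<exists>v. c \<in> S v" and "open": "\<And>v. openin T (S v)"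
  shows "\<exists>N0>0. \<forall>N\<ge>N0. \<forall>i<N. \<forall>j<N. \<exists>v. \<forall>s\<in>{real i / real N..real (Suc i) / real N}.
           \<forall>t\<in>{real j / real N..real (Suc j) / real N}. h (s, t) \<in> S v"
proof -
  let ?J = "{0..1::real} \<times> {0..1::real}"
  have "\<exists>U. open U \<and> {z \<in> ?J. h z \<in> S v} = ?J \<inter> U" for v
  proof -
    have "openin (top_of_set ?J) {z \<in> topspace (top_of_set ?J). h z \<in> S v}"
      using h "open" by (rule openin_continuous_map_preimage)
    then show ?thesis by (simp add: openin_open)
  qed
  then obtain U where U: "\<And>v. open (U v)" "\<And>v. {z \<in> ?J. h z \<in> S v} = ?J \<inter> U v" by metis
  have "?J \<subseteq> \<Union> (range U)"
  proof
    fix z assume z: "z \<in> ?J"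
    then have "h z \<in> topspace T" using h by (auto simp: continuous_map_def)
    then obtain v where "h z \<in> S v" using cover by blast
    then have "z \<in> U v" using U(2)[of v] z by blast
    then show "z \<in> \<Union> (range U)" by blast
  qed
  then obtain \<delta> where \<delta>: "0 < \<delta>" "\<And>A. A \<subseteq> ?J \<Longrightarrow> diameter A < \<delta> \<Longrightarrow> \<exists>B\<in>range U. A \<subseteq> B"
    by (rule Lebesgue_number_lemma[of ?J "range U", rotated 2]) (use U(1) in \<open>auto intro: compact_Times\<close>)
  \<comment> \<open>A square of side \<open>1 / N\<close> has diameter at most \<open>2 / N\<close>,
    the sum of the bounds for its two coordinates.\<close>
  obtain N0 :: nat where N0: "2 / \<delta> < real N0" using reals_Archimedean2 by blast
  then have "0 < N0" using \<delta>(1) by (cases N0) (auto simp: field_simps)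
  moreover have "\<exists>v. \<forall>s\<in>{real i / real N..real (Suc i) / real N}. \<forall>t\<in>{real j / real N..real (Suc j) / real N}. h (s, t) \<in> S v"
    if N: "N0 \<le> N" "i < N" "j < N" for N i j
  proof -
    have "0 < real N" "2 / \<delta> < real N" using N N0 by auto
    then have N\<delta>: "2 / real N < \<delta>" using \<delta>(1) by (simp add: field_simps)
    let ?A = "{real i / real N..real (Suc i) / real N} \<times> {real j / real N..real (Suc j) / real N}"
    have sub: "?A \<subseteq> ?J"
    proof -
      have "0 \<le> real i / real N" "real (Suc i) / real N \<le> 1" if "i < N" for i
        using that by auto
      from this[OF N(2)] this[OF N(3)] show ?thesis by (intro Sigma_mono) auto
    qed
    have width: "real (Suc i) / real N - real i / real N = 1 / real N" for i
      by (simp add: diff_divide_distrib[symmetric])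
    have "norm (z - z') \<le> 2 / real N" if "z \<in> ?A" "z' \<in> ?A" for z z'
    proof -
      have "norm (z - z') \<le> norm (fst z - fst z') + norm (snd z - snd z')"
        using norm_triangle_ineq[of "(fst z - fst z', 0)" "(0, snd z - snd z')"]
        by (simp add: minus_prod_def norm_Pair)
      moreover have "\<bar>fst z - fst z'\<bar> \<le> 1 / real N" "\<bar>snd z - snd z'\<bar> \<le> 1 / real N"
        using that width[of i] width[of j] by (auto simp: abs_le_iff mem_Times_iff)
      ultimately show ?thesis by (simp add: field_simps)
    qed
    then have "diameter ?A \<le> 2 / real N" by (intro diameter_le) auto
    then obtain v where "?A \<subseteq> U v" using \<delta>(2)[OF sub] N\<delta> by fastforce
    then have "h z \<in> S v" if "z \<in> ?A" for z using that sub U(2)[of v] by blast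
    then show ?thesis by (intro exI[of _ v]) auto
  qed
  ultimately show ?thesis by blast
qed

context subset_closed
begin

fun path_of :: "'a list \<Rightarrow> real \<Rightarrow> 'a point" where
  "path_of (u # v # p) = path_join (edge u v) (path_of (v # p))"
| "path_of p = (\<lambda>_. vertex (hd p))"

lemma edge_path_ConsD:
  assumes "edge_path K (u # p)" "p \<noteq> []"
  shows "K {u, hd p}" "edge_path K p"
proof -
  show uv: "K {u, hd p}" using assms by (auto simp: edge_path_def successively_Cons)
  have "K {hd p}" by (rule subset_closed[OF uv]) auto
  then show "edge_path K p" using assms by (auto simp: edge_path_def successively_Cons)
qed

lemma path_of:
  assumes "edge_path K p"
  shows "pathin cspace (path_of p) \<and> path_of p 0 = vertex (hd p) \<and> path_of p 1 = vertex (last p)"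
  using assms
proof (induction p rule: path_of.induct)
  case (1 u v p)
  have uv: "K {u, v}" "edge_path K (v # p)" using edge_path_ConsD[OF 1(2)] by auto
  then show ?case using 1(1) by (auto intro!: pathin_path_join pathin_edge simp: edge_ends)
next
  case ("2_2" v)
  then show ?case by (auto simp: edge_path_def pathin_def vertex_in_topspace)
qed (simp add: edge_path_def)

lemma path_of_context:
  assumes "homotopic (path_of q) (path_of q')" "hd q = hd q'" "q \<noteq> []" "q' \<noteq> []"
    and "edge_path K (p @ q)"
  shows "homotopic (path_of (p @ q)) (path_of (p @ q'))"
  using assms(5)
proof (induction p)
  case Nil
  then show ?case using assms(1) by simp
next
  case (Cons u p)
  have uv: "K {u, hd (p @ q)}" "edge_path K (p @ q)"
    using edge_path_ConsD[of u "p @ q"] Cons.prems assms(3) by auto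
  have eq: "path_of (u # r) = path_join (edge u (hd r)) (path_of r)" if "r \<noteq> []" for r
    using that by (cases r) auto
  have "hd (p @ q) = hd (p @ q')" using assms by (simp add: hd_append)
  moreover have "homotopic
      (path_join (edge u (hd (p @ q))) (path_of (p @ q))) (path_join (edge u (hd (p @ q))) (path_of (p @ q')))"
    using uv path_of[OF uv(2)] by (intro path_homotopic_join Cons.IH path_homotopic_refl pathin_edge) (auto simp: edge_ends)
  ultimately show ?case
    using eq[of "p @ q"] eq[of "p @ q'"] assms(3,4) by simp
qed

text \<open>\<open>path_of\<close> nests to the right while simplicial approximation appends edges
  at the end; associativity moves the bracket.\<close>

lemma path_of_snoc:
  assumes "edge_path K (p @ [v])" "p \<noteq> []"
  shows "homotopic (path_of (p @ [v])) (path_join (path_of p) (edge (last p) v))"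
  using assms
proof (induction p rule: path_of.induct)
  case (1 u w p)
  have uw: "K {u, w}" "edge_path K (w # p @ [v])" using edge_path_ConsD[of u "w # p @ [v]"] 1(2) by auto
  then have p: "edge_path K (w # p)" "K {last (w # p), v}"
    by (auto simp: edge_path_def successively_append_iff successively_Cons hd_append split: if_splits)
  have "homotopic (path_join (edge u w) (path_of (w # p @ [v])))
      (path_join (edge u w) (path_join (path_of (w # p)) (edge (last (w # p)) v)))"
    using 1(1) uw path_of[OF uw(2)]
    by (intro path_homotopic_join path_homotopic_refl pathin_edge) (auto simp: edge_ends)
  also have "homotopic \<dots>
      (path_join (path_join (edge u w) (path_of (w # p))) (edge (last (w # p)) v))"
    using uw p path_of[OF p(1)]
    by (intro path_homotopic_sym[OF path_homotopic_assoc] pathin_edge) (auto simp: edge_ends)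
  finally show ?case by simp
next
  case ("2_2" u)
  then have uv: "K {u, v}" by (auto simp: edge_path_def)
  have "homotopic (path_join (edge u v) (\<lambda>_. edge u v 1)) (edge u v)"
    using uv by (intro path_homotopic_rid pathin_edge)
  moreover have "homotopic (path_join (\<lambda>_. edge u v 0) (edge u v)) (edge u v)"
    using uv by (intro path_homotopic_lid pathin_edge)
  ultimately show ?case
    using uv by (simp add: edge_ends) (meson path_homotopic_sym path_homotopic_trans)
qed simp

lemma path_of_step:
  assumes "edge_step K p q" "edge_path K p"
  shows "homotopic (path_of p) (path_of q)"
  using assms(1)
proof cases
  case (triangle u v w a b)
  have K: "K {u, v}" "K {v, w}" "K {u, w}" "K {w}"
    using triangle(3) by (auto intro: subset_closed)
  have wb: "edge_path K (w # b)"
    using assms(2) triangle K by (auto simp: edge_path_def successively_append_iff)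
  have "homotopic (path_of (u # v # w # b)) (path_of (u # w # b))"
  proof -
    have "homotopic (path_join (edge u v) (path_join (edge v w) (path_of (w # b))))
        (path_join (path_join (edge u v) (edge v w)) (path_of (w # b)))"
      using K path_of[OF wb] by (intro path_homotopic_sym[OF path_homotopic_assoc] pathin_edge) (auto simp: edge_ends)
    also have "homotopic \<dots> (path_join (edge u w) (path_of (w # b)))"
      using K path_of[OF wb] triangle(3)
      by (intro path_homotopic_join edge_triangle_homotopic path_homotopic_refl) (auto simp: edge_ends)
    finally show ?thesis by simp
  qed
  then show ?thesis
    unfolding triangle using assms(2) by (intro path_of_context) (auto simp: triangle)
next
  case (stutter u a b)
  have ub: "edge_path K (u # b)"
    using assms(2) stutter by (auto simp: edge_path_def successively_append_iff)
  have "K {u, u}" using stutter by simp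
  have "homotopic (path_join (edge u u) (path_of (u # b))) (path_of (u # b))"
  proof -
    have "homotopic (edge u u) (\<lambda>_. path_of (u # b) 0)"
      using path_of[OF ub] stutter edge_degenerate pathin_edge[OF \<open>K {u, u}\<close>]
      by (intro path_homotopic_eq) auto
    then have "homotopic (path_join (edge u u) (path_of (u # b)))
        (path_join (\<lambda>_. path_of (u # b) 0) (path_of (u # b)))"
      using path_of[OF ub] edge_ends[OF \<open>K {u, u}\<close>]
      by (intro path_homotopic_join path_homotopic_refl) auto
    also have "homotopic \<dots> (path_of (u # b))"
      using path_of[OF ub] by (intro path_homotopic_lid) auto
    finally show ?thesis .
  qed
  then have "homotopic (path_of (u # u # b)) (path_of (u # b))" by simp
  then show ?thesis
    unfolding stutter using assms(2) by (intro path_of_context) (auto simp: stutter)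
qed

lemma path_of_edge_homotopic:
  assumes "edge_homotopic K p q" "edge_path K p"
  shows "homotopic (path_of p) (path_of q)"
proof -
  have "edge_path K q \<and> homotopic (path_of p) (path_of q)"
    using assms unfolding edge_homotopic_def
  proof (induction rule: equivclp_induct)
    case base
    then show ?case using path_of by (simp add: path_homotopic_refl)
  next
    case (step y z)
    then have IH: "edge_path K y" "homotopic (path_of p) (path_of y)" by auto
    have "edge_path K z \<and> homotopic (path_of y) (path_of z)"
      using step(2)
    proof
      assume "edge_step K y z"
      then show ?thesis using edge_step_edge_path(1) path_of_step IH by blast
    next
      assume "edge_step K z y"
      then show ?thesis using edge_step_edge_path(1) path_of_step IH path_homotopic_sym by blast
    qed
    then show ?case using IH path_homotopic_trans by blast
  qed
  then show ?thesis by blast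
qed

text \<open>Simplicial approximation: cut \<open>f\<close> into pieces in open stars and push the division points to
  the centres of the stars along the cones.\<close>

lemma edge_path_approximation:
  assumes f: "pathin cspace f" "f 0 = vertex x" "f 1 = vertex y" and x: "K {x}" and y: "K {y}"
  shows "\<exists>p. edge_path K p \<and> hd p = x \<and> last p = y \<and> homotopic f (path_of p)"
proof -
  let ?R = "realization cplx"
  \<comment> \<open>A one-dimensional subdivision is the grid of a map that ignores its first
    coordinate.\<close>
  have "continuous_map (top_of_set ({0..1::real} \<times> {0..1::real})) ?R (f \<circ> snd)"
    by (rule continuous_map_compose[OF _ f(1)[unfolded pathin_def]]) (auto intro!: continuous_on_snd continuous_on_id)
  from square_grid[OF this open_star_cover openin_open_star]
  obtain N where N: "0 < N" and "\<forall>i<N. \<forall>j<N. \<exists>v. \<forall>s\<in>{real i / real N..real (Suc i) / real N}.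
      \<forall>t\<in>{real j / real N..real (Suc j) / real N}. f t \<in> open_star v"
    by auto
  then have "\<forall>j<N. \<exists>v. \<forall>t\<in>{real j / real N..real (Suc j) / real N}. f t \<in> open_star v"
    by (metis atLeastAtMost_iff divide_right_mono of_nat_0_le_iff of_nat_le_iff le_SucI order_refl)
  then obtain w where w: "\<And>j t. j < N \<Longrightarrow> real j / real N \<le> t \<Longrightarrow> t \<le> real (Suc j) / real N \<Longrightarrow> f t \<in> open_star (w j)"
    by (metis atLeastAtMost_iff)
  define q where "q j = real j / real N" for j
  have q: "0 \<le> q j" "q j \<le> q (Suc j)" "j \<le> N \<Longrightarrow> q j \<le> 1" "q 0 = 0" "q N = 1" for j
    using N by (auto simp: q_def divide_right_mono)
  have star: "f (q j) \<in> open_star (w j)" "f (q (Suc j)) \<in> open_star (w j)" if "j < N" for j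
    using w[OF that, of "q j"] w[OF that, of "q (Suc j)"] q(2)[of j] by (auto simp: q_def)
  \<comment> \<open>A vertex lies in no open star but its own, so the first and last centres are
    forced.\<close>
  have w0: "w 0 = x"
    using star(1)[OF N] f(2) x by (simp add: q(4) vertex_in_open_star)
  have wN: "w (N - 1) = y"
    using star(2)[of "N - 1"] N f(3) y by (simp add: q(5) vertex_in_open_star)
  have sub: "pathin ?R (\<lambda>t. f (a + t * (b - a)))" if "0 \<le> a" "a \<le> b" "b \<le> 1" for a b
  proof -
    have "a + t * (b - a) \<in> {0..1}" if "t \<in> {0..1}" for t
      using that \<open>0 \<le> a\<close> \<open>a \<le> b\<close> \<open>b \<le> 1\<close> mult_right_mono[of t 1 "b - a"] by auto
    then show ?thesis
      unfolding pathin_def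
      by (intro continuous_map_compose[OF _ f(1)[unfolded pathin_def], unfolded o_def])
        (auto intro!: continuous_intros)
  qed
  have sub0: "pathin ?R (\<lambda>t. f (t * b))" if "0 \<le> b" "b \<le> 1" for b
    using sub[of 0 b] that by simp
  have K: "K {w j, w (Suc j)}" if "Suc j < N" for j
    using star(2)[of j] star(1)[of "Suc j"] that by (intro open_star_simplex[of _ "f (q (Suc j))"]) auto
  \<comment> \<open>Up to time \<open>q (Suc j)\<close>, follow \<open>f\<close> and then the cone
    to the centre \<open>w j\<close>: this is homotopic to the edge path through the centres so
    far.\<close>
  have "edge_path K (map w [0..<Suc j]) \<and>
      homotopic (path_join (\<lambda>t. f (t * q (Suc j))) (cone (w j) (f (q (Suc j))))) (path_of (map w [0..<Suc j]))"
    if "j < N" for j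
    using that
  proof (induction j)
    case 0
    have "homotopic (path_join (\<lambda>t. f (q 0 + t * (q 1 - q 0))) (cone x (f (q 1)))) (cone x (f (q 0)))"
      using w[of 0] w0 N q(3)[of 1] q(2)[of 0] by (intro star_path_homotopic f) (auto simp: q_def)
    moreover have "homotopic (cone x (f (q 0))) (\<lambda>_. vertex x)"
      using star(1)[OF N] w0 x by (intro path_homotopic_eq pathin_cone) (auto simp: q(4) f(2) cone_vertex)
    ultimately show ?case
      using x w0 path_homotopic_trans by (auto simp: q(4) edge_path_def)
  next
    case (Suc j)
    let ?a = "q (Suc j)" and ?b = "q (Suc (Suc j))" and ?f = "\<lambda>t. f (t * q (Suc j))"
    have IH: "edge_path K (map w [0..<Suc j])"
      "homotopic (path_join ?f (cone (w j) (f ?a))) (path_of (map w [0..<Suc j]))"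
      using Suc by auto
    have j: "Suc j < N" by (rule Suc.prems)
    have ab: "0 \<le> ?a" "?a \<le> ?b" "?b \<le> 1" "?a \<le> 1" using q(1)[of "Suc j"] q(2)[of "Suc j"] q(3)[of "Suc (Suc j)"] q(3)[of "Suc j"] j by auto
    let ?g = "\<lambda>t. f (?a + t * (?b - ?a))"
    have pf: "pathin ?R ?f" using ab by (intro sub0)
    have pg: "pathin ?R ?g" using ab by (intro sub)
    have st: "f ?a \<in> open_star (w j)" "f ?a \<in> open_star (w (Suc j))" "f ?b \<in> open_star (w (Suc j))"
      using star(2)[of j] star(1)[of "Suc j"] star(2)[of "Suc j"] j by auto
    note pc = pathin_cone[OF st(1)] pathin_cone[OF st(2)] pathin_cone[OF st(3)]
    note ce = cone_ends[OF st(1)] cone_ends[OF st(2)] cone_ends[OF st(3)]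
    have e: "pathin ?R (edge (w j) (w (Suc j)))" "edge (w j) (w (Suc j)) 0 = vertex (w j)"
      using K[OF j] by (auto simp: pathin_edge edge_ends)
    have snoc: "edge_path K (map w [0..<Suc j] @ [w (Suc j)])"
      using IH(1) K[OF j] edge_path_snoc[of K "map w [0..<Suc j]" "w (Suc j)"]
      by (simp add: last_map del: upt_Suc)
    \<comment> \<open>Cut \<open>f\<close> at \<open>?a\<close>, contract the last piece in the star
      of \<open>w (Suc j)\<close>, and trade the cone to this centre for the cone to
      \<open>w j\<close> followed by an edge.\<close>
    have "homotopic (path_join (\<lambda>t. f (t * ?b)) (cone (w (Suc j)) (f ?b)))
        (path_join (path_join ?f ?g) (cone (w (Suc j)) (f ?b)))"
      using ab pc ce path_homotopic_sym[OF path_homotopic_join_subpath[OF f(1), of ?a ?b]]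
      by (intro path_homotopic_join path_homotopic_refl) auto
    also have "homotopic \<dots> (path_join ?f (path_join ?g (cone (w (Suc j)) (f ?b))))"
      using pf pg pc ce by (intro path_homotopic_assoc) auto
    also have "homotopic \<dots> (path_join ?f (cone (w (Suc j)) (f ?a)))"
      using ab w[of "Suc j"] j pf
      by (intro path_homotopic_join star_path_homotopic f path_homotopic_refl) (auto simp: q_def)
    also have "homotopic \<dots> (path_join ?f (path_join (cone (w j) (f ?a)) (edge (w j) (w (Suc j)))))"
      using pf ce by (intro path_homotopic_join path_homotopic_refl path_homotopic_sym[OF cone_edge_homotopic] st) auto
    also have "homotopic \<dots> (path_join (path_join ?f (cone (w j) (f ?a))) (edge (w j) (w (Suc j))))"
      using pf pc e ce by (intro path_homotopic_sym[OF path_homotopic_assoc]) auto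
    also have "homotopic \<dots> (path_join (path_of (map w [0..<Suc j])) (edge (w j) (w (Suc j))))"
      using e ce by (intro path_homotopic_join IH path_homotopic_refl) auto
    also have "homotopic \<dots> (path_of (map w [0..<Suc j] @ [w (Suc j)]))"
      using path_homotopic_sym[OF path_of_snoc[OF snoc]] by (simp add: last_map del: upt_Suc)
    finally show ?case
      using IH(1) K[OF j] edge_path_snoc[of K "map w [0..<Suc j]" "w (Suc j)"] by simp
  qed
  from this[of "N - 1"] have p: "edge_path K (map w [0..<N])"
    "homotopic (path_join f (cone y (vertex y))) (path_of (map w [0..<N]))"
    using N wN by (auto simp: q(5) f(3))
  have "homotopic (\<lambda>_. vertex y) (cone y (vertex y))"
    using y by (intro path_homotopic_eq) (auto simp: cone_vertex pathin_def vertex_in_topspace)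
  then have "homotopic (path_join f (\<lambda>_. f 1)) (path_join f (cone y (vertex y)))"
    using f by (intro path_homotopic_join path_homotopic_refl) auto
  then have "homotopic f (path_of (map w [0..<N]))"
    using path_homotopic_rid[OF f(1)] p(2) by (meson path_homotopic_sym path_homotopic_trans)
  moreover have "hd (map w [0..<N]) = x" "last (map w [0..<N]) = y"
    using N w0 wN by (auto simp: hd_map last_map)
  ultimately show ?thesis using p(1) by blast
qed

end

section \<open>Polygons and their null homotopies\<close>

context subset_closed
begin

text \<open>All edges take the same time, whereas the nested joins in \<open>path_of\<close> halve
  it. A uniform grid can thus subdivide every edge into the same number of parts.\<close>

primrec polygon :: "(nat \<Rightarrow> 'a) \<Rightarrow> nat \<Rightarrow> real \<Rightarrow> 'a point" where
  "polygon v 0 r = vertex (v 0)"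
| "polygon v (Suc m) r = (if r \<le> real m then polygon v m r else edge (v m) (v (Suc m)) (r - real m))"

lemma polygon_end:
  assumes "\<And>i. i < m \<Longrightarrow> K {v i, v (Suc i)}"
  shows "polygon v m (real m) = vertex (v m)"
  using assms by (cases m) (auto simp: edge_ends)

lemma polygon_edge:
  assumes "\<And>i. i < m \<Longrightarrow> K {v i, v (Suc i)}" "i < m" "real i \<le> r" "r \<le> real (Suc i)"
  shows "polygon v m r = edge (v i) (v (Suc i)) (r - real i)"
  using assms
proof (induction m)
  case (Suc m)
  show ?case
  proof (cases "i < m")
    case True
    then have "r \<le> real m" using Suc.prems(4) by linarith
    then show ?thesis using Suc True by auto
  next
    case False
    then have i: "i = m" using Suc.prems(2) by simp
    \<comment> \<open>At \<open>r = real m\<close> the definition still uses the previous edge; both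
      descriptions give \<open>vertex (v m)\<close>.\<close>
    then show ?thesis
      using Suc.prems polygon_end[of m v] by (cases "r = real m") (auto simp: edge_ends)
  qed
qed simp

lemma continuous_map_polygon:
  assumes "\<And>i. i < m \<Longrightarrow> K {v i, v (Suc i)}" "K {v 0}"
  shows "continuous_map (top_of_set {0..real m}) cspace (polygon v m)"
  using assms(1)
proof (induction m)
  case 0
  then show ?case using assms(2) by (simp add: vertex_in_topspace)
next
  case (Suc m)
  have uv: "K {v m, v (Suc m)}" using Suc.prems by simp
  show ?case
    unfolding polygon.simps
  proof (rule continuous_map_cases_le_const)
    have "{r \<in> {0..real (Suc m)}. r \<le> real m} = {0..real m}" by auto
    then show "continuous_map (top_of_set {r \<in> {0..real (Suc m)}. r \<le> real m}) cspace (polygon v m)"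
      using Suc by simp
    have "continuous_map (top_of_set {r \<in> {0..real (Suc m)}. real m \<le> r}) cspace
        (edge (v m) (v (Suc m)) \<circ> (\<lambda>r. r - real m))"
      by (rule continuous_map_compose[OF _ pathin_edge[OF uv, unfolded pathin_def]]) (auto intro!: continuous_intros)
    then show "continuous_map (top_of_set {r \<in> {0..real (Suc m)}. real m \<le> r}) cspace
        (\<lambda>r. edge (v m) (v (Suc m)) (r - real m))"
      by (simp add: o_def)
    show "polygon v m r = edge (v m) (v (Suc m)) (r - real m)" if "r = real m" for r
      using that polygon_end[of m v] Suc.prems uv by (simp add: edge_ends)
  qed (auto intro!: continuous_intros)
qed

lemma pathin_polygon:
  assumes "\<And>i. i < m \<Longrightarrow> K {v i, v (Suc i)}" "K {v 0}"
  shows "pathin cspace (\<lambda>t. polygon v m (real m * t))"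
  unfolding pathin_def
  by (rule continuous_map_compose[OF _ continuous_map_polygon[OF assms], unfolded o_def])
    (auto intro!: continuous_intros mult_left_le)

text \<open>On a fine grid a null homotopy maps every square to an open star. Reading off the centres row
  by row gives edge paths; neighbouring rows form a ladder because the four squares around a grid
  point share it. The grid is chosen as a refinement of the subdivision of the polygon.\<close>

lemma null_homotopic_polygon:
  assumes v: "\<And>i. i < m \<Longrightarrow> K {v i, v (Suc i)}" and m: "0 < m" and vx: "v 0 = x" "v m = x"
    and null: "homotopic (\<lambda>t. polygon v m (real m * t)) (\<lambda>_. vertex x)"
  shows "edge_homotopic K (map v [0..<Suc m]) [x]"
proof -
  have Kx: "K {x}" using v[of 0] m vx by (auto intro: subset_closed)
  have Kv: "K {v i}" if "i < m" for i using v[OF that] by (rule subset_closed) auto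
  obtain h where h: "continuous_map (top_of_set ({0..1::real} \<times> {0..1::real})) cspace h"
    and hb: "\<And>t. t \<in> {0..1} \<Longrightarrow> h (0, t) = polygon v m (real m * t) \<and> h (1, t) = vertex x \<and>
        h (t, 0) = vertex x \<and> h (t, 1) = vertex x"
    using null polygon_end[of m v] v vx unfolding path_homotopic_iff prod_topology_subtopology_eu
    using path_homotopicD(3,4)[OF null] by fastforce
  obtain L where L: "0 < L" and grid: "\<And>N. L \<le> N \<Longrightarrow> \<forall>i<N. \<forall>j<N. \<exists>v. \<forall>s\<in>{real i / real N..real (Suc i) / real N}.
      \<forall>t\<in>{real j / real N..real (Suc j) / real N}. h (s, t) \<in> open_star v"
    using square_grid[OF h open_star_cover openin_open_star] by metis
  \<comment> \<open>A multiple of \<open>m\<close>, so that the polygon has its vertices at grid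
    points, and at least \<open>L\<close>, so that the grid is fine enough.\<close>
  define N where "N = m * L"
  have N: "0 < N" "L \<le> N" using L m by (auto simp: N_def)
  obtain w where w: "\<And>i j s t. i < N \<Longrightarrow> j < N \<Longrightarrow> s \<in> {real i / real N..real (Suc i) / real N} \<Longrightarrow>
      t \<in> {real j / real N..real (Suc j) / real N} \<Longrightarrow> h (s, t) \<in> open_star (w i j)"
    using grid[OF N(2)] by metis
  define q where "q j = real j / real N" for j
  have q: "0 \<le> q j" "q j \<le> q (Suc j)" "j \<le> N \<Longrightarrow> q j \<le> 1" "q 0 = 0" "q N = 1" for j
    using N by (auto simp: q_def divide_right_mono)
  have corner: "h (q a, q b) \<in> open_star (w i j)"
    if "i < N" "j < N" "a = i \<or> a = Suc i" "b = j \<or> b = Suc j" for i j a b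
    using that q(2) by (intro w) (auto simp: q_def)
  have x_star: "vertex x \<in> open_star y \<longleftrightarrow> y = x" for y
    using Kx by (auto simp: vertex_in_open_star)
  \<comment> \<open>The rows need an entry at the last grid point \<open>N\<close>, where no square
    begins; there \<open>h\<close> is \<open>vertex x\<close>, which forces
    \<open>x\<close>.\<close>
  define r where "r i j = (if j < N then w i j else x)" for i j
  have r_corner: "h (q a, q b) \<in> open_star (r i j)"
    if "i < N" "a = i \<or> a = Suc i" "j < N \<and> (b = j \<or> b = Suc j) \<or> j = N \<and> b = N" for i j a b
  proof (cases "j < N")
    case True
    then show ?thesis using corner that by (auto simp: r_def)
  next
    case False
    then show ?thesis using that hb[of "q a"] q(1,3)[of a] q(5) by (auto simp: r_def x_star)
  qed
  have r0: "r i 0 = x" if "i < N" for i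
    using r_corner[of i i 0 0] that N hb[of "q i"] q(1,3)[of i] by (simp add: q(4) x_star)
  have rN: "r i N = x" for i by (simp add: r_def)
  have rows: "edge_homotopic K (map (r 0) [0..<Suc N]) (map (r i) [0..<Suc N])" if "i < N" for i
    using that
  proof (induction i)
    case (Suc i)
    have "edge_homotopic K (map (r i) [0..<Suc N]) (map (r (Suc i)) [0..<Suc N])"
    proof (rule ladder_edge_homotopic)
      fix j assume j: "j < N"
      have "Suc j < N \<or> Suc j = N" using j by auto
      then show "K {r i j, r i (Suc j), r (Suc i) j, r (Suc i) (Suc j)}"
        using Suc.prems j by (intro open_star_simplex[of _ "h (q (Suc i), q (Suc j))"]) (auto intro!: r_corner)
    qed (use Suc.prems N r0 rN in auto)
    then show ?case using Suc by (meson Suc_lessD edge_homotopic_trans)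
  qed simp
  \<comment> \<open>The last row touches the side where \<open>h\<close> is constantly
    \<open>vertex x\<close>.\<close>
  have "r (N - 1) j = x" if "j \<le> N" for j
  proof (cases "j < N")
    case True
    then show ?thesis
      using r_corner[of "N - 1" N j j] N hb[of "q j"] q(1,3)[of j] by (simp add: q(5) x_star)
  qed (simp add: r_def)
  then have "map (r (N - 1)) [0..<Suc N] = replicate (Suc N) x"
    by (intro nth_equalityI) (auto simp del: upt_Suc replicate_Suc)
  then have last_row: "edge_homotopic K (map (r (N - 1)) [0..<Suc N]) [x]"
    using replicate_edge_homotopic[OF Kx, of "[]" N "[]"] by simp
  \<comment> \<open>The vertices of the polygon, each repeated \<open>L\<close> times, and
    \<open>x\<close> at the end: a row of the same length as those of the grid.\<close>
  define b where "b j = (if j < N then v (j div L) else x)" for j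
  have "edge_homotopic K (map b [0..<Suc N]) (map (r 0) [0..<Suc N])"
  proof (rule ladder_edge_homotopic)
    fix j assume j: "j < N"
    define i where "i = j div L"
    have im: "i < m" using j L by (simp add: i_def N_def less_mult_imp_div_less)
    have ij: "i * L \<le> j" "Suc j \<le> Suc i * L"
      using L by (auto simp: i_def mult.commute dividend_less_times_div Suc_le_eq)
    have mq: "real m * q k = real k / real L" for k
      using m L by (simp add: q_def N_def)
    have poly: "h (0, q k) = edge (v i) (v (Suc i)) (real k / real L - real i) \<and> real k / real L - real i \<in> {0..1}"
      if k: "i * L \<le> k" "k \<le> Suc i * L" for k
    proof -
      have kr: "real i \<le> real k / real L" "real k / real L \<le> real (Suc i)"
        using k L by (simp_all only: pos_le_divide_eq pos_divide_le_eq of_nat_0_less_iff flip: of_nat_mult)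
      have "Suc i * L \<le> N" using im unfolding N_def by (intro mult_right_mono) auto
      then have "q k \<in> {0..1}" using q(1,3)[of k] k by auto
      then have "h (0, q k) = polygon v m (real k / real L)" using hb[of "q k"] mq by simp
      then show ?thesis using polygon_edge[of m v i "real k / real L"] v im kr by auto
    qed
    \<comment> \<open>A point of edge \<open>i\<close> lies only in the stars of its two ends. Hence
      the rung between \<open>b\<close> and the first row is contained in this edge.\<close>
    have supp: "y \<in> {v i, v (Suc i)}" if "h (0, q k) \<in> open_star y" "i * L \<le> k" "k \<le> Suc i * L" for k y
      using poly[OF that(2,3)] class_support_edge[OF v[OF im], of "real k / real L - real i"] that(1)
      by (auto simp: open_star_def)
    have rj: "r 0 j \<in> {v i, v (Suc i)}"
      using r_corner[of 0 0 j j] N j ij by (intro supp[of j]) (auto simp: q(4))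
    have "b (Suc j) \<in> {v i, v (Suc i)} \<and> r 0 (Suc j) \<in> {v i, v (Suc i)}"
    proof (cases "Suc j = Suc i * L")
      case True
      \<comment> \<open>The right grid point begins the block of the next edge, but it still belongs
        to the closed edge \<open>i\<close>.\<close>
      have "Suc j div L = Suc i" using True L by simp
      have "Suc j < N" if "Suc i \<noteq> m"
        using that im L unfolding True N_def by (intro mult_strict_right_mono) auto
      then have b: "b (Suc j) = v (Suc i)"
        using \<open>Suc j div L = Suc i\<close> True vx by (cases "Suc i = m") (auto simp: b_def N_def)
      have "h (0, q (Suc j)) \<in> open_star (r 0 (Suc j))"
        using r_corner[of 0 0 "Suc j" "Suc j"] N j by (cases "Suc j < N") (auto simp: q(4))
      then show ?thesis using b supp[of "Suc j" "r 0 (Suc j)"] ij by auto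
    next
      case False
      then have lt: "Suc j < Suc i * L" using ij by simp
      also have "\<dots> \<le> N" using im unfolding N_def by (intro mult_right_mono) auto
      finally have "Suc j < N" .
      moreover have "Suc j div L = i"
        using lt ij by (intro div_nat_eqI) (auto simp: mult.commute)
      ultimately show ?thesis
        using r_corner[of 0 0 "Suc j" "Suc j"] N ij supp[of "Suc j" "r 0 (Suc j)"] by (auto simp: b_def q(4))
    qed
    moreover have "b j = v i" using j by (simp add: b_def i_def)
    ultimately show "K {b j, b (Suc j), r 0 j, r 0 (Suc j)}"
      using rj by (intro subset_closed[OF v[OF im]]) auto
  qed (use N r0 rN vx in \<open>auto simp: b_def\<close>)
  moreover have "map b [0..<Suc N] = map (\<lambda>j. v (j div L)) [0..<m * L] @ [v m]"
    using vx by (simp add: b_def N_def)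
  moreover have "edge_homotopic K (map (\<lambda>j. v (j div L)) [0..<m * L] @ [v m]) (map v [0..<m] @ [v m])"
    using Kv L by (rule slow_path_edge_homotopic)
  ultimately have "edge_homotopic K (map v [0..<Suc m]) (map (r 0) [0..<Suc N])"
    by (auto intro: edge_homotopic_sym edge_homotopic_trans)
  also have "edge_homotopic K \<dots> (map (r (N - 1)) [0..<Suc N])" using N by (intro rows) auto
  also note last_row
  finally show ?thesis .
qed

end

section \<open>Homotopy groups\<close>

lemma trivial_on_homotopy_group_iff:
  assumes "continuous_map X Y \<phi>" "\<phi> x = y" "y \<in> topspace Y"
  shows "trivial_on_homotopy_group k X x \<phi> Y y \<longleftrightarrow>
    (\<forall>f \<in> spheroids k X x. (\<lambda>_. y, \<phi> \<circ> f) \<in> spheroid_homotopy k Y y)"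
proof -
  have const: "(\<lambda>_. y) \<in> spheroids k Y y"
    using assms(3) by (auto simp: spheroids_def)
  have eq: "homotopy_group_map k \<phi> Y y (spheroid_homotopy k X x `` {f}) = homotopy_group_one k Y y \<longleftrightarrow>
      (\<lambda>_. y, \<phi> \<circ> f) \<in> spheroid_homotopy k Y y" if f: "f \<in> spheroids k X x" for f
  proof -
    have "\<phi> \<circ> f \<in> spheroids k Y y"
      using f assms by (auto simp: spheroids_def intro: continuous_map_compose)
    then show ?thesis
      unfolding homotopy_group_map_class[OF assms(1,2) f] homotopy_group_one_def
      using eq_equiv_class_iff[OF equiv_spheroid_homotopy const, of "\<phi> \<circ> f"] by auto
  qed
  show ?thesis
    unfolding trivial_on_homotopy_group_def homotopy_group_def quotient_def
    using eq by blast
qed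

lemma topspace_cube_0: "topspace (cube 0) = {\<lambda>_. undefined}"
  by (simp add: cube_def)

text \<open>The 0-cube is a point without boundary: spheroids are points and homotopies are
  paths.\<close>

lemma trivial_on_homotopy_group_0_iff:
  assumes "continuous_map X Y \<phi>" "\<phi> x = y" "y \<in> topspace Y"
  shows "trivial_on_homotopy_group 0 X x \<phi> Y y \<longleftrightarrow>
    (\<forall>c \<in> topspace X. path_component_of Y y (\<phi> c))"
proof -
  have bd: "cube_boundary 0 = {}" by (auto simp: cube_boundary_def)
  have hom: "(f, g) \<in> spheroid_homotopy 0 Y y \<longleftrightarrow> homotopic_with (\<lambda>_. True) (cube 0) Y f g" for f g
    by (simp add: spheroid_homotopy_def bd)
  have nontriv: "cube 0 \<noteq> trivial_topology"
    using topspace_cube_0 by (metis empty_not_insert topspace_discrete_topology)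
  let ?u = "\<lambda>_. undefined"
  have "(\<lambda>_. y, \<phi> \<circ> f) \<in> spheroid_homotopy 0 Y y \<longleftrightarrow> path_component_of Y y (\<phi> (f ?u))"
    if f: "f \<in> spheroids 0 X x" for f
  proof -
    have "homotopic_with (\<lambda>_. True) (cube 0) Y (\<lambda>_. \<phi> (f ?u)) (\<phi> \<circ> f)"
    proof (rule homotopic_with_equal)
      have "f ?u \<in> topspace X"
        using f topspace_cube_0 by (auto simp: spheroids_def continuous_map_def)
      then show "continuous_map (cube 0) Y (\<lambda>_. \<phi> (f ?u))"
        using assms(1) by (auto simp: continuous_map_def)
    qed (auto simp: topspace_cube_0)
    then have "(\<lambda>_. y, \<phi> \<circ> f) \<in> spheroid_homotopy 0 Y y \<longleftrightarrow>
        homotopic_with (\<lambda>_. True) (cube 0) Y (\<lambda>_. y) (\<lambda>_. \<phi> (f ?u))"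
      unfolding hom by (meson homotopic_with_symD homotopic_with_trans)
    then show ?thesis using nontriv by (simp add: homotopic_constant_maps)
  qed
  moreover have "(\<lambda>_. c) \<in> spheroids 0 X x" if "c \<in> topspace X" for c
    using that by (auto simp: spheroids_def bd)
  moreover have "f ?u \<in> topspace X" if "f \<in> spheroids 0 X x" for f
    using that topspace_cube_0 by (auto simp: spheroids_def continuous_map_def)
  ultimately show ?thesis
    unfolding trivial_on_homotopy_group_iff[OF assms] by (metis (no_types, lifting))
qed

lemma trivial_on_homotopy_group_1_iff:
  assumes "continuous_map X Y \<phi>" "\<phi> x = y" "y \<in> topspace Y"
  shows "trivial_on_homotopy_group (Suc 0) X x \<phi> Y y \<longleftrightarrow>
    (\<forall>f. pathin X f \<longrightarrow> f 0 = x \<longrightarrow> f 1 = x \<longrightarrow> path_homotopic Y (\<lambda>_. y) (\<phi> \<circ> f))"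
    (is "?l \<longleftrightarrow> ?r")
proof -
  \<comment> \<open>\<open>i\<close> and \<open>p\<close> identify the interval with the 1-cube,
    whose points are functions on \<open>{..<Suc 0}\<close>; \<open>i\<close> inverts
    \<open>p\<close> only on extensional functions, hence the restriction to the cube in
    \<open>ip\<close>.\<close>
  define i :: "real \<Rightarrow> nat \<Rightarrow> real" where "i t = (\<lambda>j\<in>{..<Suc 0}. t)" for t
  define p :: "(nat \<Rightarrow> real) \<Rightarrow> real" where "p u = u 0" for u
  let ?C = "cube (Suc 0)"
  have i: "continuous_map (top_of_set {0..1}) ?C i"
    unfolding cube_def i_def by (subst continuous_map_componentwise) (auto simp: continuous_map_id[unfolded id_def])
  have p: "continuous_map ?C (top_of_set {0..1}) p"
    unfolding cube_def p_def[abs_def] by (rule continuous_map_product_projection) simp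
  have pi: "p (i t) = t" for t by (simp add: p_def i_def)
  have ip: "i (p u) = u" if "u \<in> topspace ?C" for u
    using that by (auto simp: p_def i_def cube_def PiE_def extensional_def fun_eq_iff)
  have bd: "i 0 \<in> cube_boundary (Suc 0)" "i 1 \<in> cube_boundary (Suc 0)"
    using i by (auto simp: cube_boundary_def continuous_map_def i_def)
  have bdp: "p u = 0 \<or> p u = 1" if "u \<in> cube_boundary (Suc 0)" for u
    using that by (auto simp: cube_boundary_def p_def)
  have hom: "(f, g) \<in> spheroid_homotopy (Suc 0) Y y \<longleftrightarrow>
      homotopic_with (\<lambda>h. h ` cube_boundary (Suc 0) \<subseteq> {y}) ?C Y f g" for f g
    by (simp add: spheroid_homotopy_def)
  show ?thesis
    unfolding trivial_on_homotopy_group_iff[OF assms]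
  proof (intro iffI allI ballI impI)
    fix f assume sph: "\<forall>f\<in>spheroids (Suc 0) X x. (\<lambda>_. y, \<phi> \<circ> f) \<in> spheroid_homotopy (Suc 0) Y y"
      and f: "pathin X f" "f 0 = x" "f 1 = x"
    have "f \<circ> p \<in> spheroids (Suc 0) X x"
      using f bdp p by (force simp: spheroids_def pathin_def intro: continuous_map_compose)
    then have "homotopic_with (\<lambda>h. h ` cube_boundary (Suc 0) \<subseteq> {y}) ?C Y (\<lambda>_. y) (\<phi> \<circ> (f \<circ> p))"
      using sph hom by blast
    then have "homotopic_with (\<lambda>h. h 0 = y \<and> h 1 = y) (top_of_set {0..1}) Y ((\<lambda>_. y) \<circ> i) ((\<phi> \<circ> (f \<circ> p)) \<circ> i)"
      by (rule homotopic_with_compose_continuous_map_right[OF _ i]) (use bd in auto)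
    then show "path_homotopic Y (\<lambda>_. y) (\<phi> \<circ> f)"
      by (simp add: path_homotopic_def o_def pi)
  next
    fix f assume paths: "\<forall>f. pathin X f \<longrightarrow> f 0 = x \<longrightarrow> f 1 = x \<longrightarrow> path_homotopic Y (\<lambda>_. y) (\<phi> \<circ> f)"
      and f: "f \<in> spheroids (Suc 0) X x"
    have cont: "continuous_map ?C X f" using f by (simp add: spheroids_def)
    have "pathin X (f \<circ> i)" unfolding pathin_def by (rule continuous_map_compose[OF i cont])
    moreover have "(f \<circ> i) 0 = x" "(f \<circ> i) 1 = x" using f bd by (auto simp: spheroids_def)
    ultimately have "path_homotopic Y (\<lambda>_. y) (\<phi> \<circ> (f \<circ> i))" using paths by blast
    then have "homotopic_with (\<lambda>h. h ` cube_boundary (Suc 0) \<subseteq> {y}) ?C Y ((\<lambda>_. y) \<circ> p) ((\<phi> \<circ> (f \<circ> i)) \<circ> p)"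
      unfolding path_homotopic_def
      by (rule homotopic_with_compose_continuous_map_right[OF _ p]) (use bdp in force)
    moreover have "homotopic_with (\<lambda>h. h ` cube_boundary (Suc 0) \<subseteq> {y}) ?C Y (\<phi> \<circ> f) ((\<phi> \<circ> (f \<circ> i)) \<circ> p)"
    proof (rule homotopic_with_equal)
      show "continuous_map ?C Y (\<phi> \<circ> f)" using cont assms(1) by (rule continuous_map_compose)
      show "(\<phi> \<circ> f) ` cube_boundary (Suc 0) \<subseteq> {y}" using f assms(2) by (auto simp: spheroids_def)
      have "i (p u) = u" if "u \<in> cube_boundary (Suc 0)" for u
        using that ip by (simp add: cube_boundary_def)
      then show "((\<phi> \<circ> (f \<circ> i)) \<circ> p) ` cube_boundary (Suc 0) \<subseteq> {y}"
        using f assms(2) by (auto simp: spheroids_def)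
    qed (simp add: ip)
    ultimately have "homotopic_with (\<lambda>h. h ` cube_boundary (Suc 0) \<subseteq> {y}) ?C Y ((\<lambda>_. y) \<circ> p) (\<phi> \<circ> f)"
      by (meson homotopic_with_symD homotopic_with_trans)
    then show "(\<lambda>_. y, \<phi> \<circ> f) \<in> spheroid_homotopy (Suc 0) Y y"
      by (simp add: hom o_def)
  qed
qed

section \<open>Inclusions of complexes and their effect on homotopy groups\<close>

abbreviation trivial_inclusion :: "nat \<Rightarrow> ('a set \<Rightarrow> bool) \<Rightarrow> ('a set \<Rightarrow> bool) \<Rightarrow> 'a \<Rightarrow> bool" where
  "trivial_inclusion k K K' x \<equiv> trivial_on_homotopy_group k (realization (tuple_sset K)) (vertex_point (tuple_sset K) [x])
     (realization_inclusion (tuple_sset K) (tuple_sset K'))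
     (realization (tuple_sset K')) (vertex_point (tuple_sset K') [x])"

locale complex_inclusion = small: subset_closed K + large: subset_closed K' for K K' :: "'a set \<Rightarrow> bool" +
  assumes sub: "K S \<Longrightarrow> K' S"
begin

abbreviation incl where
  "incl \<equiv> realization_inclusion (tuple_sset K) (tuple_sset K')"

lemma simplicial_subset_tuple: "simplicial_subset (tuple_sset K) (tuple_sset K')"
  unfolding simplicial_subset_def
  using small.tuples.simplicial_set_axioms large.tuples.simplicial_set_axioms sub
  by (auto simp: fun_eq_iff)

lemma incl_cell:
  assumes "x \<in> simplices (tuple_sset K) n" "t \<in> \<Delta> n"
  shows "incl (cell (tuple_sset K) n x t) = cell (tuple_sset K') n x t"
  unfolding cell_def using assms
  by (intro realization_inclusion_class simplicial_subset_tuple) (simp add: topspace_prerealization)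

lemma incl_vertex: "K {v} \<Longrightarrow> incl (small.vertex v) = large.vertex v"
  by (simp add: small.vertex_def large.vertex_def incl_cell first_vertex_in_simplex)

lemma incl_edge: "K {u, v} \<Longrightarrow> s \<in> {0..1} \<Longrightarrow> incl (small.edge u v s) = large.edge u v s"
  by (simp add: small.edge_def large.edge_def incl_cell segment_in_simplex)

lemma continuous_map_incl:
  "continuous_map (realization (tuple_sset K)) (realization (tuple_sset K')) incl"
proof (rule continuous_compose_quotient_map[OF quotient_map_realization])
  let ?P = "prerealization (tuple_sset K)" and ?P' = "prerealization (tuple_sset K')"
  have "continuous_map ?P ?P' (\<lambda>p. p)"
    unfolding continuous_map_def
  proof (intro conjI allI impI)
    show "(\<lambda>p. p) \<in> topspace ?P \<rightarrow> topspace ?P'"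
      using sub by (auto simp: topspace_prerealization)
    fix U assume U: "openin ?P' U"
    show "openin ?P {p \<in> topspace ?P. p \<in> U}"
    proof (rule openin_prerealization)
      fix n x assume x: "x \<in> simplices (tuple_sset K) n"
      then have x': "x \<in> simplices (tuple_sset K') n" using sub by simp
      have "continuous_map (top_of_set (\<Delta> n)) ?P' (\<lambda>t. (n, x, t))"
        using x' by (rule continuous_map_prerealization_simplex)
      from openin_continuous_map_preimage[OF this U]
      show "openin (top_of_set (\<Delta> n)) {t \<in> \<Delta> n. (n, x, t) \<in> {p \<in> topspace ?P. p \<in> U}}"
        using x by (simp add: topspace_prerealization conj_ac cong: conj_cong)
    qed auto
  qed
  from continuous_map_compose[OF this quotient_imp_continuous_map[OF quotient_map_realization]]
  show "continuous_map ?P (realization (tuple_sset K')) (incl \<circ> (\<lambda>p. realization_rel (tuple_sset K) `` {p}))"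
    by (rule continuous_map_eq) (simp add: realization_inclusion_class[OF simplicial_subset_tuple])
qed

lemma edge_path_large: "edge_path K p \<Longrightarrow> edge_path K' p"
  using sub by (auto simp: edge_path_def elim: successively_mono)

lemma incl_path_of:
  assumes "edge_path K p" "t \<in> {0..1}"
  shows "incl (small.path_of p t) = large.path_of p t"
  using assms
proof (induction p arbitrary: t rule: small.path_of.induct)
  case (1 u v p)
  have "K {u, v}" "edge_path K (v # p)" using small.edge_path_ConsD[OF 1(2)] by auto
  then show ?case using 1 by (auto simp: path_join_def incl_edge)
next
  case ("2_2" v)
  then show ?case by (simp add: edge_path_def incl_vertex)
qed (simp add: edge_path_def)

lemma incl_polygon:
  assumes "\<And>i. i < m \<Longrightarrow> K {v i, v (Suc i)}" "K {v 0}" "r \<in> {0..real m}"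
  shows "incl (small.polygon v m r) = large.polygon v m r"
  using assms(1,3)
proof (induction m)
  case 0
  then show ?case using assms(2) by (simp add: incl_vertex)
next
  case (Suc m)
  then show ?case by (auto simp: incl_edge)
qed

text \<open>Every point is joined by a cone to a vertex whose star contains it, so only vertices
  need to be connected.\<close>

lemma trivial_0_iff:
  assumes x: "K {x}"
  shows "trivial_inclusion 0 K K' x \<longleftrightarrow>
    (\<forall>v. K {v} \<longrightarrow> (\<exists>p. edge_path K' p \<and> hd p = x \<and> last p = v))"
proof -
  let ?R = "realization (tuple_sset K)" and ?R' = "realization (tuple_sset K')"
  have x': "K' {x}" using x by (rule sub)
  have connected: "path_component_of ?R' (large.vertex x) (large.vertex v) \<longleftrightarrow>
      (\<exists>p. edge_path K' p \<and> hd p = x \<and> last p = v)" if v: "K' {v}" for v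
    unfolding path_component_of_def
    using large.edge_path_approximation[OF _ _ _ x' v] large.path_of by blast
  have near: "\<exists>v. K {v} \<and> path_component_of ?R' (large.vertex v) (incl c)" if c: "c \<in> topspace ?R" for c
  proof -
    obtain v where v: "c \<in> small.open_star v" using small.open_star_cover[OF c] by blast
    have "K {v}" using small.open_star_simplex[of "{v}" c] v by auto
    have "path_component_of ?R c (small.vertex v)"
      unfolding path_component_of_def using small.pathin_cone[OF v] small.cone_ends[OF v] by blast
    then have "path_component_of ?R' (incl c) (large.vertex v)"
      using path_component_of_continuous_image[OF continuous_map_incl] incl_vertex[OF \<open>K {v}\<close>] by metis
    then show ?thesis using \<open>K {v}\<close> path_component_of_sym by metis
  qed
  have "(\<forall>c \<in> topspace ?R. path_component_of ?R' (large.vertex x) (incl c)) \<longleftrightarrow>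
      (\<forall>v. K {v} \<longrightarrow> path_component_of ?R' (large.vertex x) (large.vertex v))" (is "?a \<longleftrightarrow> ?b")
  proof
    assume ?a
    then show ?b using small.vertex_in_topspace incl_vertex by metis
  next
    assume b: ?b
    show ?a
    proof
      fix c assume "c \<in> topspace ?R"
      then obtain v where v: "K {v}" "path_component_of ?R' (large.vertex v) (incl c)" using near by metis
      from b v(1) have "path_component_of ?R' (large.vertex x) (large.vertex v)" by simp
      then show "path_component_of ?R' (large.vertex x) (incl c)"
        using v(2) by (rule path_component_of_trans)
    qed
  qed
  then show ?thesis
    unfolding small.vertex_point_eq large.vertex_point_eq
      trivial_on_homotopy_group_0_iff[OF continuous_map_incl incl_vertex[OF x] large.vertex_in_topspace[OF x']]
    using connected sub by metis
qed

text \<open>From left to right the edge path is realized at equal speed, as the grid argument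
  requires. From right to left a loop is approximated in the small complex first, and the
  combinatorial homotopy in the large one is realized afterwards.\<close>

lemma trivial_1_iff:
  assumes x: "K {x}"
  shows "trivial_inclusion (Suc 0) K K' x \<longleftrightarrow>
    (\<forall>p. edge_path K p \<longrightarrow> hd p = x \<longrightarrow> last p = x \<longrightarrow> edge_homotopic K' p [x])" (is "?l \<longleftrightarrow> ?r")
proof -
  let ?R = "realization (tuple_sset K)" and ?R' = "realization (tuple_sset K')"
  have x': "K' {x}" using x by (rule sub)
  have l: "?l \<longleftrightarrow> (\<forall>f. pathin ?R f \<longrightarrow> f 0 = small.vertex x \<longrightarrow> f 1 = small.vertex x \<longrightarrow>
      path_homotopic ?R' (\<lambda>_. large.vertex x) (incl \<circ> f))"
    unfolding small.vertex_point_eq large.vertex_point_eq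
    by (rule trivial_on_homotopy_group_1_iff[OF continuous_map_incl incl_vertex[OF x] large.vertex_in_topspace[OF x']])
  show ?thesis
  proof
    assume L: ?l
    show ?r
    proof (intro allI impI)
      fix p assume p: "edge_path K p" "hd p = x" "last p = x"
      then obtain q where q: "p = x # q" by (cases p) (auto simp: edge_path_def)
      show "edge_homotopic K' p [x]"
      \<comment> \<open>The one-vertex path is already \<open>[x]\<close>; the grid argument needs
        at least one edge.\<close>
      proof (cases "q = []")
        case False
        define m where "m = length q"
        define v where "v i = p ! i" for i
        have m: "0 < m" "length p = Suc m" using False q by (simp_all add: m_def)
        have pv: "p = map v [0..<Suc m]"
          using m by (intro nth_equalityI) (auto simp: v_def simp del: upt_Suc)
        have v: "v 0 = x" "v m = x"
          using p m q by (auto simp: v_def last_conv_nth)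
        have K: "K {v i, v (Suc i)}" if "i < m" for i
          using p(1) that m successively_nth[of "\<lambda>u v. K {u, v}" p i] by (simp add: edge_path_def v_def)
        let ?f = "\<lambda>t. small.polygon v m (real m * t)"
        have "pathin ?R ?f" using K x v(1) by (intro small.pathin_polygon) auto
        moreover have "?f 0 = small.vertex x" "?f 1 = small.vertex x"
          using small.polygon_end[of m v] small.polygon_edge[of m v 0 0] small.edge_ends(1)[OF K[of 0]] K v m by auto
        ultimately have ph: "path_homotopic ?R' (\<lambda>_. large.vertex x) (incl \<circ> ?f)"
          using L l by blast
        have "path_homotopic ?R' (incl \<circ> ?f) (\<lambda>t. large.polygon v m (real m * t))"
        proof (rule path_homotopic_eq[OF path_homotopicD(2)[OF ph]])
          fix t :: real assume "0 \<le> t" "t \<le> 1"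
          then have "real m * t \<in> {0..real m}" by (simp add: mult_left_le)
          then show "(incl \<circ> ?f) t = large.polygon v m (real m * t)"
            using incl_polygon[of m v "real m * t"] K x v by simp
        qed
        then have "path_homotopic ?R' (\<lambda>t. large.polygon v m (real m * t)) (\<lambda>_. large.vertex x)"
          using ph by (meson path_homotopic_sym path_homotopic_trans)
        then show ?thesis
          unfolding pv using K sub m v by (intro large.null_homotopic_polygon) auto
      qed (simp add: q)
    qed
  next
    assume R: ?r
    show ?l
      unfolding l
    proof (intro allI impI)
      fix f assume f: "pathin ?R f" "f 0 = small.vertex x" "f 1 = small.vertex x"
      obtain p where p: "edge_path K p" "hd p = x" "last p = x" "path_homotopic ?R f (small.path_of p)"
        using small.edge_path_approximation[OF f x x] by blast
      have c: "path_homotopic ?R' (incl \<circ> f) (incl \<circ> small.path_of p)"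
        using p(4) continuous_map_incl by (rule path_homotopic_compose)
      also have "path_homotopic ?R' \<dots> (large.path_of p)"
        using incl_path_of[OF p(1)] by (intro path_homotopic_eq path_homotopicD(2)[OF c]) auto
      also have "path_homotopic ?R' \<dots> (large.path_of [x])"
        using R p edge_path_large by (intro large.path_of_edge_homotopic) auto
      finally show "path_homotopic ?R' (\<lambda>_. large.vertex x) (incl \<circ> f)"
        by (simp add: path_homotopic_sym)
    qed
  qed
qed

end

section \<open>The invariants in terms of edge paths, and the theorem\<close>

lemma half_orbit_eq: "half_orbit chi C = tuple_sset (orbit_complex chi C)"
proof -
  have "(\<exists>g xs. ys = map ((+) g) xs \<and> g \<in> half chi \<and> length xs = Suc n \<and> set xs \<subseteq> C) \<longleftrightarrow>
      length ys = Suc n \<and> orbit_complex chi C (set ys)" for ys n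
  proof
    assume "length ys = Suc n \<and> orbit_complex chi C (set ys)"
    then obtain g where g: "g \<in> half chi" "set ys \<subseteq> (+) g ` C" "length ys = Suc n"
      by (auto simp: orbit_complex_def)
    have "ys = map ((+) g) (map (\<lambda>y. - g + y) ys)" by (simp add: map_idI)
    moreover have "set (map (\<lambda>y. - g + y) ys) \<subseteq> C" using g(2) by (auto simp: mem_left_translate)
    ultimately show "\<exists>g xs. ys = map ((+) g) xs \<and> g \<in> half chi \<and> length xs = Suc n \<and> set xs \<subseteq> C"
      using g by (metis length_map)
  qed (auto simp: orbit_complex_def; blast)
  then show ?thesis
    by (simp add: half_orbit_def tuple_sset_def E_sset_def)
qed

lemma Sigma_top_iff:
  "chi \<in> Sigma_top n \<longleftrightarrow> is_character chi \<and>
    (\<exists>x. \<forall>k<n. \<forall>C. compact C \<longrightarrow> orbit_complex chi C {x} \<longrightarrow>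
      (\<exists>D. compact D \<and> C \<subseteq> D \<and>
        trivial_inclusion k (orbit_complex chi C) (orbit_complex chi D) x))"
proof -
  have k: "int k \<le> int n - 1 \<longleftrightarrow> k < n" for k by auto
  have bex: "(\<exists>x\<in>simplices (E_sset UNIV) 0. P x) \<longleftrightarrow> (\<exists>x. P [x])" for P :: "'a list \<Rightarrow> bool"
    by (auto simp: E_sset_def length_Suc_conv)
  show ?thesis
    unfolding Sigma_top_def essentially_connected_def half_orbit_eq k mem_Collect_eq bex
    by (simp add: Ball_def Bex_def)
qed

lemma complex_inclusion_orbit: "C \<subseteq> D \<Longrightarrow> complex_inclusion (orbit_complex chi C) (orbit_complex chi D)"
  by unfold_locales (unfold orbit_complex_def, blast)

lemma trivial_0_orbit:
  assumes "C \<subseteq> D" "orbit_complex chi C {x}"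
  shows "trivial_inclusion 0 (orbit_complex chi C) (orbit_complex chi D) x \<longleftrightarrow>
    (\<forall>v. orbit_complex chi C {v} \<longrightarrow> (\<exists>p. edge_path (orbit_complex chi D) p \<and> hd p = x \<and> last p = v))"
  using complex_inclusion.trivial_0_iff[OF complex_inclusion_orbit] assms by blast

lemma trivial_1_orbit:
  assumes "C \<subseteq> D" "orbit_complex chi C {x}"
  shows "trivial_inclusion (Suc 0) (orbit_complex chi C) (orbit_complex chi D) x \<longleftrightarrow>
    (\<forall>p. edge_path (orbit_complex chi C) p \<longrightarrow> hd p = x \<longrightarrow> last p = x \<longrightarrow> edge_homotopic (orbit_complex chi D) p [x])"
  using complex_inclusion.trivial_1_iff[OF complex_inclusion_orbit] assms by blast

definition essentially_edge_connected :: "('a::topological_group_add \<Rightarrow> real) \<Rightarrow> 'a \<Rightarrow> bool" where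
  "essentially_edge_connected chi x \<longleftrightarrow>
     (\<forall>C. compact C \<longrightarrow> orbit_complex chi C {x} \<longrightarrow> (\<exists>D. compact D \<and> C \<subseteq> D \<and>
       (\<forall>v. orbit_complex chi C {v} \<longrightarrow> (\<exists>p. edge_path (orbit_complex chi D) p \<and> hd p = x \<and> last p = v))))"

definition essentially_edge_simply_connected :: "('a::topological_group_add \<Rightarrow> real) \<Rightarrow> 'a \<Rightarrow> bool" where
  "essentially_edge_simply_connected chi x \<longleftrightarrow>
     (\<forall>C. compact C \<longrightarrow> orbit_complex chi C {x} \<longrightarrow> (\<exists>D. compact D \<and> C \<subseteq> D \<and>
       (\<forall>p. edge_path (orbit_complex chi C) p \<longrightarrow> hd p = x \<longrightarrow> last p = x \<longrightarrow>
         edge_homotopic (orbit_complex chi D) p [x])))"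

lemma Sigma_top_1_iff:
  "chi \<in> Sigma_top 1 \<longleftrightarrow> is_character chi \<and> (\<exists>x. essentially_edge_connected chi x)"
  unfolding Sigma_top_iff essentially_edge_connected_def by (simp add: trivial_0_orbit cong: conj_cong)

lemma Sigma_top_2_iff:
  "chi \<in> Sigma_top 2 \<longleftrightarrow> is_character chi \<and>
    (\<exists>x. essentially_edge_connected chi x \<and> essentially_edge_simply_connected chi x)"
  unfolding Sigma_top_iff essentially_edge_connected_def essentially_edge_simply_connected_def
  by (simp add: numeral_2_eq_2 All_less_Suc trivial_0_orbit trivial_1_orbit cong: conj_cong)
    (auto simp: conj_ac)

lemma generates_imp_essentially_edge_connected:
  fixes chi :: "'a::topological_group_add \<Rightarrow> real"
  assumes "is_character chi" "compact X" "generates_along chi X"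
  shows "essentially_edge_connected chi 0"
  unfolding essentially_edge_connected_def
proof (intro allI impI)
  interpret additive_character chi using assms(1) by (rule is_character_additive)
  fix C :: "'a set" assume C: "compact C"
  let ?D = "insert 0 (X \<union> uminus ` X \<union> C)"
  have "compact ?D"
    using assms(2) C by (intro compact_insert compact_Un compact_continuous_image) (auto intro!: continuous_intros)
  then show "\<exists>D. compact D \<and> C \<subseteq> D \<and> (\<forall>v. orbit_complex chi C {v} \<longrightarrow>
      (\<exists>p. edge_path (orbit_complex chi D) p \<and> hd p = 0 \<and> last p = v))"
    using generates_along_connected[OF assms(3), of C ?D] by (intro exI[of _ ?D]) auto
qed

lemma orbit_complex_self:
  assumes "is_character chi" "x \<in> C"
  shows "orbit_complex chi C {x}"
proof -
  interpret additive_character chi using assms(1) by (rule is_character_additive)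
  show ?thesis
    using assms(2) unfolding orbit_complex_def by (intro bexI[of _ 0]) (auto simp: half_def mem_left_translate)
qed

text \<open>The stage \<open>C = {x}\<close> suffices: its vertices are the points
  \<open>h + x\<close> with \<open>h\<close> in the half space, which are those that
  \<open>connected_generates_along\<close> has to reach.\<close>

lemma essentially_edge_connected_imp_compactly_generated:
  assumes chi: "is_character chi" and x: "essentially_edge_connected chi x"
  shows "compactly_generated_along chi"
proof -
  interpret additive_character chi using chi by (rule is_character_additive)
  obtain D where D: "compact D" "{x} \<subseteq> D"
    and conn: "\<And>v. orbit_complex chi {x} {v} \<Longrightarrow> \<exists>p. edge_path (orbit_complex chi D) p \<and> hd p = x \<and> last p = v"
    using x orbit_complex_self[OF chi, of x "{x}"] unfolding essentially_edge_connected_def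
    by (metis compact_sing insertI1)
  have "compact ((\<lambda>(a, b). a - b) ` (D \<times> D))"
    using D(1) by (intro compact_continuous_image compact_Times) (auto simp: split_def intro!: continuous_intros)
  moreover have "(\<lambda>(a, b). a - b) ` (D \<times> D) = {a - b |a b. a \<in> D \<and> b \<in> D}" by auto
  moreover have "generates_along chi {a - b |a b. a \<in> D \<and> b \<in> D}"
  proof (rule connected_generates_along)
    show "x \<in> D" using D(2) by simp
    fix h assume "h \<in> half chi"
    then have "orbit_complex chi {x} {h + x}" by (auto simp: orbit_complex_def)
    then show "\<exists>p. edge_path (orbit_complex chi D) p \<and> hd p = x \<and> last p = h + x" by (rule conn)
  qed
  ultimately show ?thesis
    unfolding compactly_generated_along_def by metis
qed

theorem theorem3:
  fixes chi :: "'a::{topological_group_add, t2_space} \<Rightarrow> real"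
  assumes "locally_compact_space (euclidean :: 'a topology)"
    and "is_character chi"
  shows "(chi \<in> Sigma_top 1 \<longleftrightarrow> compactly_generated_along chi) \<and>
         (chi \<in> Sigma_top 2 \<longleftrightarrow> compactly_presented_along chi)"
proof (intro conjI iffI)
  assume "chi \<in> Sigma_top 1"
  then show "compactly_generated_along chi"
    using essentially_edge_connected_imp_compactly_generated unfolding Sigma_top_1_iff by blast
next
  assume "compactly_generated_along chi"
  then show "chi \<in> Sigma_top 1"
    using generates_imp_essentially_edge_connected assms(2)
    unfolding Sigma_top_1_iff compactly_generated_along_def by blast
next
  assume "chi \<in> Sigma_top 2"
  then obtain x where x: "essentially_edge_connected chi x" "essentially_edge_simply_connected chi x"
    unfolding Sigma_top_2_iff by blast
  obtain X where X: "compact X" "generates_along chi X"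
    using essentially_edge_connected_imp_compactly_generated[OF assms(2) x(1)]
    unfolding compactly_generated_along_def by blast
  show "compactly_presented_along chi"
    using assms X
  proof (rule edge_homotopic_imp_presented)
    fix C assume "compact C" "x \<in> C"
    then show "\<exists>D. compact D \<and> C \<subseteq> D \<and> (\<forall>p. edge_path (orbit_complex chi C) p \<longrightarrow> hd p = x \<longrightarrow> last p = x \<longrightarrow>
        edge_homotopic (orbit_complex chi D) p [x])"
      using x(2) orbit_complex_self[OF assms(2)] unfolding essentially_edge_simply_connected_def by blast
  qed
next
  assume "compactly_presented_along chi"
  then obtain X R N where XR: "presentation_along chi X R" "compact X" "\<And>r. r \<in> R \<Longrightarrow> length r \<le> N"
    unfolding compactly_presented_along_def by blast
  have "essentially_edge_connected chi 0"
    using XR assms(2) by (intro generates_imp_essentially_edge_connected) (auto simp: presentation_along_def)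
  moreover have "essentially_edge_simply_connected chi 0"
    unfolding essentially_edge_simply_connected_def
  proof (intro allI impI)
    fix C :: "'a set" assume C: "compact C"
    \<comment> \<open>The null homotopy result wants \<open>0\<close> in the compact set itself,
      while \<open>0\<close> being a vertex only puts it into some translate of \<open>C\<close>;
      hence \<open>insert 0 C\<close>.\<close>
    obtain D where D: "compact D" "insert 0 C \<subseteq> D"
      and null: "\<forall>p. edge_path (orbit_complex chi (insert 0 C)) p \<longrightarrow> hd p = 0 \<longrightarrow> last p = 0 \<longrightarrow>
        edge_homotopic (orbit_complex chi D) p [0]"
      using presented_imp_edge_homotopic[OF assms XR, of "insert 0 C"] C by auto
    have "edge_path (orbit_complex chi (insert 0 C)) p" if "edge_path (orbit_complex chi C) p" for p
      using complex_inclusion.edge_path_large[OF complex_inclusion_orbit that] by blast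
    then show "\<exists>D. compact D \<and> C \<subseteq> D \<and> (\<forall>p. edge_path (orbit_complex chi C) p \<longrightarrow> hd p = 0 \<longrightarrow> last p = 0 \<longrightarrow>
        edge_homotopic (orbit_complex chi D) p [0])"
      using D null by (intro exI[of _ D]) auto
  qed
  ultimately show "chi \<in> Sigma_top 2"
    unfolding Sigma_top_2_iff using assms(2) by blast
qed

end
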